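(* Let $q=e^{2\pi i/24}$, let $\mathcal{E}_4^{12}$ be the directed graph on vertices $1,\dots,11$ described in the context, with its Frobenius–Perron eigenvector $\lambda$, and let $W\in \operatorname{Hom}_{oGPA(\mathcal{E}_4^{12})}(-\to ++)$ be the explicit element given in the context. Let $t\in \operatorname{Hom}(-\to ++)$ denote the trivalent vertex generating the planar algebra $\mathcal{P}_{\overline{\operatorname{Rep}(U_q(\mathfrak{sl}_3))};\Lambda_1}$. Then the assignment $t\mapsto W$ (and correspondingly $t^\dagger\mapsto W^\dagger$) defines a tensor functor \[\mathcal{P}_{\overline{\operatorname{Rep}(U_q(\mathfrak{sl}_3))};\Lambda_1}\to oGPA(\mathcal{E}_4^{12}).\]
   Context: Notation. $[n]_q=\frac{q^n-q^{-n}}{q-q^{-1}}$ with $q=e^{2\pi i/24}$; $\zeta_\ell=e^{2\pi i/\ell}$; $\mathbf{i}=\sqrt{-1}$; all square roots are of positive reals and are the positive ones. $z$ is the root of $9x^{16}-14x^8+9$ closest to $-0.996393+0.0848571\,\mathbf{i}$. Planar algebras. A planar algebra is a strictly pivotal monoidal category whose objects are strings in the alphabet $\{+,-\}$ (tensor product of objects is concatenation, $+$ and $-$ are dual to each other, and there are distinguished maps $\operatorname{ev}_{(+,-)},\operatorname{ev}_{(-,+)},\operatorname{coev}_{(+,-)},\operatorname{coev}_{(-,+)}$). A tensor functor between planar algebras here is a linear strict monoidal functor that is the identity on objects and preserves these distinguished maps. For a pivotal tensor category $\mathcal{C}$ and object $X$, $\mathcal{P}_{\mathcal{C};X}$ is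 the planar algebra with $\operatorname{Hom}(s\to t)=\operatorname{Hom}_{\mathcal{C}}(X^{s_1}\otimes X^{s_2}\otimes\cdots\to X^{t_1}\otimes X^{t_2}\otimes\cdots)$, where $X^+=X$, $X^-=X^*$. The source. $\overline{\operatorname{Rep}(U_q(\mathfrak{sl}_3))}$ is the semisimplification (quotient by negligible morphisms) of the representation category of $U_q(\mathfrak{sl}_3)$ at $q=e^{2\pi i/24}$, and $\Lambda_1$ is the vector representation. By Kuperberg's presentation, $\mathcal{P}_{\operatorname{Rep}(U_q(\mathfrak{sl}_3));\Lambda_1}$ (before semisimplification) is the linear planar algebra in which a closed loop equals $[3]_q$, generated by a trivalent vertex $t:-\to ++$ and its adjoint $t^\dagger:++\to -$, subject to the following relations (together with their adjoints), where $f^*$ denotes the pivotal dual (rotation by $\pi$) of $f$: (Rotation) with $T=(t\otimes \mathrm{id}_+)\circ\operatorname{coev}_{(-,+)}:\mathbf{1}\to +++$, one has $(\operatorname{ev}_{(-,+)}\otimes \mathrm{id}_{+++})\circ(\mathrm{id}_-\otimes T\otimes\mathrm{id}_+)\circ\operatorname{coev}_{(-,+)}=T$ (i.e. $t$ is invariant under rotation by one click); (i) $t^\dagger\circ t=[2]_q\,\mathrm{id}_-$; (ii) the square with alternating boundary is the sum of the two planar pairings: $(t^*\otimes \mathrm{id}_-)\circ(\mathrm{id}_-\otimes (t^\dagger)^* )\circ(\mathrm{id}_-\otimes t^* )\circ((t^\dagger)^*\otimes \mathrm{id}_-)=\mathrm{id}_{+-}+\operatorname{coev}_{(+,-)}\circ\operatorname{ev}_{(+,-)}$.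 The planar algebra $\mathcal{P}_{\overline{\operatorname{Rep}(U_q(\mathfrak{sl}_3))};\Lambda_1}$ is its quotient by negligible morphisms. The graph planar algebra. Let $\Gamma$ be a finite directed graph with positive Frobenius–Perron eigenvector $\lambda$. For an edge $e$, $s(e),t(e)$ are its source and target and $\overline{e}$ denotes $e$ traversed backwards. For a string $s$ in $\{+,-\}$, an $s$-path is a path in $\Gamma$ traversing an edge forwards for each $+$ and backwards for each $-$; $s(p),t(p)$ denote start and end of a path $p$. The planar algebra $oGPA(\Gamma)$ has $\operatorname{Hom}(s\to t)$ with basis the pairs $(p,q)$, $p$ an $s$-path, $q$ a $t$-path, with $s(p)=s(q)$, $t(p)=t(q)$. Composition of $(p,q)$ followed by $(p',q')$ is $(p',q')\circ(p,q)=\delta_{q,p'}(p,q')$; tensor product is $(p,q)\otimes(p',q')=\delta_{t(p),s(p')}\delta_{t(q),s(q')}(pp',qq')$; $\dagger$ is the antilinear extension of $(p,q)^\dagger=(q,p)$. The duality maps are $\operatorname{ev}_{(+,-)}=\sum_e\sqrt{\lambda_{t(e)}/\lambda_{s(e)}}\,((e,\overline e),s(e))$, $\operatorname{coev}_{(+,-)}=\sum_e\sqrt{\lambda_{t(e)}/\lambda_{s(e)}}\,(s(e),(e,\overline e))$, $\operatorname{ev}_{(-,+)}=\sum_e\sqrt{\lambda_{s(e)}/\lambda_{t(e)}}\,((\overline e,e),t(e))$, $\operatorname{coev}_{(-,+)}=\sum_e\sqrt{\lambda_{s(e)}/\lambda_{t(e)}}\,(t(e),(\overline e,e))$, sums over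 all edges $e$, where a vertex denotes the path of length $0$. The graph $\mathcal{E}_4^{12}$. Vertices $1,\dots,11$; single directed edges $1\to6$, $2\to6$, $3\to6$, $3\to10$, $4\to6$, $4\to10$, $5\to6$, $5\to8$, $5\to10$, $6\to7$, $7\to3$, $7\to4$, $7\to5$, $8\to7$, $9\to1$, $9\to2$, $9\to3$, $9\to4$, $9\to5$, $10\to7$, $10\to9$, $10\to11$, $11\to5$; and two edges $\alpha,\beta:6\to9$. Its Frobenius–Perron eigenvector (eigenvalue $[3]_q$) is \[\lambda=\left(\tfrac{[5]_q}{[3]_q},\tfrac{[5]_q}{[3]_q},\tfrac{[2]_q[4]_q}{[3]_q},\tfrac{[2]_q[4]_q}{[3]_q},[3]_q,[5]_q,[3]_q,1,[5]_q,[3]_q,1\right).\] The element $W$. $W=\sum W_{v_1,v_2,v_3}\,\big(v_1\xleftarrow{\gamma_3}v_3,\ v_1\xrightarrow{\gamma_1}v_2\xrightarrow{\gamma_2}v_3\big)$, summed over directed triangles $v_1\xrightarrow{\gamma_1}v_2\xrightarrow{\gamma_2}v_3\xrightarrow{\gamma_3}v_1$ (the first entry being the $-$-path from $v_1$ to $v_3$ traversing $\gamma_3$ backwards). Edge labels are suppressed except that $W^\alpha,W^\beta$ indicates which edge $6\to9$ is used. Writing $[n]$ for $[n]_q$, the coefficients are: $W^\alpha_{1,6,9}=\sqrt{[2]}$, $W^\beta_{1,6,9}=0$; $W^\alpha_{2,6,9}=z^{-1}\sqrt{\tfrac{1}{[2]}}$, $W^\beta_{2,6,9}=\zeta_{24}^{19}\sqrt{\tfrac{[3]}{[2]}}$;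 $W^\alpha_{3,6,9}=z\sqrt{\tfrac{1}{[2]}}$, $W^\beta_{3,6,9}=\zeta_3 z\sqrt{\tfrac{[3]}{[4]([2]+[3])}}$; $W^\alpha_{4,6,9}=\sqrt{\tfrac{1}{[2]}}$, $W^\beta_{4,6,9}=\zeta_8^5\sqrt{\tfrac{[3]([2]+[3])}{[4][5]}}$; $W^\alpha_{5,6,9}=\mathbf{i}z^{-1}\sqrt{\tfrac{1}{[2]}}$, $W^\beta_{5,6,9}=\zeta_{48}^{11}z\sqrt{\tfrac{[4]}{[5]}}$; $W_{3,6,7}=z\sqrt{\tfrac{[2](1+[2])}{[4]}}$, $W_{3,10,7}=z\sqrt{\tfrac{[2]^2}{[4]([2]+[3])}}$, $W_{3,10,9}=z\sqrt{\tfrac{[3](1+[2])}{[2][4]}}$; $W_{4,6,7}=\zeta_8^5\sqrt{\tfrac{[2][3]}{[4](1+[2])}}$, $W_{4,10,7}=z\sqrt{\tfrac{[2]+[3]}{[4]}}$, $W_{4,10,9}=z\sqrt{\tfrac{[3]^2}{[2][4](1+[2])}}$; $W_{5,6,7}=\zeta_8\sqrt{\tfrac{[2]}{[3]}}$, $W_{5,8,7}=z\sqrt{\tfrac{[2]}{[3]}}$, $W_{5,10,7}=z\sqrt{\tfrac{1}{[2]}}$, $W_{5,10,9}=z\sqrt{\tfrac{1}{[2]}}$, $W_{5,10,11}=z\sqrt{[2]}$; and the remaining coefficients are determined by the rotational formula $W_{a,b,c}=\sqrt{\lambda_b/\lambda_c}\;W_{b,c,a}$ (applied to each directed triangle, with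 the same choice of edge $6\to9$). *)

theory Defs
  imports Complex_Main "Graph_Theory.Digraph"
begin

section \<open>Planar algebras\<close>

datatype sign = Pos | Neg

type_synonym obj = "sign list"

primrec opp :: "sign \<Rightarrow> sign" where
  "opp Pos = Neg"
| "opp Neg = Pos"

definition dobj :: "obj \<Rightarrow> obj" where
  "dobj s = rev (map opp s)"

text \<open>
  The data of a linear monoidal category with distinguished duality maps whose objects are
  strings of signs, with tensor product of objects given by concatenation. \<open>Cmp P g f\<close> is
  \<open>g\<close> after \<open>f\<close>. \<open>Ev P a : [a, opp a] \<rightarrow> []\<close> and \<open>Coev P a : [] \<rightarrow> [a, opp a]\<close>, so that
  \<open>Ev P Pos\<close> is the evaluation with subscript (+,-) and \<open>Ev P Neg\<close> the one with subscript (-,+).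
\<close>

record 'm planar =
  Hom :: "obj \<Rightarrow> obj \<Rightarrow> 'm set"
  Nul :: "obj \<Rightarrow> obj \<Rightarrow> 'm"
  Add :: "'m \<Rightarrow> 'm \<Rightarrow> 'm"
  Scl :: "complex \<Rightarrow> 'm \<Rightarrow> 'm"
  Ide :: "obj \<Rightarrow> 'm"
  Cmp :: "'m \<Rightarrow> 'm \<Rightarrow> 'm"
  Tns :: "'m \<Rightarrow> 'm \<Rightarrow> 'm"
  Ev :: "sign \<Rightarrow> 'm"
  Coev :: "sign \<Rightarrow> 'm"

text \<open>Nested duality maps \<open>s @ dobj s \<rightarrow> []\<close> and \<open>[] \<rightarrow> s @ dobj s\<close>.\<close>

primrec evs :: "'m planar \<Rightarrow> obj \<Rightarrow> 'm" where
  "evs P [] = Ide P []"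
| "evs P (a # s) = Cmp P (Ev P a) (Tns P (Tns P (Ide P [a]) (evs P s)) (Ide P [opp a]))"

primrec coevs :: "'m planar \<Rightarrow> obj \<Rightarrow> 'm" where
  "coevs P [] = Ide P []"
| "coevs P (a # s) = Cmp P (Tns P (Tns P (Ide P [a]) (coevs P s)) (Ide P [opp a])) (Coev P a)"

text \<open>
  The two rotations by \<open>\<pi>\<close> of \<open>f : s \<rightarrow> t\<close>, both morphisms \<open>dobj t \<rightarrow> dobj s\<close>. Strict pivotality
  says that they agree; \<open>dual\<close> is the pivotal dual.
\<close>

definition dual :: "'m planar \<Rightarrow> obj \<Rightarrow> obj \<Rightarrow> 'm \<Rightarrow> 'm" where
  "dual P s t f =
     Cmp P (Tns P (evs P (dobj t)) (Ide P (dobj s)))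
       (Cmp P (Tns P (Tns P (Ide P (dobj t)) f) (Ide P (dobj s)))
         (Tns P (Ide P (dobj t)) (coevs P s)))"

definition dual' :: "'m planar \<Rightarrow> obj \<Rightarrow> obj \<Rightarrow> 'm \<Rightarrow> 'm" where
  "dual' P s t f =
     Cmp P (Tns P (Ide P (dobj s)) (evs P t))
       (Cmp P (Tns P (Tns P (Ide P (dobj s)) f) (Ide P (dobj t)))
         (Tns P (coevs P (dobj s)) (Ide P (dobj t))))"

definition tr :: "'m planar \<Rightarrow> obj \<Rightarrow> 'm \<Rightarrow> 'm" where
  "tr P s f = Cmp P (evs P s) (Cmp P (Tns P f (Ide P (dobj s))) (coevs P s))"

definition negligible :: "'m planar \<Rightarrow> obj \<Rightarrow> obj \<Rightarrow> 'm \<Rightarrow> bool" where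
  "negligible P s t f \<longleftrightarrow>
     f \<in> Hom P s t \<and> (\<forall>g\<in>Hom P t s. tr P s (Cmp P g f) = Nul P [] [])"

text \<open>
  The equational axioms of a linear strictly pivotal monoidal category, as the set of pairs
  (left side, right side) of their instances. They are used twice: an actual planar algebra
  satisfies them as equations, and in a presentation by generators and relations they are
  imposed on formal expressions.
\<close>

inductive planar_law :: "'m planar \<Rightarrow> 'm \<Rightarrow> 'm \<Rightarrow> bool" for P where
  add_assoc: "\<lbrakk>f \<in> Hom P s t; g \<in> Hom P s t; h \<in> Hom P s t\<rbrakk> \<Longrightarrow>
    planar_law P (Add P (Add P f g) h) (Add P f (Add P g h))"
| add_comm: "\<lbrakk>f \<in> Hom P s t; g \<in> Hom P s t\<rbrakk> \<Longrightarrow> planar_law P (Add P f g) (Add P g f)"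
| add_nul: "f \<in> Hom P s t \<Longrightarrow> planar_law P (Add P f (Nul P s t)) f"
| scl_add: "\<lbrakk>f \<in> Hom P s t; g \<in> Hom P s t\<rbrakk> \<Longrightarrow>
    planar_law P (Scl P c (Add P f g)) (Add P (Scl P c f) (Scl P c g))"
| add_scl: "f \<in> Hom P s t \<Longrightarrow>
    planar_law P (Scl P (c + d) f) (Add P (Scl P c f) (Scl P d f))"
| scl_scl: "f \<in> Hom P s t \<Longrightarrow> planar_law P (Scl P c (Scl P d f)) (Scl P (c * d) f)"
| scl_one: "f \<in> Hom P s t \<Longrightarrow> planar_law P (Scl P 1 f) f"
| scl_zero: "f \<in> Hom P s t \<Longrightarrow> planar_law P (Scl P 0 f) (Nul P s t)"
| cmp_assoc: "\<lbrakk>f \<in> Hom P s t; g \<in> Hom P t u; h \<in> Hom P u v\<rbrakk> \<Longrightarrow>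
    planar_law P (Cmp P (Cmp P h g) f) (Cmp P h (Cmp P g f))"
| cmp_ide_left: "f \<in> Hom P s t \<Longrightarrow> planar_law P (Cmp P (Ide P t) f) f"
| cmp_ide_right: "f \<in> Hom P s t \<Longrightarrow> planar_law P (Cmp P f (Ide P s)) f"
| cmp_add_left: "\<lbrakk>f \<in> Hom P s t; g \<in> Hom P t u; g' \<in> Hom P t u\<rbrakk> \<Longrightarrow>
    planar_law P (Cmp P (Add P g g') f) (Add P (Cmp P g f) (Cmp P g' f))"
| cmp_add_right: "\<lbrakk>f \<in> Hom P s t; f' \<in> Hom P s t; g \<in> Hom P t u\<rbrakk> \<Longrightarrow>
    planar_law P (Cmp P g (Add P f f')) (Add P (Cmp P g f) (Cmp P g f'))"
| cmp_scl_left: "\<lbrakk>f \<in> Hom P s t; g \<in> Hom P t u\<rbrakk> \<Longrightarrow>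
    planar_law P (Cmp P (Scl P c g) f) (Scl P c (Cmp P g f))"
| cmp_scl_right: "\<lbrakk>f \<in> Hom P s t; g \<in> Hom P t u\<rbrakk> \<Longrightarrow>
    planar_law P (Cmp P g (Scl P c f)) (Scl P c (Cmp P g f))"
| tns_assoc: "\<lbrakk>f \<in> Hom P s t; f' \<in> Hom P s' t'; f'' \<in> Hom P s'' t''\<rbrakk> \<Longrightarrow>
    planar_law P (Tns P (Tns P f f') f'') (Tns P f (Tns P f' f''))"
| tns_unit_left: "f \<in> Hom P s t \<Longrightarrow> planar_law P (Tns P (Ide P []) f) f"
| tns_unit_right: "f \<in> Hom P s t \<Longrightarrow> planar_law P (Tns P f (Ide P [])) f"
| tns_ide: "planar_law P (Tns P (Ide P s) (Ide P t)) (Ide P (s @ t))"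
| interchange: "\<lbrakk>f \<in> Hom P s t; g \<in> Hom P t u; f' \<in> Hom P s' t'; g' \<in> Hom P t' u'\<rbrakk> \<Longrightarrow>
    planar_law P (Tns P (Cmp P g f) (Cmp P g' f')) (Cmp P (Tns P g g') (Tns P f f'))"
| tns_add_left: "\<lbrakk>f \<in> Hom P s t; g \<in> Hom P s t; h \<in> Hom P s' t'\<rbrakk> \<Longrightarrow>
    planar_law P (Tns P (Add P f g) h) (Add P (Tns P f h) (Tns P g h))"
| tns_add_right: "\<lbrakk>f \<in> Hom P s t; g \<in> Hom P s' t'; h \<in> Hom P s' t'\<rbrakk> \<Longrightarrow>
    planar_law P (Tns P f (Add P g h)) (Add P (Tns P f g) (Tns P f h))"
| tns_scl_left: "\<lbrakk>f \<in> Hom P s t; g \<in> Hom P s' t'\<rbrakk> \<Longrightarrow>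
    planar_law P (Tns P (Scl P c f) g) (Scl P c (Tns P f g))"
| tns_scl_right: "\<lbrakk>f \<in> Hom P s t; g \<in> Hom P s' t'\<rbrakk> \<Longrightarrow>
    planar_law P (Tns P f (Scl P c g)) (Scl P c (Tns P f g))"
| zigzag_left: "planar_law P
    (Cmp P (Tns P (Ev P a) (Ide P [a])) (Tns P (Ide P [a]) (Coev P (opp a)))) (Ide P [a])"
| zigzag_right: "planar_law P
    (Cmp P (Tns P (Ide P [a]) (Ev P (opp a))) (Tns P (Coev P a) (Ide P [a]))) (Ide P [a])"
| pivotal: "f \<in> Hom P s t \<Longrightarrow> planar_law P (dual P s t f) (dual' P s t f)"

locale planar_algebra =
  fixes P :: "'m planar"
  assumes nul_closed: "Nul P s t \<in> Hom P s t"
    and add_closed: "\<lbrakk>f \<in> Hom P s t; g \<in> Hom P s t\<rbrakk> \<Longrightarrow> Add P f g \<in> Hom P s t"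
    and scl_closed: "f \<in> Hom P s t \<Longrightarrow> Scl P c f \<in> Hom P s t"
    and ide_closed: "Ide P s \<in> Hom P s s"
    and cmp_closed: "\<lbrakk>f \<in> Hom P s t; g \<in> Hom P t u\<rbrakk> \<Longrightarrow> Cmp P g f \<in> Hom P s u"
    and tns_closed: "\<lbrakk>f \<in> Hom P s t; g \<in> Hom P s' t'\<rbrakk> \<Longrightarrow> Tns P f g \<in> Hom P (s @ s') (t @ t')"
    and ev_closed: "Ev P a \<in> Hom P [a, opp a] []"
    and coev_closed: "Coev P a \<in> Hom P [] [a, opp a]"
    and laws: "planar_law P f g \<Longrightarrow> f = g"

locale tensor_functor =
  source: planar_algebra P + target: planar_algebra Q
  for P :: "'m planar" and Q :: "'n planar" +
  fixes F :: "obj \<Rightarrow> obj \<Rightarrow> 'm \<Rightarrow> 'n"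
  assumes map_hom: "f \<in> Hom P s t \<Longrightarrow> F s t f \<in> Hom Q s t"
    and map_add: "\<lbrakk>f \<in> Hom P s t; g \<in> Hom P s t\<rbrakk> \<Longrightarrow>
      F s t (Add P f g) = Add Q (F s t f) (F s t g)"
    and map_scl: "f \<in> Hom P s t \<Longrightarrow> F s t (Scl P c f) = Scl Q c (F s t f)"
    and map_ide: "F s s (Ide P s) = Ide Q s"
    and map_cmp: "\<lbrakk>f \<in> Hom P s t; g \<in> Hom P t u\<rbrakk> \<Longrightarrow>
      F s u (Cmp P g f) = Cmp Q (F t u g) (F s t f)"
    and map_tns: "\<lbrakk>f \<in> Hom P s t; g \<in> Hom P s' t'\<rbrakk> \<Longrightarrow>
      F (s @ s') (t @ t') (Tns P f g) = Tns Q (F s t f) (F s' t' g)"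
    and map_ev: "F [a, opp a] [] (Ev P a) = Ev Q a"
    and map_coev: "F [] [a, opp a] (Coev P a) = Coev Q a"

section \<open>Planar algebras generated by a trivalent vertex and its adjoint\<close>

datatype pterm =
    TTri
  | TTriDag
  | TEv sign
  | TCoev sign
  | TIde obj
  | TNul obj obj
  | TAdd pterm pterm (infixl "\<oplus>" 65)
  | TScl complex pterm (infixr "\<cdot>" 72)
  | TCmp pterm pterm (infixl "\<odot>" 70)
  | TTns pterm pterm (infixl "\<otimes>" 75)

inductive has_type :: "pterm \<Rightarrow> obj \<Rightarrow> obj \<Rightarrow> bool" where
  "has_type TTri [Neg] [Pos, Pos]"
| "has_type TTriDag [Pos, Pos] [Neg]"
| "has_type (TEv a) [a, opp a] []"
| "has_type (TCoev a) [] [a, opp a]"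
| "has_type (TIde s) s s"
| "has_type (TNul s t) s t"
| "\<lbrakk>has_type f s t; has_type g s t\<rbrakk> \<Longrightarrow> has_type (f \<oplus> g) s t"
| "has_type f s t \<Longrightarrow> has_type (c \<cdot> f) s t"
| "\<lbrakk>has_type f s t; has_type g t u\<rbrakk> \<Longrightarrow> has_type (g \<odot> f) s u"
| "\<lbrakk>has_type f s t; has_type g s' t'\<rbrakk> \<Longrightarrow> has_type (f \<otimes> g) (s @ s') (t @ t')"

primrec tdag :: "pterm \<Rightarrow> pterm" where
  "tdag TTri = TTriDag"
| "tdag TTriDag = TTri"
| "tdag (TEv a) = TCoev a"
| "tdag (TCoev a) = TEv a"
| "tdag (TIde s) = TIde s"
| "tdag (TNul s t) = TNul t s"
| "tdag (f \<oplus> g) = tdag f \<oplus> tdag g"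
| "tdag (c \<cdot> f) = cnj c \<cdot> tdag f"
| "tdag (g \<odot> f) = tdag f \<odot> tdag g"
| "tdag (f \<otimes> g) = tdag f \<otimes> tdag g"

definition Terms :: "pterm planar" where
  "Terms = \<lparr>Hom = (\<lambda>s t. {f. has_type f s t}), Nul = TNul, Add = TAdd, Scl = TScl,
     Ide = TIde, Cmp = TCmp, Tns = TTns, Ev = TEv, Coev = TCoev\<rparr>"

text \<open>
  The congruence on well-typed expressions generated by the relations \<open>R\<close> and the axioms of a
  planar algebra.
\<close>

inductive planar_cong :: "(pterm \<Rightarrow> pterm \<Rightarrow> bool) \<Rightarrow> pterm \<Rightarrow> pterm \<Rightarrow> bool" for R where
  cong_rel: "R f g \<Longrightarrow> planar_cong R f g"
| cong_law: "planar_law Terms f g \<Longrightarrow> planar_cong R f g"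
| cong_refl: "has_type f s t \<Longrightarrow> planar_cong R f f"
| cong_sym: "planar_cong R f g \<Longrightarrow> planar_cong R g f"
| cong_trans: "\<lbrakk>planar_cong R f g; planar_cong R g h\<rbrakk> \<Longrightarrow> planar_cong R f h"
| cong_add: "\<lbrakk>has_type f s t; has_type g s t; planar_cong R f f'; planar_cong R g g'\<rbrakk> \<Longrightarrow>
    planar_cong R (f \<oplus> g) (f' \<oplus> g')"
| cong_scl: "planar_cong R f f' \<Longrightarrow> planar_cong R (c \<cdot> f) (c \<cdot> f')"
| cong_cmp: "\<lbrakk>has_type f s t; has_type g t u; planar_cong R f f'; planar_cong R g g'\<rbrakk> \<Longrightarrow>
    planar_cong R (g \<odot> f) (g' \<odot> f')"
| cong_tns: "\<lbrakk>planar_cong R f f'; planar_cong R g g'\<rbrakk> \<Longrightarrow> planar_cong R (f \<otimes> g) (f' \<otimes> g')"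

definition cls :: "(pterm \<Rightarrow> pterm \<Rightarrow> bool) \<Rightarrow> pterm \<Rightarrow> pterm set" where
  "cls R f = {g. planar_cong R f g}"

text \<open>The planar algebra presented by the relations \<open>R\<close>; its morphisms are congruence classes.\<close>

definition presented :: "(pterm \<Rightarrow> pterm \<Rightarrow> bool) \<Rightarrow> pterm set planar" where
  "presented R = \<lparr>
     Hom = (\<lambda>s t. {cls R f | f. has_type f s t}),
     Nul = (\<lambda>s t. cls R (TNul s t)),
     Add = (\<lambda>X Y. \<Union>f\<in>X. \<Union>g\<in>Y. cls R (f \<oplus> g)),
     Scl = (\<lambda>c X. \<Union>f\<in>X. cls R (c \<cdot> f)),
     Ide = (\<lambda>s. cls R (TIde s)),
     Cmp = (\<lambda>Y X. \<Union>f\<in>X. \<Union>g\<in>Y. cls R (g \<odot> f)),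
     Tns = (\<lambda>X Y. \<Union>f\<in>X. \<Union>g\<in>Y. cls R (f \<otimes> g)),
     Ev = (\<lambda>a. cls R (TEv a)),
     Coev = (\<lambda>a. cls R (TCoev a))\<rparr>"

section \<open>The source\<close>

definition q24 :: complex where
  "q24 = exp (2 * of_real pi * \<i> / 24)"

definition qint :: "nat \<Rightarrow> complex" where
  "qint n = (q24 ^ n - inverse q24 ^ n) / (q24 - inverse q24)"

definition Tvertex :: pterm where
  "Tvertex = (TTri \<otimes> TIde [Pos]) \<odot> TCoev Neg"

abbreviation TTri_dual :: pterm where
  "TTri_dual \<equiv> dual Terms [Neg] [Pos, Pos] TTri"

abbreviation TTriDag_dual :: pterm where
  "TTriDag_dual \<equiv> dual Terms [Pos, Pos] [Neg] TTriDag"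

inductive kuperberg_rel :: "pterm \<Rightarrow> pterm \<Rightarrow> bool" where
  loop: "kuperberg_rel (TEv a \<odot> TCoev a) (qint 3 \<cdot> TIde [])"
| rotation: "kuperberg_rel
    ((TEv Neg \<otimes> TIde [Pos, Pos, Pos]) \<odot> (TIde [Neg] \<otimes> Tvertex \<otimes> TIde [Pos]) \<odot> TCoev Neg)
    Tvertex"
| bigon: "kuperberg_rel (TTriDag \<odot> TTri) (qint 2 \<cdot> TIde [Neg])"
| square: "kuperberg_rel
    ((TTri_dual \<otimes> TIde [Neg]) \<odot> (TIde [Neg] \<otimes> TTriDag_dual) \<odot>
     (TIde [Neg] \<otimes> TTri_dual) \<odot> (TTriDag_dual \<otimes> TIde [Neg]))
    (TIde [Pos, Neg] \<oplus> TCoev Pos \<odot> TEv Pos)"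
| adjoint: "kuperberg_rel f g \<Longrightarrow> kuperberg_rel (tdag f) (tdag g)"

text \<open>
  The planar algebra of \<open>Rep(U_q(sl_3))\<close> and the vector representation, before semisimplification.
\<close>

definition P_sl3 :: "pterm set planar" where
  "P_sl3 = presented kuperberg_rel"

text \<open>
  The quotient of \<open>P_sl3\<close> by its negligible morphisms is obtained by additionally setting every
  negligible morphism equal to zero. As \<open>Rep(U_q(sl_3))\<close> is spherical, the negligible morphisms
  form a tensor ideal, so no further morphisms are killed.
\<close>

inductive semisimple_rel :: "pterm \<Rightarrow> pterm \<Rightarrow> bool" where
  kuperberg: "kuperberg_rel f g \<Longrightarrow> semisimple_rel f g"
| kill: "\<lbrakk>has_type f s t; negligible P_sl3 s t (cls kuperberg_rel f)\<rbrakk> \<Longrightarrow>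
    semisimple_rel f (TNul s t)"

definition P_sl3_ss :: "pterm set planar" where
  "P_sl3_ss = presented semisimple_rel"

definition tri :: "pterm set" where
  "tri = cls semisimple_rel TTri"

definition tri_dag :: "pterm set" where
  "tri_dag = cls semisimple_rel TTriDag"

section \<open>The oriented graph planar algebra\<close>

text \<open>
  A step \<open>(Pos, e)\<close> traverses the edge \<open>e\<close> forwards and \<open>(Neg, e)\<close> backwards. A path is its start
  vertex together with its list of steps; the vertex \<open>v\<close> as a path of length zero is \<open>(v, [])\<close>.
\<close>

type_synonym 'e step = "sign \<times> 'e"
type_synonym ('v, 'e) path = "'v \<times> 'e step list"
type_synonym ('v, 'e) gpa = "('v, 'e) path \<times> ('v, 'e) path \<Rightarrow> complex"

fun step_src :: "('v, 'e) pre_digraph \<Rightarrow> 'e step \<Rightarrow> 'v" where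
  "step_src G (Pos, e) = tail G e"
| "step_src G (Neg, e) = head G e"

fun step_tgt :: "('v, 'e) pre_digraph \<Rightarrow> 'e step \<Rightarrow> 'v" where
  "step_tgt G (Pos, e) = head G e"
| "step_tgt G (Neg, e) = tail G e"

fun is_path :: "('v, 'e) pre_digraph \<Rightarrow> ('v, 'e) path \<Rightarrow> bool" where
  "is_path G (v, []) \<longleftrightarrow> v \<in> verts G"
| "is_path G (v, x # xs) \<longleftrightarrow>
     snd x \<in> arcs G \<and> step_src G x = v \<and> is_path G (step_tgt G x, xs)"

fun path_end :: "('v, 'e) pre_digraph \<Rightarrow> ('v, 'e) path \<Rightarrow> 'v" where
  "path_end G (v, []) = v"
| "path_end G (v, x # xs) = path_end G (step_tgt G x, xs)"

definition spaths :: "('v, 'e) pre_digraph \<Rightarrow> obj \<Rightarrow> ('v, 'e) path set" where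
  "spaths G s = {p. is_path G p \<and> map fst (snd p) = s}"

definition gpa_basis ::
    "('v, 'e) pre_digraph \<Rightarrow> obj \<Rightarrow> obj \<Rightarrow> (('v, 'e) path \<times> ('v, 'e) path) set" where
  "gpa_basis G s t =
     {(p, r). p \<in> spaths G s \<and> r \<in> spaths G t \<and> fst p = fst r \<and> path_end G p = path_end G r}"

text \<open>The linear combination of the basis elements \<open>b i\<close>, \<open>i \<in> I\<close>, with coefficients \<open>c i\<close>.\<close>

definition lincomb :: "'i set \<Rightarrow> ('i \<Rightarrow> complex) \<Rightarrow> ('i \<Rightarrow> 'b) \<Rightarrow> 'b \<Rightarrow> complex" where
  "lincomb I c b = (\<lambda>x. \<Sum>i\<in>I. if b i = x then c i else 0)"

text \<open>
  The bilinear extension of a product of basis elements, where \<open>None\<close> stands for the product zero.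
\<close>

definition bilin :: "('b \<Rightarrow> 'b \<Rightarrow> 'b option) \<Rightarrow> ('b \<Rightarrow> complex) \<Rightarrow> ('b \<Rightarrow> complex) \<Rightarrow> 'b \<Rightarrow> complex" where
  "bilin m f g = (\<lambda>x. \<Sum>b | f b \<noteq> 0. \<Sum>b' | g b' \<noteq> 0. if m b b' = Some x then f b * g b' else 0)"

fun cmp_basis :: "('p \<times> 'p) \<Rightarrow> ('p \<times> 'p) \<Rightarrow> ('p \<times> 'p) option" where
  "cmp_basis (p', r') (p, r) = (if r = p' then Some (p, r') else None)"

fun path_append :: "('v, 'e) path \<Rightarrow> ('v, 'e) path \<Rightarrow> ('v, 'e) path" where
  "path_append (v, xs) (w, ys) = (v, xs @ ys)"

fun tns_basis :: "('v, 'e) pre_digraph \<Rightarrow> (('v, 'e) path \<times> ('v, 'e) path) \<Rightarrow>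
    (('v, 'e) path \<times> ('v, 'e) path) \<Rightarrow> (('v, 'e) path \<times> ('v, 'e) path) option" where
  "tns_basis G (p, r) (p', r') =
     (if path_end G p = fst p' \<and> path_end G r = fst r'
      then Some (path_append p p', path_append r r') else None)"

definition gpa_coev_coeff :: "('v, 'e) pre_digraph \<Rightarrow> ('v \<Rightarrow> real) \<Rightarrow> 'e step \<Rightarrow> complex" where
  "gpa_coev_coeff G lam x = of_real (sqrt (lam (step_tgt G x) / lam (step_src G x)))"

definition oGPA :: "('v, 'e) pre_digraph \<Rightarrow> ('v \<Rightarrow> real) \<Rightarrow> ('v, 'e) gpa planar" where
  "oGPA G lam = \<lparr>
     Hom = (\<lambda>s t. {f. \<forall>x. f x \<noteq> 0 \<longrightarrow> x \<in> gpa_basis G s t}),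
     Nul = (\<lambda>s t x. 0),
     Add = (\<lambda>f g x. f x + g x),
     Scl = (\<lambda>c f x. c * f x),
     Ide = (\<lambda>s. lincomb (spaths G s) (\<lambda>p. 1) (\<lambda>p. (p, p))),
     Cmp = bilin cmp_basis,
     Tns = bilin (tns_basis G),
     Ev = (\<lambda>a. lincomb (arcs G) (\<lambda>e. gpa_coev_coeff G lam (a, e))
       (\<lambda>e. ((step_src G (a, e), [(a, e), (opp a, e)]), (step_src G (a, e), [])))),
     Coev = (\<lambda>a. lincomb (arcs G) (\<lambda>e. gpa_coev_coeff G lam (a, e))
       (\<lambda>e. ((step_src G (a, e), []), (step_src G (a, e), [(a, e), (opp a, e)]))))\<rparr>"

definition gpa_dag :: "('v, 'e) gpa \<Rightarrow> ('v, 'e) gpa" where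
  "gpa_dag f = (\<lambda>(p, r). cnj (f (r, p)))"

section \<open>The graph and the element W\<close>

datatype edge = Edge nat nat | Alpha | Beta

primrec edge_tail :: "edge \<Rightarrow> nat" where
  "edge_tail (Edge a b) = a"
| "edge_tail Alpha = 6"
| "edge_tail Beta = 6"

primrec edge_head :: "edge \<Rightarrow> nat" where
  "edge_head (Edge a b) = b"
| "edge_head Alpha = 9"
| "edge_head Beta = 9"

definition E412 :: "(nat, edge) pre_digraph" where
  "E412 = \<lparr>verts = {1..11},
     arcs = {Edge 1 6, Edge 2 6, Edge 3 6, Edge 3 10, Edge 4 6, Edge 4 10,
       Edge 5 6, Edge 5 8, Edge 5 10, Edge 6 7, Edge 7 3, Edge 7 4, Edge 7 5,
       Edge 8 7, Edge 9 1, Edge 9 2, Edge 9 3, Edge 9 4, Edge 9 5,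
       Edge 10 7, Edge 10 9, Edge 10 11, Edge 11 5, Alpha, Beta},
     tail = edge_tail, head = edge_head\<rparr>"

text \<open>The quantum integers at \<open>q24\<close> are real.\<close>

definition rqint :: "nat \<Rightarrow> real" where
  "rqint n = Re (qint n)"

definition lam :: "nat \<Rightarrow> real" where
  "lam v =
     [rqint 5 / rqint 3, rqint 5 / rqint 3, rqint 2 * rqint 4 / rqint 3,
      rqint 2 * rqint 4 / rqint 3, rqint 3, rqint 5, rqint 3, 1, rqint 5, rqint 3, 1] ! (v - 1)"

definition zeta :: "nat \<Rightarrow> complex" where
  "zeta l = exp (2 * of_real pi * \<i> / of_nat l)"

definition z_root :: "complex \<Rightarrow> bool" where
  "z_root x \<longleftrightarrow> 9 * x ^ 16 - 14 * x ^ 8 + 9 = 0"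

definition zW :: complex where
  "zW = (let c = Complex (- 0.996393) 0.0848571
        in THE x. z_root x \<and> (\<forall>y. z_root y \<and> y \<noteq> x \<longrightarrow> dist x c < dist y c))"

definition rsqrt :: "real \<Rightarrow> complex" where
  "rsqrt x = of_real (sqrt x)"

text \<open>
  The coefficients of the triangles starting at one of the vertices 1, ..., 5. Such a triangle is
  determined by its first two edges, which serve as keys.
\<close>

definition W_table :: "((edge \<times> edge) \<times> complex) list" where
  "W_table =
    (let q2 = rqint 2; q3 = rqint 3; q4 = rqint 4; q5 = rqint 5 in
     [((Edge 1 6, Alpha), rsqrt q2),
      ((Edge 1 6, Beta), 0),
      ((Edge 2 6, Alpha), inverse zW * rsqrt (1 / q2)),
      ((Edge 2 6, Beta), zeta 24 ^ 19 * rsqrt (q3 / q2)),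
      ((Edge 3 6, Alpha), zW * rsqrt (1 / q2)),
      ((Edge 3 6, Beta), zeta 3 * zW * rsqrt (q3 / (q4 * (q2 + q3)))),
      ((Edge 4 6, Alpha), rsqrt (1 / q2)),
      ((Edge 4 6, Beta), zeta 8 ^ 5 * rsqrt (q3 * (q2 + q3) / (q4 * q5))),
      ((Edge 5 6, Alpha), \<i> * inverse zW * rsqrt (1 / q2)),
      ((Edge 5 6, Beta), zeta 48 ^ 11 * zW * rsqrt (q4 / q5)),
      ((Edge 3 6, Edge 6 7), zW * rsqrt (q2 * (1 + q2) / q4)),
      ((Edge 3 10, Edge 10 7), zW * rsqrt (q2\<^sup>2 / (q4 * (q2 + q3)))),
      ((Edge 3 10, Edge 10 9), zW * rsqrt (q3 * (1 + q2) / (q2 * q4))),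
      ((Edge 4 6, Edge 6 7), zeta 8 ^ 5 * rsqrt (q2 * q3 / (q4 * (1 + q2)))),
      ((Edge 4 10, Edge 10 7), zW * rsqrt ((q2 + q3) / q4)),
      ((Edge 4 10, Edge 10 9), zW * rsqrt (q3\<^sup>2 / (q2 * q4 * (1 + q2)))),
      ((Edge 5 6, Edge 6 7), zeta 8 * rsqrt (q2 / q3)),
      ((Edge 5 8, Edge 8 7), zW * rsqrt (q2 / q3)),
      ((Edge 5 10, Edge 10 7), zW * rsqrt (1 / q2)),
      ((Edge 5 10, Edge 10 9), zW * rsqrt (1 / q2)),
      ((Edge 5 10, Edge 10 11), zW * rsqrt q2)])"

definition W_start :: "edge \<Rightarrow> edge \<Rightarrow> complex" where
  "W_start e e' = the (map_of W_table (e, e'))"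

definition triangles :: "(edge \<times> edge \<times> edge) set" where
  "triangles = {(e1, e2, e3). {e1, e2, e3} \<subseteq> arcs E412 \<and>
     edge_head e1 = edge_tail e2 \<and> edge_head e2 = edge_tail e3 \<and> edge_head e3 = edge_tail e1}"

text \<open>
  Every directed triangle contains exactly one of the vertices 1, ..., 5, so the rotational formula
  below determines all remaining coefficients from the table.
\<close>

definition W_coeff :: "edge \<Rightarrow> edge \<Rightarrow> edge \<Rightarrow> complex" where
  "W_coeff e1 e2 e3 =
    (let a = edge_tail e1; b = edge_tail e2; c = edge_tail e3 in
     if a \<le> 5 then W_start e1 e2
     else if b \<le> 5 then rsqrt (lam b / lam c) * W_start e2 e3
     else rsqrt (lam b / lam c) * (rsqrt (lam c / lam a) * W_start e3 e1))"

definition W :: "(nat, edge) gpa" where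
  "W = lincomb triangles (\<lambda>(e1, e2, e3). W_coeff e1 e2 e3)
     (\<lambda>(e1, e2, e3). ((edge_tail e1, [(Neg, e3)]), (edge_tail e1, [(Pos, e1), (Pos, e2)])))"

end

theory Submission
  imports Defs
begin

text \<open>
  A tensor functor out of a planar algebra given by generators and relations is the same thing as
  a pair of morphisms in the target satisfying the relations. The proof therefore has three parts.

  First, the target has to be a planar algebra. Morphisms of the graph planar algebra are finitely
  supported matrices indexed by paths; composition is matrix multiplication, and the entry of a
  tensor product at a pair of paths is the product of the entries at their initial and final
  segments. Nested cups insert a path followed by its reversal, weighted by the square root of the
  quotient of the eigenvector at its two ends. Both rotations by \<open>\<pi>\<close> then reverse paths and
  transpose, because the weights of the cup and of the cap cancel: \<open>dual_coeff\<close>, \<open>dual'_coeff\<close>.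
  This gives pivotality, and applied to identities it gives the zigzag equations.

  Secondly, negligible morphisms must be sent to zero although nothing is known about them beyond
  a vanishing trace in the source. Here the dagger helps: the interpretation commutes with it, so
  if \<open>f\<close> is negligible then the trace of \<open>f\<^sup>\<dagger> f\<close> vanishes in the target. There it is a sum, with
  positive weights, of squared absolute values of the matrix entries of \<open>f\<close>: \<open>trace_positive\<close>.

  Thirdly, Kuperberg's relations have to be verified for \<open>W\<close>. In terms of matrix entries the
  rotation relation is the rotational formula, the loop relation is the Perron-Frobenius equation,
  and the bigon and square relations become finitely many polynomial equations between the cells.
  After division by square roots of the eigenvector and a unitary rescaling of the edges, the cells
  lie in the field generated by \<open>\<i>\<close> and a few real square roots. The root \<open>z\<close> lies in this field as
  well, up to the factor \<open>sqrt (sqrt 3) * sqrt (2 + sqrt 2) * sqrt (1 + sqrt 3)\<close>, so each equation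
  is decided by expanding products and reducing squares of these square roots.
\<close>

section \<open>Typed expressions\<close>

text \<open>Types are unique, so the relation \<open>has_type\<close> is replaced by functions that the simplifier can run.\<close>

primrec src :: "pterm \<Rightarrow> obj" where
  "src TTri = [Neg]"
| "src TTriDag = [Pos, Pos]"
| "src (TEv a) = [a, opp a]"
| "src (TCoev a) = []"
| "src (TIde s) = s"
| "src (TNul s t) = s"
| "src (f \<oplus> g) = src f"
| "src (c \<cdot> f) = src f"
| "src (g \<odot> f) = src f"
| "src (f \<otimes> g) = src f @ src g"

primrec tgt :: "pterm \<Rightarrow> obj" where
  "tgt TTri = [Pos, Pos]"
| "tgt TTriDag = [Neg]"
| "tgt (TEv a) = []"
| "tgt (TCoev a) = [a, opp a]"
| "tgt (TIde s) = s"
| "tgt (TNul s t) = t"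
| "tgt (f \<oplus> g) = tgt f"
| "tgt (c \<cdot> f) = tgt f"
| "tgt (g \<odot> f) = tgt g"
| "tgt (f \<otimes> g) = tgt f @ tgt g"

primrec wt :: "pterm \<Rightarrow> bool" where
  "wt TTri \<longleftrightarrow> True"
| "wt TTriDag \<longleftrightarrow> True"
| "wt (TEv a) \<longleftrightarrow> True"
| "wt (TCoev a) \<longleftrightarrow> True"
| "wt (TIde s) \<longleftrightarrow> True"
| "wt (TNul s t) \<longleftrightarrow> True"
| "wt (f \<oplus> g) \<longleftrightarrow> wt f \<and> wt g \<and> src f = src g \<and> tgt f = tgt g"
| "wt (c \<cdot> f) \<longleftrightarrow> wt f"
| "wt (g \<odot> f) \<longleftrightarrow> wt f \<and> wt g \<and> tgt f = src g"
| "wt (f \<otimes> g) \<longleftrightarrow> wt f \<and> wt g"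

lemma wt_has_type: "wt f \<Longrightarrow> has_type f (src f) (tgt f)"
  by (induction f) (auto intro: has_type.intros simp: has_type.intros(9))

lemma has_type_iff: "has_type f s t \<longleftrightarrow> wt f \<and> src f = s \<and> tgt f = t"
proof
  show "has_type f s t \<Longrightarrow> wt f \<and> src f = s \<and> tgt f = t"
    by (induction rule: has_type.induct) auto
qed (auto dest: wt_has_type)

lemma Terms_simps [simp]:
  "f \<in> Hom Terms s t \<longleftrightarrow> wt f \<and> src f = s \<and> tgt f = t"
  "Nul Terms = TNul" "Add Terms = TAdd" "Scl Terms = TScl" "Ide Terms = TIde"
  "Cmp Terms = TCmp" "Tns Terms = TTns" "Ev Terms = TEv" "Coev Terms = TCoev"
  by (simp_all add: Terms_def has_type_iff)

lemmas Terms_law = planar_law.intros[where P = Terms, unfolded Terms_simps]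

lemma opp_opp [simp]: "opp (opp a) = a"
  by (cases a) auto

lemma dobj_simps [simp]:
  "dobj [] = []" "dobj (a # s) = dobj s @ [opp a]" "dobj (s @ t) = dobj t @ dobj s"
  "dobj (dobj s) = s" "length (dobj s) = length s"
  by (simp_all add: dobj_def rev_map o_def)

lemma evs_Terms_type [simp]:
  "wt (evs Terms s) \<and> src (evs Terms s) = s @ dobj s \<and> tgt (evs Terms s) = []"
  by (induction s) auto

lemma coevs_Terms_type [simp]:
  "wt (coevs Terms s) \<and> src (coevs Terms s) = [] \<and> tgt (coevs Terms s) = s @ dobj s"
  by (induction s) auto

lemma dual_Terms_type [simp]:
  assumes "wt f"
  shows "wt (dual Terms (src f) (tgt f) f)"
    "src (dual Terms (src f) (tgt f) f) = dobj (tgt f)"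
    "tgt (dual Terms (src f) (tgt f) f) = dobj (src f)"
    "wt (dual' Terms (src f) (tgt f) f)"
    "src (dual' Terms (src f) (tgt f) f) = dobj (tgt f)"
    "tgt (dual' Terms (src f) (tgt f) f) = dobj (src f)"
  using assms evs_Terms_type[of "dobj (tgt f)"] coevs_Terms_type[of "dobj (src f)"]
  by (simp_all add: dual_def dual'_def)

text \<open>Only for type preserving relations do classes of expressions have well-defined operations.\<close>

definition coherent :: "(pterm \<Rightarrow> pterm \<Rightarrow> bool) \<Rightarrow> bool" where
  "coherent R \<longleftrightarrow> (\<forall>f g. R f g \<longrightarrow> wt f \<and> wt g \<and> src f = src g \<and> tgt f = tgt g)"

lemma coherent_planar_law: "coherent (planar_law Terms)"
  unfolding coherent_def by (auto elim!: planar_law.cases)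

lemma coherent_planar_cong: "coherent R \<Longrightarrow> coherent (planar_cong R)"
  unfolding coherent_def
proof (intro allI impI)
  fix f g
  assume R: "\<forall>f g. R f g \<longrightarrow> wt f \<and> wt g \<and> src f = src g \<and> tgt f = tgt g"
  show "planar_cong R f g \<Longrightarrow> wt f \<and> wt g \<and> src f = src g \<and> tgt f = tgt g"
    by (induction rule: planar_cong.induct)
      (use R coherent_planar_law in \<open>auto simp: has_type_iff coherent_def\<close>)
qed

section \<open>Presented planar algebras\<close>

text \<open>The operations on classes are unions over representatives; each is a union of equal sets.\<close>

lemma UN_constant_on:
  assumes "x \<in> X" "\<And>u. u \<in> X \<Longrightarrow> h u = C"
  shows "(\<Union>u\<in>X. h u) = C"
  using assms by auto

locale presentation =
  fixes R :: "pterm \<Rightarrow> pterm \<Rightarrow> bool"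
  assumes coherent: "coherent R"
begin

lemma cong_typed:
  assumes "planar_cong R f g"
  shows "wt f" "wt g" "src g = src f" "tgt g = tgt f"
  using coherent_planar_cong[OF coherent] assms by (auto simp: coherent_def)

lemma cls_eq_iff:
  assumes "wt f"
  shows "cls R f = cls R g \<longleftrightarrow> planar_cong R f g"
  using cong_refl[OF wt_has_type[OF assms], of R]
  by (auto simp: cls_def intro: cong_sym cong_trans)

lemma cls_eqI: "planar_cong R f g \<Longrightarrow> cls R f = cls R g"
  using cls_eq_iff cong_typed by blast

lemma in_cls: "wt f \<Longrightarrow> f \<in> cls R f"
  by (auto simp: cls_def intro: cong_refl wt_has_type)

lemma presented_simps [simp]:
  "X \<in> Hom (presented R) s t \<longleftrightarrow> (\<exists>f. X = cls R f \<and> wt f \<and> src f = s \<and> tgt f = t)"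
  "Nul (presented R) s t = cls R (TNul s t)"
  "Ide (presented R) s = cls R (TIde s)"
  "Ev (presented R) a = cls R (TEv a)"
  "Coev (presented R) a = cls R (TCoev a)"
  by (auto simp: presented_def has_type_iff)

lemma Add_cls [simp]:
  assumes "wt f" "wt g" "src f = src g" "tgt f = tgt g"
  shows "Add (presented R) (cls R f) (cls R g) = cls R (f \<oplus> g)"
proof -
  have "cls R (f' \<oplus> g') = cls R (f \<oplus> g)" if "f' \<in> cls R f" "g' \<in> cls R g" for f' g'
    using that assms by (intro cls_eqI[symmetric] cong_add) (auto simp: cls_def has_type_iff)
  then show ?thesis
    unfolding presented_def planar.simps
    by - (rule UN_constant_on[OF in_cls[OF assms(1)] UN_constant_on[OF in_cls[OF assms(2)]]])
qed

lemma Cmp_cls [simp]: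
  assumes "wt f" "wt g" "tgt f = src g"
  shows "Cmp (presented R) (cls R g) (cls R f) = cls R (g \<odot> f)"
proof -
  have "cls R (g' \<odot> f') = cls R (g \<odot> f)" if "f' \<in> cls R f" "g' \<in> cls R g" for f' g'
    using that assms by (intro cls_eqI[symmetric] cong_cmp) (auto simp: cls_def has_type_iff)
  then show ?thesis
    unfolding presented_def planar.simps
    by - (rule UN_constant_on[OF in_cls[OF assms(1)] UN_constant_on[OF in_cls[OF assms(2)]]])
qed

lemma Tns_cls [simp]:
  assumes "wt f" "wt g"
  shows "Tns (presented R) (cls R f) (cls R g) = cls R (f \<otimes> g)"
proof -
  have "cls R (f' \<otimes> g') = cls R (f \<otimes> g)" if "f' \<in> cls R f" "g' \<in> cls R g" for f' g'
    using that assms by (intro cls_eqI[symmetric] cong_tns) (auto simp: cls_def)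
  then show ?thesis
    unfolding presented_def planar.simps
    by - (rule UN_constant_on[OF in_cls[OF assms(1)] UN_constant_on[OF in_cls[OF assms(2)]]])
qed

lemma Scl_cls [simp]:
  assumes "wt f"
  shows "Scl (presented R) c (cls R f) = cls R (c \<cdot> f)"
proof -
  have "cls R (c \<cdot> f') = cls R (c \<cdot> f)" if "f' \<in> cls R f" for f'
    using that by (intro cls_eqI[symmetric] cong_scl) (auto simp: cls_def)
  then show ?thesis
    unfolding presented_def planar.simps
    by - (rule UN_constant_on[OF in_cls[OF assms]])
qed

lemma evs_presented [simp]: "evs (presented R) s = cls R (evs Terms s)"
  by (induction s) auto

lemma coevs_presented [simp]: "coevs (presented R) s = cls R (coevs Terms s)"
  by (induction s) auto

lemma dual_cls [simp]:
  assumes "wt f"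
  shows "dual (presented R) (src f) (tgt f) (cls R f) = cls R (dual Terms (src f) (tgt f) f)"
    "dual' (presented R) (src f) (tgt f) (cls R f) = cls R (dual' Terms (src f) (tgt f) f)"
  using assms by (simp_all add: dual_def dual'_def)

lemma tr_cls [simp]:
  assumes "wt f" "tgt f = src f"
  shows "tr (presented R) (src f) (cls R f) = cls R (tr Terms (src f) f)"
  using assms by (simp add: tr_def)

text \<open>Every instance of an axiom among classes is the image of an instance among expressions; this is why a presented planar algebra satisfies the axioms.\<close>

lemma presented_law:
  "planar_law (presented R) X Y \<Longrightarrow> \<exists>f g. X = cls R f \<and> Y = cls R g \<and> planar_law Terms f g"
  by (induction rule: planar_law.induct)
    (clarsimp, intro exI conjI, rule refl, rule refl, rule Terms_law, (force+)?)+

lemma planar_algebra_presented: "planar_algebra (presented R)"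
proof
  fix X Y
  assume "planar_law (presented R) X Y"
  from presented_law[OF this] show "X = Y"
    using cls_eqI cong_law by metis
qed (clarsimp, intro exI conjI, rule refl, simp, simp, simp)+

end

section \<open>Interpretation\<close>

primrec interp :: "'m planar \<Rightarrow> 'm \<Rightarrow> 'm \<Rightarrow> pterm \<Rightarrow> 'm" where
  "interp Q x y TTri = x"
| "interp Q x y TTriDag = y"
| "interp Q x y (TEv a) = Ev Q a"
| "interp Q x y (TCoev a) = Coev Q a"
| "interp Q x y (TIde s) = Ide Q s"
| "interp Q x y (TNul s t) = Nul Q s t"
| "interp Q x y (f \<oplus> g) = Add Q (interp Q x y f) (interp Q x y g)"
| "interp Q x y (c \<cdot> f) = Scl Q c (interp Q x y f)"
| "interp Q x y (g \<odot> f) = Cmp Q (interp Q x y g) (interp Q x y f)"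
| "interp Q x y (f \<otimes> g) = Tns Q (interp Q x y f) (interp Q x y g)"

lemma interp_evs [simp]: "interp Q x y (evs Terms s) = evs Q s"
  by (induction s) auto

lemma interp_coevs [simp]: "interp Q x y (coevs Terms s) = coevs Q s"
  by (induction s) auto

lemma interp_dual [simp]:
  "interp Q x y (dual Terms s t f) = dual Q s t (interp Q x y f)"
  "interp Q x y (dual' Terms s t f) = dual' Q s t (interp Q x y f)"
  by (simp_all add: dual_def dual'_def)

lemma interp_tr [simp]: "interp Q x y (tr Terms s f) = tr Q s (interp Q x y f)"
  by (simp add: tr_def)

locale vertex_pair = planar_algebra Q for Q :: "'m planar" +
  fixes x y :: 'm
  assumes x_hom: "x \<in> Hom Q [Neg] [Pos, Pos]" and y_hom: "y \<in> Hom Q [Pos, Pos] [Neg]"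
begin

lemma interp_hom: "wt f \<Longrightarrow> interp Q x y f \<in> Hom Q (src f) (tgt f)"
  by (induction f)
    (auto intro: x_hom y_hom nul_closed add_closed scl_closed ide_closed cmp_closed tns_closed
      ev_closed coev_closed)

lemma interp_law:
  "planar_law Terms f g \<Longrightarrow> planar_law Q (interp Q x y f) (interp Q x y g)"
  by (induction rule: planar_law.induct)
    (auto intro!: planar_law.intros dest!: interp_hom)

lemma interp_cong:
  assumes sound: "\<And>f g. R f g \<Longrightarrow> interp Q x y f = interp Q x y g"
  shows "planar_cong R f g \<Longrightarrow> interp Q x y f = interp Q x y g"
  by (induction rule: planar_cong.induct) (auto intro: sound laws interp_law)

end


context presentation begin

text \<open>The universal property: a pair of morphisms satisfying the relations extends to a functor, which evaluates any representative.\<close>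

theorem tensor_functor_presented:
  assumes "vertex_pair Q x y"
    and sound: "\<And>f g. R f g \<Longrightarrow> interp Q x y f = interp Q x y g"
  defines "F \<equiv> \<lambda>(s :: obj) (t :: obj) X. interp Q x y (SOME f. f \<in> X)"
  shows "tensor_functor (presented R) Q F"
    and "wt f \<Longrightarrow> F s t (cls R f) = interp Q x y f"
proof -
  interpret vertex_pair Q x y by fact
  have F [simp]: "F s t (cls R f) = interp Q x y f" if "wt f" for s t f
  proof -
    have "(SOME g. g \<in> cls R f) \<in> cls R f"
      using in_cls[OF that] by (rule someI)
    then show ?thesis
      using interp_cong[of R, OF sound] by (auto simp: F_def cls_def)
  qed
  then show "wt f \<Longrightarrow> F s t (cls R f) = interp Q x y f" .
  interpret source: planar_algebra "presented R"
    by (rule planar_algebra_presented)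
  show "tensor_functor (presented R) Q F"
    by unfold_locales (auto simp: interp_hom)
qed

text \<open>Uniqueness. The zero morphism is preserved because it equals \<open>0\<close> times itself.\<close>

theorem tensor_functor_eq_interp:
  assumes "tensor_functor (presented R) Q F"
  shows "wt f \<Longrightarrow> F (src f) (tgt f) (cls R f) =
    interp Q (F [Neg] [Pos, Pos] (cls R TTri)) (F [Pos, Pos] [Neg] (cls R TTriDag)) f"
proof (induction f)
  case (TNul s t)
  interpret tensor_functor "presented R" Q F by fact
  let ?N = "cls R (TNul s t)"
  have N: "?N \<in> Hom (presented R) s t"
    using source.nul_closed by simp
  have "Scl (presented R) 0 ?N = ?N"
    using source.laws[OF planar_law.scl_zero[OF N]] by simp
  then have "F s t ?N = Scl Q 0 (F s t ?N)"
    using map_scl[OF N] by metis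
  then show ?case
    using target.laws[OF planar_law.scl_zero[OF map_hom[OF N]]] by simp
next
  case (TIde s)
  interpret tensor_functor "presented R" Q F by fact
  show ?case using map_ide[of s] by simp
next
  case (TEv a)
  interpret tensor_functor "presented R" Q F by fact
  show ?case using map_ev[of a] by simp
next
  case (TCoev a)
  interpret tensor_functor "presented R" Q F by fact
  show ?case using map_coev[of a] by simp
next
  case (TAdd f g)
  interpret tensor_functor "presented R" Q F by fact
  show ?case using TAdd map_add[of "cls R f" "src f" "tgt f" "cls R g"] by auto
next
  case (TScl c f)
  interpret tensor_functor "presented R" Q F by fact
  show ?case using TScl map_scl[of "cls R f" "src f" "tgt f" c] by auto
next
  case (TCmp g f)
  interpret tensor_functor "presented R" Q F by fact
  show ?case using TCmp map_cmp[of "cls R f" "src f" "tgt f" "cls R g" "tgt g"] by auto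
next
  case (TTns f g)
  interpret tensor_functor "presented R" Q F by fact
  show ?case
    using TTns map_tns[of "cls R f" "src f" "tgt f" "cls R g" "src g" "tgt g"] by auto
qed auto

end

section \<open>Morphisms of the graph planar algebra as matrices over paths\<close>

locale gpa_graph = fin_digraph G for G :: "('v, 'e) pre_digraph" (structure) +
  fixes lam :: "'v \<Rightarrow> real"
  assumes lam_pos: "v \<in> verts G \<Longrightarrow> lam v > 0"
begin

abbreviation "pend \<equiv> path_end G"
abbreviation "paths \<equiv> spaths G"

definition ptake :: "nat \<Rightarrow> ('v, 'e) path \<Rightarrow> ('v, 'e) path" where
  "ptake n p = (fst p, take n (snd p))"

definition pdrop :: "nat \<Rightarrow> ('v, 'e) path \<Rightarrow> ('v, 'e) path" where
  "pdrop n p = (pend (ptake n p), drop n (snd p))"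

lemma step_ends: "snd x \<in> arcs G \<Longrightarrow> step_src G x \<in> verts G \<and> step_tgt G x \<in> verts G"
  by (cases "(G, x)" rule: step_src.cases) auto

lemma pend_append: "pend (v, xs @ ys) = pend (pend (v, xs), ys)"
  by (induction xs arbitrary: v) auto

lemma is_path_verts: "is_path G (v, xs) \<Longrightarrow> v \<in> verts G \<and> pend (v, xs) \<in> verts G"
  by (induction xs arbitrary: v) (auto simp: step_ends)

lemma is_path_append:
  "is_path G (v, xs @ ys) \<longleftrightarrow> is_path G (v, xs) \<and> is_path G (pend (v, xs), ys)"
  by (induction xs arbitrary: v) (auto dest: is_path_verts)

lemma paths_verts: "p \<in> paths s \<Longrightarrow> fst p \<in> verts G \<and> pend p \<in> verts G"
  by (cases p) (auto simp: spaths_def dest: is_path_verts)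

lemma paths_Nil: "p \<in> paths [] \<longleftrightarrow> snd p = [] \<and> fst p \<in> verts G"
  by (cases p) (auto simp: spaths_def)

lemma paths_length: "p \<in> paths s \<Longrightarrow> length (snd p) = length s"
  by (auto simp: spaths_def)

lemma finite_paths [simp, intro]: "finite (paths s)"
proof (induction s)
  case Nil
  have "paths [] = (\<lambda>v. (v, [])) ` verts G"
    by (force simp: paths_Nil)
  then show ?case by simp
next
  case (Cons a s)
  have "paths (a # s) \<subseteq> (\<lambda>(e, p). (step_src G (a, e), (a, e) # snd p)) ` (arcs G \<times> paths s)"
  proof
    fix p assume "p \<in> paths (a # s)"
    then obtain v e xs where "p = (v, (a, e) # xs)" "e \<in> arcs G" "step_src G (a, e) = v"
      "(step_tgt G (a, e), xs) \<in> paths s"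
      by (cases p) (auto simp: spaths_def)
    then show "p \<in> (\<lambda>(e, p). (step_src G (a, e), (a, e) # snd p)) ` (arcs G \<times> paths s)"
      by (intro image_eqI[of _ _ "(e, (step_tgt G (a, e), xs))"]) auto
  qed
  then show ?case
    by (rule finite_subset) (use Cons in simp)
qed

text \<open>The two factors of a concatenated path are recovered from the length of the first. All formulas for tensor products rest on this.\<close>

lemma path_append_eq:
  assumes "p \<in> paths s" "pend p = fst q"
  shows "path_append p q = r \<longleftrightarrow> p = ptake (length s) r \<and> q = pdrop (length s) r"
  using assms
  by (cases p; cases q; cases r) (auto simp: ptake_def pdrop_def dest!: paths_length)

lemma path_append_take_drop [simp]: "path_append (ptake n p) (pdrop n p) = p"
  by (cases p) (simp add: ptake_def pdrop_def)

lemma fst_path_append [simp]: "fst (path_append p q) = fst p"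
  by (cases p; cases q) simp

lemma snd_path_append [simp]: "snd (path_append p q) = snd p @ snd q"
  by (cases p; cases q) simp

lemma fst_ptake [simp]: "fst (ptake n p) = fst p"
  by (simp add: ptake_def)

lemma fst_pdrop [simp]: "fst (pdrop n p) = pend (ptake n p)"
  by (simp add: pdrop_def)

lemma pend_pdrop [simp]: "pend (pdrop n p) = pend p"
  by (cases p) (simp add: pdrop_def ptake_def pend_append[symmetric])

lemma ptake_append [simp]: "p \<in> paths s \<Longrightarrow> ptake (length s) (path_append p q) = p"
  by (cases p; cases q) (auto simp: ptake_def dest!: paths_length)

lemma pdrop_append [simp]:
  "p \<in> paths s \<Longrightarrow> pend p = fst q \<Longrightarrow> pdrop (length s) (path_append p q) = q"
  by (cases p; cases q) (auto simp: pdrop_def ptake_def dest!: paths_length)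

lemma pend_path_append [simp]: "pend p = fst q \<Longrightarrow> pend (path_append p q) = pend q"
  by (cases p; cases q) (simp add: pend_append)

lemma paths_append_iff:
  "r \<in> paths (s @ t) \<longleftrightarrow> ptake (length s) r \<in> paths s \<and> pdrop (length s) r \<in> paths t"
proof -
  obtain v xs where r: "r = (v, xs)" by force
  have "map fst xs = s @ t \<longleftrightarrow> map fst (take (length s) xs) = s \<and> map fst (drop (length s) xs) = t"
    by (metis append_eq_conv_conj append_take_drop_id map_append take_map drop_map)
  then show ?thesis
    using is_path_append[of v "take (length s) xs" "drop (length s) xs"]
    by (auto simp: r spaths_def ptake_def pdrop_def)
qed

lemma path_append_in_paths:
  "p \<in> paths s \<Longrightarrow> q \<in> paths t \<Longrightarrow> pend p = fst q \<Longrightarrow> path_append p q \<in> paths (s @ t)"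
  by (simp add: paths_append_iff)

lemma ptake_ptake: "ptake m (ptake n p) = ptake (min m n) p"
  by (simp add: ptake_def)

lemma ptake_pdrop: "ptake m (pdrop n p) = pdrop n (ptake (n + m) p)"
  by (cases p) (simp add: ptake_def pdrop_def take_drop add.commute)

lemma pdrop_pdrop: "pdrop m (pdrop n p) = pdrop (n + m) p"
proof (cases p)
  case (Pair v xs)
  then show ?thesis
    using pend_append[of v "take n xs" "take m (drop n xs)"]
    by (simp add: ptake_def pdrop_def take_add add.commute[of m n])
qed

declare path_append.simps [simp del]

text \<open>Splitting paths is a bijection onto composable pairs; needed for the interchange law.\<close>

lemma sum_paths_append:
  "(\<Sum>q\<in>paths (s @ t). h (ptake (length s) q) (pdrop (length s) q)) =
   (\<Sum>q\<in>paths s. \<Sum>q'\<in>paths t. if pend q = fst q' then h q q' else (0 :: complex))"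
proof -
  have "(\<Sum>q\<in>paths s. \<Sum>q'\<in>paths t. if pend q = fst q' then h q q' else 0) =
    (\<Sum>(q, q')\<in>paths s \<times> paths t. if pend q = fst q' then h q q' else 0)"
    by (simp add: sum.cartesian_product)
  also have "\<dots> = (\<Sum>(q, q') | q \<in> paths s \<and> q' \<in> paths t \<and> pend q = fst q'. h q q')"
    by (rule sum.mono_neutral_cong_right) (auto split: if_splits)
  also have "\<dots> = (\<Sum>q\<in>paths (s @ t). h (ptake (length s) q) (pdrop (length s) q))"
    by (rule sum.reindex_bij_witness[where
          i = "\<lambda>q. (ptake (length s) q, pdrop (length s) q)" and j = "\<lambda>(q, q'). path_append q q'"])
      (auto simp: paths_append_iff)
  finally show ?thesis by simp
qed

subsection \<open>Coefficients\<close>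

abbreviation "Q \<equiv> oGPA G lam"

lemma Hom_iff: "f \<in> Hom Q s t \<longleftrightarrow> (\<forall>p r. f (p, r) \<noteq> 0 \<longrightarrow>
    p \<in> paths s \<and> r \<in> paths t \<and> fst p = fst r \<and> pend p = pend r)"
  by (auto simp: oGPA_def gpa_basis_def)

lemma HomD:
  assumes "f \<in> Hom Q s t" "f (p, r) \<noteq> 0"
  shows "p \<in> paths s" "r \<in> paths t" "fst p = fst r" "pend p = pend r"
  using assms unfolding Hom_iff by blast+

lemma Nul_coeff [simp]: "Nul Q s t x = 0"
  by (simp add: oGPA_def)

lemma Add_coeff [simp]: "Add Q f g x = f x + g x"
  by (simp add: oGPA_def)

lemma Scl_coeff [simp]: "Scl Q c f x = c * f x"
  by (simp add: oGPA_def)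

lemma Ide_coeff [simp]: "Ide Q s (p, r) = (if p = r \<and> p \<in> paths s then 1 else 0)"
proof -
  have "Ide Q s (p, r) = (\<Sum>q\<in>paths s. if q = p then (if p = r then 1 else 0) else 0)"
    unfolding oGPA_def lincomb_def planar.simps by (rule sum.cong) auto
  then show ?thesis by simp
qed

lemma sum_support:
  assumes f: "f \<in> Hom Q s t" and h: "\<And>x. f x = 0 \<Longrightarrow> h x = (0 :: complex)"
  shows "(\<Sum>x | f x \<noteq> 0. h x) = (\<Sum>p\<in>paths s. \<Sum>r\<in>paths t. h (p, r))"
proof -
  have "(\<Sum>x | f x \<noteq> 0. h x) = (\<Sum>x\<in>paths s \<times> paths t. h x)"
    using HomD(1,2)[OF f] h by (intro sum.mono_neutral_left) auto
  then show ?thesis by (simp add: sum.cartesian_product')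
qed

lemma sum_delta2:
  assumes "finite A" "finite B"
  shows "(\<Sum>x\<in>A. \<Sum>y\<in>B. if x = a \<and> y = b then c else 0) = (if a \<in> A \<and> b \<in> B then c else (0 :: complex))"
proof -
  have "(\<Sum>x\<in>A. \<Sum>y\<in>B. if x = a \<and> y = b then c else 0) =
    (\<Sum>x\<in>A. if x = a then \<Sum>y\<in>B. if y = b then c else 0 else 0)"
    by (intro sum.cong refl) auto
  then show ?thesis using assms by simp
qed

lemma Cmp_coeff:
  assumes f: "f \<in> Hom Q s t" and g: "g \<in> Hom Q t u"
  shows "Cmp Q g f (p, r) = (\<Sum>q\<in>paths t. f (p, q) * g (q, r))"
proof -
  have inner: "(\<Sum>b' | f b' \<noteq> 0. if cmp_basis b b' = Some (p, r) then g b * f b' else 0) =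
    (if snd b = r then f (p, fst b) * g b else 0)" for b
  proof -
    have "(\<Sum>b' | f b' \<noteq> 0. if cmp_basis b b' = Some (p, r) then g b * f b' else 0) =
      (\<Sum>p'\<in>paths s. \<Sum>q'\<in>paths t. if cmp_basis b (p', q') = Some (p, r) then g b * f (p', q') else 0)"
      by (rule sum_support[OF f]) simp
    also have "\<dots> = (\<Sum>p'\<in>paths s. \<Sum>q'\<in>paths t. if p' = p \<and> q' = fst b
        then if snd b = r then f (p, fst b) * g b else 0 else 0)"
      by (intro sum.cong refl, cases b) auto
    also have "\<dots> = (if snd b = r then f (p, fst b) * g b else 0)"
      using HomD(1,2)[OF f, of p "fst b"] by (auto simp: sum_delta2)
    finally show ?thesis .
  qed
  have "Cmp Q g f (p, r) = (\<Sum>b | g b \<noteq> 0. if snd b = r then f (p, fst b) * g b else 0)"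
    by (simp only: oGPA_def bilin_def inner planar.simps)
  also have "\<dots> = (\<Sum>q\<in>paths t. \<Sum>r'\<in>paths u. if r' = r then f (p, q) * g (q, r) else 0)"
    by (subst sum_support[OF g]) (auto intro!: sum.cong)
  also have "\<dots> = (\<Sum>q\<in>paths t. f (p, q) * g (q, r))"
    by (intro sum.cong refl) (auto dest: HomD(2)[OF g])
  finally show ?thesis .
qed

text \<open>At most one pair of basis elements contributes to a given coefficient, namely the initial and final segments.\<close>

lemma Tns_coeff:
  assumes f: "f \<in> Hom Q s t" and g: "g \<in> Hom Q s' t'"
  shows "Tns Q f g (p, r) = f (ptake (length s) p, ptake (length t) r) *
    g (pdrop (length s) p, pdrop (length t) r)"
    (is "_ = f (?p1, ?r1) * g (?p2, ?r2)")
proof -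
  have eq: "tns_basis G b (p2, r2) = Some (p, r) \<longleftrightarrow>
      fst b = ?p1 \<and> snd b = ?r1 \<and> p2 = ?p2 \<and> r2 = ?r2"
    if "fst b \<in> paths s" "snd b \<in> paths t" for b p2 r2
    using path_append_eq[OF that(1), of p2 p] path_append_eq[OF that(2), of r2 r]
    by (cases b) auto
  have inner: "(\<Sum>b' | g b' \<noteq> 0. if tns_basis G b b' = Some (p, r) then f b * g b' else 0) =
    (if fst b = ?p1 \<and> snd b = ?r1 then f b * g (?p2, ?r2) else 0)"
    if b: "f b \<noteq> 0" for b
  proof -
    have b: "fst b \<in> paths s" "snd b \<in> paths t"
      using HomD[OF f, of "fst b" "snd b"] b by auto
    have "(\<Sum>b' | g b' \<noteq> 0. if tns_basis G b b' = Some (p, r) then f b * g b' else 0) =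
      (\<Sum>p2\<in>paths s'. \<Sum>r2\<in>paths t'. if tns_basis G b (p2, r2) = Some (p, r)
        then f b * g (p2, r2) else 0)"
      by (rule sum_support[OF g]) simp
    also have "\<dots> = (\<Sum>p2\<in>paths s'. \<Sum>r2\<in>paths t'. if p2 = ?p2 \<and> r2 = ?r2 then
        if fst b = ?p1 \<and> snd b = ?r1 then f b * g (?p2, ?r2) else 0 else 0)"
      by (intro sum.cong refl) (simp add: eq[OF b])
    also have "\<dots> = (if fst b = ?p1 \<and> snd b = ?r1 then f b * g (?p2, ?r2) else 0)"
      using HomD(1,2)[OF g, of ?p2 ?r2] by (auto simp: sum_delta2)
    finally show ?thesis .
  qed
  have "Tns Q f g (p, r) = (\<Sum>b | f b \<noteq> 0. if fst b = ?p1 \<and> snd b = ?r1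
      then f b * g (?p2, ?r2) else 0)"
    unfolding oGPA_def bilin_def planar.simps by (rule sum.cong[OF refl inner]) simp
  also have "\<dots> = (\<Sum>p1\<in>paths s. \<Sum>r1\<in>paths t. if p1 = ?p1 \<and> r1 = ?r1
      then f (?p1, ?r1) * g (?p2, ?r2) else 0)"
    by (subst sum_support[OF f]) (auto intro!: sum.cong)
  also have "\<dots> = f (?p1, ?r1) * g (?p2, ?r2)"
    using HomD(1,2)[OF f, of ?p1 ?r1] by (auto simp: sum_delta2)
  finally show ?thesis .
qed

lemma Coev_coeff:
  "Coev Q a (p, r) = (\<Sum>e\<in>arcs G. if p = (step_src G (a, e), []) \<and>
     r = (step_src G (a, e), [(a, e), (opp a, e)]) then gpa_coev_coeff G lam (a, e) else 0)"
  by (auto simp: oGPA_def lincomb_def intro!: sum.cong)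

lemma Ev_coeff: "Ev Q a (p, r) = Coev Q a (r, p)"
  unfolding Coev_coeff by (auto simp: oGPA_def lincomb_def intro!: sum.cong)

subsection \<open>Closure\<close>

lemma step_flip [simp]:
  "step_src G (opp a, e) = step_tgt G (a, e)" "step_tgt G (opp a, e) = step_src G (a, e)"
  by (cases a; simp)+

lemma Nul_hom: "Nul Q s t \<in> Hom Q s t"
  by (simp add: Hom_iff)

lemma Add_hom: "f \<in> Hom Q s t \<Longrightarrow> g \<in> Hom Q s t \<Longrightarrow> Add Q f g \<in> Hom Q s t"
  unfolding Hom_iff Add_coeff by (metis add_0)

lemma Scl_hom: "f \<in> Hom Q s t \<Longrightarrow> Scl Q c f \<in> Hom Q s t"
  unfolding Hom_iff Scl_coeff by (metis mult_zero_right)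

lemma Ide_hom: "Ide Q s \<in> Hom Q s s"
  unfolding Hom_iff Ide_coeff by presburger

lemma Cmp_hom:
  assumes f: "f \<in> Hom Q s t" and g: "g \<in> Hom Q t u"
  shows "Cmp Q g f \<in> Hom Q s u"
  unfolding Hom_iff Cmp_coeff[OF f g]
proof (intro allI impI)
  fix p r
  assume "(\<Sum>q\<in>paths t. f (p, q) * g (q, r)) \<noteq> 0"
  then obtain q where "f (p, q) * g (q, r) \<noteq> 0"
    by (rule sum.not_neutral_contains_not_neutral)
  then have "f (p, q) \<noteq> 0" "g (q, r) \<noteq> 0"
    by simp_all
  with HomD[OF f this(1)] HomD[OF g this(2)]
  show "p \<in> paths s \<and> r \<in> paths u \<and> fst p = fst r \<and> pend p = pend r"
    by simp
qed

lemma Tns_hom: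
  assumes f: "f \<in> Hom Q s t" and g: "g \<in> Hom Q s' t'"
  shows "Tns Q f g \<in> Hom Q (s @ s') (t @ t')"
  unfolding Hom_iff Tns_coeff[OF f g]
proof (intro allI impI)
  fix p r
  let ?p1 = "ptake (length s) p" and ?p2 = "pdrop (length s) p"
  let ?r1 = "ptake (length t) r" and ?r2 = "pdrop (length t) r"
  assume "f (?p1, ?r1) * g (?p2, ?r2) \<noteq> 0"
  then have "f (?p1, ?r1) \<noteq> 0" "g (?p2, ?r2) \<noteq> 0"
    by simp_all
  with HomD[OF f this(1)] HomD[OF g this(2)]
  show "p \<in> paths (s @ s') \<and> r \<in> paths (t @ t') \<and> fst p = fst r \<and> pend p = pend r"
    by (simp add: paths_append_iff)
qed

lemma Coev_hom: "Coev Q a \<in> Hom Q [] [a, opp a]"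
proof -
  have "p \<in> paths [] \<and> r \<in> paths [a, opp a] \<and> fst p = fst r \<and> pend p = pend r"
    if nz: "Coev Q a (p, r) \<noteq> 0" for p r
  proof -
    obtain e where "e \<in> arcs G" "p = (step_src G (a, e), [])" "r = (step_src G (a, e), [(a, e), (opp a, e)])"
      using sum.not_neutral_contains_not_neutral[OF nz[unfolded Coev_coeff]]
      by (metis (mono_tags, lifting))
    then show ?thesis
      using step_ends[of "(a, e)"] by (auto simp: spaths_def)
  qed
  then show ?thesis by (simp add: Hom_iff)
qed

lemma Ev_hom: "Ev Q a \<in> Hom Q [a, opp a] []"
  using Coev_hom[of a] unfolding Hom_iff Ev_coeff by auto

end

section \<open>Monoidal structure, dagger and cups\<close>

context gpa_graph begin

lemmas homs = Nul_hom Add_hom Scl_hom Ide_hom Cmp_hom Tns_hom Ev_hom Coev_hom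

lemma gpa_eqI: "(\<And>p r. f (p, r) = g (p, r)) \<Longrightarrow> f = (g :: ('v, 'e) gpa)"
  by auto

lemma Cmp_assoc:
  assumes f: "f \<in> Hom Q s t" and g: "g \<in> Hom Q t u" and h: "h \<in> Hom Q u v"
  shows "Cmp Q (Cmp Q h g) f = Cmp Q h (Cmp Q g f)"
proof (rule gpa_eqI)
  fix p r
  have "Cmp Q (Cmp Q h g) f (p, r) =
    (\<Sum>q\<in>paths t. \<Sum>q'\<in>paths u. f (p, q) * (g (q, q') * h (q', r)))"
    by (simp add: Cmp_coeff[OF f Cmp_hom[OF g h]] Cmp_coeff[OF g h] sum_distrib_left)
  also have "\<dots> = Cmp Q h (Cmp Q g f) (p, r)"
    by (subst sum.swap)
      (simp add: Cmp_coeff[OF Cmp_hom[OF f g] h] Cmp_coeff[OF f g] sum_distrib_right mult.assoc)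
  finally show "Cmp Q (Cmp Q h g) f (p, r) = Cmp Q h (Cmp Q g f) (p, r)" .
qed

lemma Cmp_Ide_left:
  assumes f: "f \<in> Hom Q s t"
  shows "Cmp Q (Ide Q t) f = f"
proof (rule gpa_eqI)
  fix p r
  have "Cmp Q (Ide Q t) f (p, r) = (\<Sum>q\<in>paths t. if q = r then f (p, r) else 0)"
    unfolding Cmp_coeff[OF f Ide_hom] by (intro sum.cong) auto
  then show "Cmp Q (Ide Q t) f (p, r) = f (p, r)"
    using HomD(2)[OF f, of p r] by auto
qed

lemma Cmp_Ide_right:
  assumes f: "f \<in> Hom Q s t"
  shows "Cmp Q f (Ide Q s) = f"
proof (rule gpa_eqI)
  fix p r
  have "Cmp Q f (Ide Q s) (p, r) = (\<Sum>q\<in>paths s. if q = p then f (p, r) else 0)"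
    unfolding Cmp_coeff[OF Ide_hom f] by (intro sum.cong) auto
  then show "Cmp Q f (Ide Q s) (p, r) = f (p, r)"
    using HomD(1)[OF f, of p r] by auto
qed

lemma Tns_assoc:
  assumes f: "f \<in> Hom Q s t" and g: "g \<in> Hom Q s' t'" and h: "h \<in> Hom Q s'' t''"
  shows "Tns Q (Tns Q f g) h = Tns Q f (Tns Q g h)"
  by (rule gpa_eqI)
    (simp add: Tns_coeff[OF Tns_hom[OF f g] h] Tns_coeff[OF f g] Tns_coeff[OF g h]
      Tns_coeff[OF f Tns_hom[OF g h]] ptake_ptake ptake_pdrop pdrop_pdrop)

lemma ptake_0 [simp]: "ptake 0 p = (fst p, [])"
  by (simp add: ptake_def)

lemma pdrop_0 [simp]: "pdrop 0 p = p"
  by (simp add: pdrop_def)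

lemma Tns_unit_left:
  assumes f: "f \<in> Hom Q s t"
  shows "Tns Q (Ide Q []) f = f"
proof (rule gpa_eqI)
  fix p r
  show "Tns Q (Ide Q []) f (p, r) = f (p, r)"
    unfolding Tns_coeff[OF Ide_hom f]
    using HomD[OF f, of p r] paths_verts[of p s] by (cases "f (p, r) = 0") (auto simp: paths_Nil)
qed

lemma Tns_unit_right:
  assumes f: "f \<in> Hom Q s t"
  shows "Tns Q f (Ide Q []) = f"
proof (rule gpa_eqI)
  fix p r
  have *: "ptake (length u) p = p \<and> pdrop (length u) p = (pend p, [])" if "p \<in> paths u" for u p
    using paths_length[OF that] by (simp add: ptake_def pdrop_def)
  have **: "f (ptake (length s) p, ptake (length t) r) = f (p, r)"
    if "snd (pdrop (length s) p) = []" "snd (pdrop (length t) r) = []"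
    using that by (simp add: pdrop_def ptake_def)
  show "Tns Q f (Ide Q []) (p, r) = f (p, r)"
  proof (cases "f (p, r) = 0")
    case True
    then show ?thesis
      unfolding Tns_coeff[OF f Ide_hom] using ** by (auto simp: paths_Nil)
  next
    case False
    note pr = HomD[OF f False]
    show ?thesis
      unfolding Tns_coeff[OF f Ide_hom] using *[OF pr(1)] *[OF pr(2)] pr(4) paths_verts[OF pr(1)]
      by (simp add: paths_Nil)
  qed
qed

lemma ptake_pdrop_eq_iff: "ptake n p = ptake n r \<and> pdrop n p = pdrop n r \<longleftrightarrow> p = r"
  using path_append_take_drop by metis

lemma Tns_Ide: "Tns Q (Ide Q s) (Ide Q t) = Ide Q (s @ t)"
proof (rule gpa_eqI)
  fix p r
  show "Tns Q (Ide Q s) (Ide Q t) (p, r) = Ide Q (s @ t) (p, r)"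
    unfolding Tns_coeff[OF Ide_hom Ide_hom]
    using ptake_pdrop_eq_iff[of "length s" p r] by (auto simp: paths_append_iff)
qed

text \<open>Pairs of middle paths that do not compose contribute zero to the product of sums, since the end of the left one and the start of the right one are both forced by the outer paths.\<close>

lemma interchange_law:
  assumes f: "f \<in> Hom Q s t" and g: "g \<in> Hom Q t u"
    and f': "f' \<in> Hom Q s' t'" and g': "g' \<in> Hom Q t' u'"
  shows "Tns Q (Cmp Q g f) (Cmp Q g' f') = Cmp Q (Tns Q g g') (Tns Q f f')"
proof (rule gpa_eqI)
  fix p r
  let ?p1 = "ptake (length s) p" and ?p2 = "pdrop (length s) p"
  let ?r1 = "ptake (length u) r" and ?r2 = "pdrop (length u) r"
  let ?h = "\<lambda>q q'. f (?p1, q) * f' (?p2, q') * (g (q, ?r1) * g' (q', ?r2))"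
  have "Cmp Q (Tns Q g g') (Tns Q f f') (p, r) =
    (\<Sum>q\<in>paths (t @ t'). ?h (ptake (length t) q) (pdrop (length t) q))"
    by (simp add: Cmp_coeff[OF Tns_hom[OF f f'] Tns_hom[OF g g']] Tns_coeff[OF f f'] Tns_coeff[OF g g'])
  also have "\<dots> = (\<Sum>q\<in>paths t. \<Sum>q'\<in>paths t'. if pend q = fst q' then ?h q q' else 0)"
    by (rule sum_paths_append)
  also have "\<dots> = (\<Sum>q\<in>paths t. \<Sum>q'\<in>paths t'. ?h q q')"
    using HomD(4)[OF f, of ?p1] HomD(3)[OF f', of ?p2] by (intro sum.cong refl) fastforce
  also have "\<dots> = Tns Q (Cmp Q g f) (Cmp Q g' f') (p, r)"
    by (simp add: Tns_coeff[OF Cmp_hom[OF f g] Cmp_hom[OF f' g']] Cmp_coeff[OF f g]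
        Cmp_coeff[OF f' g'] sum_product mult_ac)
  finally show "Tns Q (Cmp Q g f) (Cmp Q g' f') (p, r) = Cmp Q (Tns Q g g') (Tns Q f f') (p, r)" ..
qed

subsection \<open>The dagger\<close>

lemma gpa_dag_coeff [simp]: "gpa_dag f (p, r) = cnj (f (r, p))"
  by (simp add: gpa_dag_def)

lemma gpa_dag_hom: "f \<in> Hom Q s t \<Longrightarrow> gpa_dag f \<in> Hom Q t s"
  unfolding Hom_iff gpa_dag_coeff by (metis complex_cnj_zero)

lemma gpa_dag_Cmp:
  assumes f: "f \<in> Hom Q s t" and g: "g \<in> Hom Q t u"
  shows "gpa_dag (Cmp Q g f) = Cmp Q (gpa_dag f) (gpa_dag g)"
  by (rule gpa_eqI)
    (simp add: Cmp_coeff[OF f g] Cmp_coeff[OF gpa_dag_hom[OF g] gpa_dag_hom[OF f]] mult.commute)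

lemma gpa_dag_Tns:
  assumes f: "f \<in> Hom Q s t" and g: "g \<in> Hom Q s' t'"
  shows "gpa_dag (Tns Q f g) = Tns Q (gpa_dag f) (gpa_dag g)"
  by (rule gpa_eqI)
    (simp add: Tns_coeff[OF f g] Tns_coeff[OF gpa_dag_hom[OF f] gpa_dag_hom[OF g]])

lemma gpa_dag_Ide: "gpa_dag (Ide Q s) = Ide Q s"
  by (rule gpa_eqI) auto

lemma gpa_dag_Ev: "gpa_dag (Ev Q a) = Coev Q a"
  by (rule gpa_eqI) (auto simp: Ev_coeff Coev_coeff gpa_coev_coeff_def intro!: sum.cong)

lemma gpa_dag_Coev: "gpa_dag (Coev Q a) = Ev Q a"
  by (rule gpa_eqI) (auto simp: Ev_coeff Coev_coeff gpa_coev_coeff_def intro!: sum.cong)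

subsection \<open>Cups\<close>

definition prev :: "('v, 'e) path \<Rightarrow> ('v, 'e) path" where
  "prev p = (pend p, rev (map (\<lambda>(a, e). (opp a, e)) (snd p)))"

definition wgt :: "('v, 'e) path \<Rightarrow> complex" where
  "wgt p = of_real (sqrt (lam (pend p) / lam (fst p)))"

definition loop :: "('v, 'e) path \<Rightarrow> ('v, 'e) path" where
  "loop x = path_append x (prev x)"

lemma fst_prev [simp]: "fst (prev p) = pend p"
  by (simp add: prev_def)

lemma prev_path:
  assumes "p \<in> paths s"
  shows "prev p \<in> paths (dobj s) \<and> pend (prev p) = fst p"
proof -
  obtain v xs where p: "p = (v, xs)" by force
  have "is_path G (v, xs) \<Longrightarrow> is_path G (prev (v, xs)) \<and> pend (prev (v, xs)) = v"
  proof (induction xs arbitrary: v)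
    case (Cons x xs)
    obtain a e where x: "x = (a, e)" by force
    show ?case
      using Cons.IH[of "step_tgt G x"] Cons.prems step_ends[of x]
      by (auto simp: prev_def x is_path_append pend_append)
  qed (simp add: prev_def)
  moreover have "map fst (rev (map (\<lambda>(a, e). (opp a, e)) xs)) = dobj (map fst xs)"
    by (induction xs) auto
  ultimately show ?thesis
    using assms by (auto simp: p spaths_def prev_def)
qed

lemma prev_prev [simp]: "p \<in> paths s \<Longrightarrow> prev (prev p) = p"
  using prev_path[of p s] by (cases p) (auto simp: prev_def rev_map o_def case_prod_unfold)

lemma prev_append:
  "pend p = fst q \<Longrightarrow> prev (path_append p q) = path_append (prev q) (prev p)"
  by (cases p; cases q) (auto simp: prev_def path_append.simps pend_append)

lemma wgt_prev: "p \<in> paths s \<Longrightarrow> wgt p * wgt (prev p) = 1"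
  using prev_path[of p s] paths_verts[of p s] lam_pos
  by (auto simp: wgt_def less_le of_real_mult[symmetric] real_sqrt_mult[symmetric]
      simp del: of_real_mult)

lemma wgt_append:
  assumes "p \<in> paths s" "q \<in> paths t" "pend p = fst q"
  shows "wgt (path_append p q) = wgt p * wgt q"
proof -
  have "lam (fst q) \<noteq> 0"
    using lam_pos[of "fst q"] paths_verts[OF assms(2)] by auto
  then show ?thesis
    using assms(3)
    by (simp add: wgt_def of_real_mult[symmetric] real_sqrt_mult[symmetric] del: of_real_mult)
qed

lemma loop_path:
  assumes "x \<in> paths s"
  shows "loop x \<in> paths (s @ dobj s)" "fst (loop x) = fst x" "pend (loop x) = fst x"
  using prev_path[OF assms] path_append_in_paths[OF assms, of "prev x"] by (auto simp: loop_def)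

lemma Coev_cup:
  "Coev Q a (p, r) = (\<Sum>x\<in>paths [a]. if p = (fst x, []) \<and> r = loop x then wgt x else 0)"
proof -
  let ?x = "\<lambda>e. (step_src G (a, e), [(a, e)])"
  have "paths [a] = ?x ` arcs G"
    using step_ends by (fastforce simp: spaths_def image_iff)
  moreover have "inj_on ?x (arcs G)"
    by (auto intro: inj_onI)
  ultimately show ?thesis
    by (simp add: Coev_coeff sum.reindex loop_def prev_def path_append.simps wgt_def
        gpa_coev_coeff_def cong: if_cong)
qed

lemma coevs_hom: "coevs Q s \<in> Hom Q [] (s @ dobj s)"
proof (induction s)
  case (Cons a s)
  then show ?case
    using Cmp_hom[OF Coev_hom, of "Tns Q (Tns Q (Ide Q [a]) (coevs Q s)) (Ide Q [opp a])" a]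
      Tns_hom[OF Tns_hom[OF Ide_hom[of "[a]"] Cons] Ide_hom[of "[opp a]"]] by simp
qed (simp add: Ide_hom)

lemma evs_hom: "evs Q s \<in> Hom Q (s @ dobj s) []"
proof (induction s)
  case (Cons a s)
  then show ?case
    using Cmp_hom[OF _ Ev_hom, of "Tns Q (Tns Q (Ide Q [a]) (evs Q s)) (Ide Q [opp a])" _ a]
      Tns_hom[OF Tns_hom[OF Ide_hom[of "[a]"] Cons] Ide_hom[of "[opp a]"]] by simp
qed (simp add: Ide_hom)

lemma evs_eq_dag_coevs: "evs Q s = gpa_dag (coevs Q s)"
proof (induction s)
  case (Cons a s)
  have 1: "Tns Q (Ide Q [a]) (coevs Q s) \<in> Hom Q [a] ([a] @ s @ dobj s)"
    using Tns_hom[OF Ide_hom[of "[a]"] coevs_hom[of s]] by simp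
  have 2: "Tns Q (Tns Q (Ide Q [a]) (coevs Q s)) (Ide Q [opp a]) \<in> Hom Q [a, opp a] (a # s @ dobj s @ [opp a])"
    using Tns_hom[OF 1 Ide_hom[of "[opp a]"]] by simp
  show ?case
    by (simp add: Cons gpa_dag_Cmp[OF Coev_hom 2] gpa_dag_Tns[OF 1 Ide_hom]
        gpa_dag_Tns[OF Ide_hom coevs_hom] gpa_dag_Ide gpa_dag_Coev)
qed (simp add: gpa_dag_Ide)


lemma Tns_append_left:
  assumes f: "f \<in> Hom Q s t" and g: "g \<in> Hom Q s' t'" and "p \<in> paths s" "pend p = fst q"
  shows "Tns Q f g (path_append p q, r) = f (p, ptake (length t) r) * g (q, pdrop (length t) r)"
  using assms by (simp add: Tns_coeff[OF f g])

lemma Tns_append_append: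
  assumes f: "f \<in> Hom Q s t" and g: "g \<in> Hom Q s' t'"
    and "p \<in> paths s" "pend p = fst q" "p' \<in> paths t" "pend p' = fst q'"
  shows "Tns Q f g (path_append p q, path_append p' q') = f (p, p') * g (q, q')"
  using assms by (simp add: Tns_coeff[OF f g])

lemma path_append_Nil [simp]: "path_append p (v, []) = p"
  by (cases p) (simp add: path_append.simps)

lemma path_append_assoc: "path_append (path_append p q) r = path_append p (path_append q r)"
  by (cases p; cases q; cases r) (simp add: path_append.simps)

text \<open>By induction, wrapping \<open>loop y\<close> between an edge and its reversal yields \<open>loop\<close> of the longer path, and the weights multiply.\<close>

lemma coevs_cup:
  "coevs Q s (p, r) = (\<Sum>x\<in>paths s. if p = (fst x, []) \<and> r = loop x then wgt x else 0)"
proof (induction s arbitrary: p r)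
  case Nil
  have "coevs Q [] (p, r) = (\<Sum>x\<in>paths []. if x = p then if p = r then 1 else 0 else 0)"
    by simp
  also have "\<dots> = (\<Sum>x\<in>paths []. if p = (fst x, []) \<and> r = loop x then wgt x else 0)"
    using lam_pos
    by (intro sum.cong refl) (force simp: paths_Nil loop_def prev_def path_append.simps wgt_def)
  finally show ?case .
next
  case (Cons a s)
  let ?T1 = "Tns Q (Ide Q [a]) (coevs Q s)"
  let ?T = "Tns Q ?T1 (Ide Q [opp a])"
  have T1_hom: "?T1 \<in> Hom Q [a] ([a] @ (s @ dobj s))"
    using Tns_hom[OF Ide_hom[of "[a]"] coevs_hom[of s]] by simp
  have T_hom: "?T \<in> Hom Q [a, opp a] (([a] @ (s @ dobj s)) @ [opp a])"
    using Tns_hom[OF T1_hom Ide_hom[of "[opp a]"]] by simp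
  have T1: "?T1 (x, r) = (\<Sum>y\<in>paths s. if pend x = fst y \<and> path_append x (loop y) = r then wgt y else 0)"
    if x: "x \<in> paths [a]" for x r
  proof -
    have eq: "path_append x (loop y) = r \<longleftrightarrow>
        x = ptake (length [a]) r \<and> pdrop (length [a]) r = loop y"
      if "y \<in> paths s" "pend x = fst y" for y
      using path_append_eq[OF x, of "loop y" r] loop_path(2)[OF that(1)] that(2) by auto
    have "?T1 (path_append x (pend x, []), r) =
        (if x = ptake (length [a]) r then 1 else 0) * coevs Q s ((pend x, []), pdrop (length [a]) r)"
      using x by (subst Tns_append_left[OF Ide_hom coevs_hom x]) auto
    also have "\<dots> = (\<Sum>y\<in>paths s. if pend x = fst y \<and> path_append x (loop y) = r then wgt y else 0)"
      unfolding Cons sum_distrib_left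
      by (intro sum.cong refl) (simp add: eq cong: conj_cong)
    finally show ?thesis by simp
  qed
  have T: "?T (loop x, r) = (\<Sum>y\<in>paths s. if pend x = fst y \<and>
      r = loop (path_append x y) then wgt y else 0)"
    if x: "x \<in> paths [a]" for x
  proof -
    have eq: "r = loop (path_append x y) \<longleftrightarrow>
        path_append x (loop y) = ptake (length ([a] @ (s @ dobj s))) r \<and>
        prev x = pdrop (length ([a] @ (s @ dobj s))) r" if "y \<in> paths s" "pend x = fst y" for y
    proof -
      have "path_append x (loop y) \<in> paths ([a] @ (s @ dobj s))"
        using path_append_in_paths[OF x loop_path(1)[OF that(1)]] loop_path(2)[OF that(1)] that(2)
        by simp
      from path_append_eq[OF this, of "prev x" r] show ?thesis
        using loop_path(2,3)[OF that(1)] that(2)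
        by (simp add: loop_def prev_append path_append_assoc eq_commute[of r])
    qed
    have "?T (loop x, r) = ?T1 (x, ptake (length ([a] @ (s @ dobj s))) r) *
        Ide Q [opp a] (prev x, pdrop (length ([a] @ (s @ dobj s))) r)"
      unfolding loop_def by (rule Tns_append_left[OF T1_hom Ide_hom x]) simp
    also have "\<dots> = (\<Sum>y\<in>paths s. if pend x = fst y \<and> r = loop (path_append x y) then wgt y else 0)"
      unfolding T1[OF x] sum_distrib_right
      using prev_path[OF x] by (intro sum.cong refl) (auto simp: eq cong: conj_cong)
    finally show ?thesis .
  qed
  have "coevs Q (a # s) (p, r) = (\<Sum>q\<in>paths [a, opp a]. Coev Q a (p, q) * ?T (q, r))"
    by (simp add: Cmp_coeff[OF Coev_hom T_hom])
  also have "\<dots> = (\<Sum>q\<in>paths [a, opp a]. \<Sum>x\<in>paths [a].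
      if q = loop x then if p = (fst x, []) then wgt x * ?T (loop x, r) else 0 else 0)"
    unfolding Coev_cup sum_distrib_right by (intro sum.cong refl) auto
  also have "\<dots> = (\<Sum>x\<in>paths [a]. if p = (fst x, []) then wgt x * ?T (loop x, r) else 0)"
    using loop_path(1)[of _ "[a]"] by (subst sum.swap) (auto intro!: sum.cong)
  also have "\<dots> = (\<Sum>x\<in>paths [a]. \<Sum>y\<in>paths s. if pend x = fst y then
      if p = (fst (path_append x y), []) \<and> r = loop (path_append x y) then wgt (path_append x y)
      else 0 else 0)"
    by (intro sum.cong refl)
      (auto simp: T sum_distrib_left wgt_append intro!: sum.cong sum.neutral)
  also have "\<dots> = (\<Sum>x\<in>paths (a # s). if p = (fst x, []) \<and> r = loop x then wgt x else 0)"
    using sum_paths_append[of "\<lambda>x y. if p = (fst (path_append x y), []) \<and> r = loop (path_append x y)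
      then wgt (path_append x y) else 0" "[a]" s, symmetric]
    by (simp del: fst_path_append fst_ptake cong: if_cong)
  finally show ?case .
qed

lemma evs_cap:
  "evs Q s (r, p) = (\<Sum>x\<in>paths s. if p = (fst x, []) \<and> r = loop x then wgt x else 0)"
  by (auto simp: evs_eq_dag_coevs coevs_cup wgt_def intro!: sum.cong)

end

section \<open>Pivotality and positivity of the trace\<close>

context gpa_graph begin

lemma Tns_coevs_Ide:
  assumes b: "b \<in> paths w"
  shows "Tns Q (coevs Q s) (Ide Q w) (b, m) =
    (\<Sum>x\<in>paths s. if fst x = fst b \<and> m = path_append (loop x) b then wgt x else 0)"
proof -
  let ?n = "length (s @ dobj s)"
  have eq: "m = path_append (loop x) b \<longleftrightarrow> ptake ?n m = loop x \<and> b = pdrop ?n m"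
    if "x \<in> paths s" "fst x = fst b" for x
    using path_append_eq[OF loop_path(1)[OF that(1)], of b m] loop_path(3)[OF that(1)] that(2)
    by auto
  have "Tns Q (coevs Q s) (Ide Q w) (b, m) =
      coevs Q s ((fst b, []), ptake ?n m) * (if b = pdrop ?n m then 1 else 0)"
    using b by (simp add: Tns_coeff[OF coevs_hom Ide_hom])
  also have "\<dots> = (\<Sum>x\<in>paths s. if fst x = fst b \<and> m = path_append (loop x) b then wgt x else 0)"
    unfolding coevs_cup sum_distrib_right
    by (intro sum.cong refl) (auto simp: eq cong: conj_cong)
  finally show ?thesis .
qed

lemma Tns_Ide_coevs:
  assumes a: "a \<in> paths u"
  shows "Tns Q (Ide Q u) (coevs Q s) (a, m) =
    (\<Sum>x\<in>paths s. if fst x = pend a \<and> m = path_append a (loop x) then wgt x else 0)"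
proof -
  let ?n = "length u"
  have eq: "m = path_append a (loop x) \<longleftrightarrow> a = ptake ?n m \<and> pdrop ?n m = loop x"
    if "x \<in> paths s" "fst x = pend a" for x
    using path_append_eq[OF a, of "loop x" m] loop_path(2)[OF that(1)] that(2) by auto
  have a': "ptake ?n a = a" "pdrop ?n a = (pend a, [])"
    using paths_length[OF a] by (simp_all add: ptake_def pdrop_def)
  have "Tns Q (Ide Q u) (coevs Q s) (a, m) =
      (if a = ptake ?n m then 1 else 0) * coevs Q s ((pend a, []), pdrop ?n m)"
    using a by (simp add: Tns_coeff[OF Ide_hom coevs_hom] a')
  also have "\<dots> = (\<Sum>x\<in>paths s. if fst x = pend a \<and> m = path_append a (loop x) then wgt x else 0)"
    unfolding coevs_cup sum_distrib_left
    by (intro sum.cong refl) (auto simp: eq cong: conj_cong)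
  finally show ?thesis .
qed

lemma sum_loops:
  assumes "\<And>x. x \<in> paths s \<Longrightarrow> P x \<Longrightarrow> \<phi> x \<in> M" "finite M"
  shows "(\<Sum>m\<in>M. (\<Sum>x\<in>paths s. if P x \<and> m = \<phi> x then wgt x else 0) * F m) =
    (\<Sum>x\<in>paths s. if P x then wgt x * F (\<phi> x) else 0)"
proof -
  have "(\<Sum>m\<in>M. (\<Sum>x\<in>paths s. if P x \<and> m = \<phi> x then wgt x else 0) * F m) =
    (\<Sum>x\<in>paths s. \<Sum>m\<in>M. if m = \<phi> x then if P x then wgt x * F (\<phi> x) else 0 else 0)"
    unfolding sum_distrib_right by (subst sum.swap) (intro sum.cong refl, auto)
  also have "\<dots> = (\<Sum>x\<in>paths s. if P x then wgt x * F (\<phi> x) else 0)"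
    using assms by (auto intro!: sum.cong)
  finally show ?thesis .
qed

lemma left_cup_sum:
  assumes b: "b \<in> paths w"
  shows "(\<Sum>m\<in>paths ((s @ dobj s) @ w). Tns Q (coevs Q s) (Ide Q w) (b, m) * F m) =
    (\<Sum>x\<in>paths s. if fst x = fst b then wgt x * F (path_append (loop x) b) else 0)"
  unfolding Tns_coevs_Ide[OF b]
  by (rule sum_loops) (auto intro!: path_append_in_paths[OF loop_path(1) b] simp: loop_path simp del: append_assoc)

lemma right_cup_sum:
  assumes a: "a \<in> paths u"
  shows "(\<Sum>m\<in>paths (u @ (s @ dobj s)). Tns Q (Ide Q u) (coevs Q s) (a, m) * F m) =
    (\<Sum>x\<in>paths s. if fst x = pend a then wgt x * F (path_append a (loop x)) else 0)"
  unfolding Tns_Ide_coevs[OF a]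
  by (rule sum_loops) (auto intro!: path_append_in_paths[OF a loop_path(1)] simp: loop_path simp del: append_assoc)

lemma evs_coevs: "evs Q s (m, p) = coevs Q s (p, m)"
  by (simp add: evs_cap coevs_cup)

lemma Ide_sym: "Ide Q s (m, p) = Ide Q s (p, m)"
  by auto

lemma Tns_evs_Ide: "Tns Q (evs Q s) (Ide Q w) (m, p) = Tns Q (coevs Q s) (Ide Q w) (p, m)"
  unfolding Tns_coeff[OF evs_hom Ide_hom] Tns_coeff[OF coevs_hom Ide_hom]
  by (subst Ide_sym) (simp only: evs_coevs list.size)

lemma Tns_Ide_evs: "Tns Q (Ide Q w) (evs Q s) (m, p) = Tns Q (Ide Q w) (coevs Q s) (p, m)"
  unfolding Tns_coeff[OF Ide_hom evs_hom] Tns_coeff[OF Ide_hom coevs_hom]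
  by (subst Ide_sym) (simp only: evs_coevs)

lemma prev_eq_iff:
  assumes "x \<in> paths s" "b \<in> paths (dobj s)"
  shows "prev x = b \<longleftrightarrow> x = prev b"
  using assms prev_prev[OF assms(1)] prev_prev[OF assms(2)] by auto

lemma wgt_prev_prev:
  assumes "a \<in> paths s" "b \<in> paths t" "fst a = fst b" "pend a = pend b"
  shows "wgt a * wgt (prev b) = 1"
proof -
  have "wgt a = wgt b" using assms by (simp add: wgt_def)
  then show ?thesis using wgt_prev[OF assms(2)] by simp
qed

text \<open>The cup forces the path next to it to be the reversal of \<open>b\<close>, the cap forces the other one to be the reversal of \<open>a\<close>, and the two weights are mutually inverse.\<close>

lemma dual_coeff:
  assumes f: "f \<in> Hom Q s t" and a: "a \<in> paths (dobj t)" and b: "b \<in> paths (dobj s)"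
  shows "dual Q s t f (a, b) = f (prev b, prev a)"
proof -
  let ?X = "Tns Q (Ide Q (dobj t)) (coevs Q s)"
  let ?Y = "Tns Q (Tns Q (Ide Q (dobj t)) f) (Ide Q (dobj s))"
  let ?Z = "Tns Q (evs Q (dobj t)) (Ide Q (dobj s))"
  let ?c = "if fst a = fst b \<and> pend b = pend a then wgt a * wgt (prev b) * f (prev b, prev a) else 0"
  have X: "?X \<in> Hom Q (dobj t) (dobj t @ s @ dobj s)"
    using Tns_hom[OF Ide_hom coevs_hom, of "dobj t" s] by simp
  have Y1: "Tns Q (Ide Q (dobj t)) f \<in> Hom Q (dobj t @ s) (dobj t @ t)"
    by (rule Tns_hom[OF Ide_hom f])
  have Y: "?Y \<in> Hom Q (dobj t @ s @ dobj s) ((dobj t @ t) @ dobj s)"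
    using Tns_hom[OF Y1 Ide_hom, of "dobj s"] by simp
  have Z: "?Z \<in> Hom Q ((dobj t @ t) @ dobj s) (dobj s)"
    using Tns_hom[OF evs_hom Ide_hom, of "dobj t" "dobj s"] by simp
  have Yval: "?Y (path_append a (loop x), path_append (loop y) b) =
      (if a = y then 1 else 0) * f (x, prev y) * (if prev x = b then 1 else 0)"
    if x: "x \<in> paths s" "fst x = pend a" and y: "y \<in> paths (dobj t)" "fst y = fst b" for x y
  proof -
    have ax: "path_append a x \<in> paths (dobj t @ s)" "pend (path_append a x) = fst (prev x)"
      using path_append_in_paths[OF a x(1)] x(2) by simp_all
    have yy: "path_append y (prev y) \<in> paths (dobj t @ t)" "pend (path_append y (prev y)) = fst b"
      using path_append_in_paths[OF y(1), of "prev y" t] prev_path[OF y(1)] y(2) by simp_all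
    have "?Y (path_append (path_append a x) (prev x), path_append (path_append y (prev y)) b) =
        Tns Q (Ide Q (dobj t)) f (path_append a x, path_append y (prev y)) * Ide Q (dobj s) (prev x, b)"
      by (rule Tns_append_append[OF Y1 Ide_hom ax yy])
    also have "Tns Q (Ide Q (dobj t)) f (path_append a x, path_append y (prev y)) =
        Ide Q (dobj t) (a, y) * f (x, prev y)"
      using x(2) by (intro Tns_append_append[OF Ide_hom f a _ y(1)]) simp_all
    finally show ?thesis
      using prev_path[OF x(1)] a by (simp add: loop_def path_append_assoc)
  qed
  have "dual Q s t f (a, b) =
      (\<Sum>n\<in>paths ((dobj t @ dobj (dobj t)) @ dobj s).
        Tns Q (coevs Q (dobj t)) (Ide Q (dobj s)) (b, n) *
        (\<Sum>m\<in>paths (dobj t @ s @ dobj s). ?X (a, m) * ?Y (m, n)))"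
    unfolding dual_def Cmp_coeff[OF Cmp_hom[OF X Y] Z] Cmp_coeff[OF X Y] Tns_evs_Ide
    by (simp add: mult.commute)
  also have "\<dots> = (\<Sum>y\<in>paths (dobj t). \<Sum>x\<in>paths s. if y = a \<and> x = prev b then ?c else 0)"
  proof -
    have "wgt y * (if fst x = pend a then wgt x * ?Y (path_append a (loop x), path_append (loop y) b) else 0) =
        (if y = a \<and> x = prev b then ?c else 0)"
      if "x \<in> paths s" "y \<in> paths (dobj t)" "fst y = fst b" for x y
      using that Yval[of x y] prev_eq_iff[OF that(1) b]
      by (cases "y = a"; cases "x = prev b") auto
    then show ?thesis
      unfolding right_cup_sum[OF a] left_cup_sum[OF b]
      by (intro sum.cong refl)
        (auto simp: sum_distrib_left if_distrib intro!: sum.cong sum.neutral)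
  qed
  also have "\<dots> = ?c"
    using a prev_path[OF b] by (simp add: sum_delta2)
  also have "\<dots> = f (prev b, prev a)"
    using HomD(3,4)[OF f, of "prev b" "prev a"] wgt_prev_prev[OF a b] prev_path[OF a] prev_path[OF b]
    by (cases "f (prev b, prev a) = 0") auto
  finally show ?thesis .
qed

lemma dual'_coeff:
  assumes f: "f \<in> Hom Q s t" and a: "a \<in> paths (dobj t)" and b: "b \<in> paths (dobj s)"
  shows "dual' Q s t f (a, b) = f (prev b, prev a)"
proof -
  let ?X = "Tns Q (coevs Q (dobj s)) (Ide Q (dobj t))"
  let ?Y = "Tns Q (Tns Q (Ide Q (dobj s)) f) (Ide Q (dobj t))"
  let ?Z = "Tns Q (Ide Q (dobj s)) (evs Q t)"
  let ?c = "if fst b = fst a \<and> pend a = pend b then wgt b * wgt (prev a) * f (prev b, prev a) else 0"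
  have X: "?X \<in> Hom Q (dobj t) ((dobj s @ s) @ dobj t)"
    using Tns_hom[OF coevs_hom Ide_hom, of "dobj s" "dobj t"] by simp
  have Y1: "Tns Q (Ide Q (dobj s)) f \<in> Hom Q (dobj s @ s) (dobj s @ t)"
    by (rule Tns_hom[OF Ide_hom f])
  have Y: "?Y \<in> Hom Q ((dobj s @ s) @ dobj t) (dobj s @ (t @ dobj t))"
    using Tns_hom[OF Y1 Ide_hom, of "dobj t"] by simp
  have Z: "?Z \<in> Hom Q (dobj s @ (t @ dobj t)) (dobj s)"
    using Tns_hom[OF Ide_hom evs_hom, of "dobj s" t] by simp
  have Yval: "?Y (path_append (loop y) a, path_append b (loop x)) =
      (if y = b then 1 else 0) * f (prev y, x) * (if a = prev x then 1 else 0)"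
    if x: "x \<in> paths t" "fst x = pend b" and y: "y \<in> paths (dobj s)" "fst y = fst a" for x y
  proof -
    have bx: "path_append b x \<in> paths (dobj s @ t)" "pend (path_append b x) = fst (prev x)"
      using path_append_in_paths[OF b x(1)] x(2) by simp_all
    have yy: "path_append y (prev y) \<in> paths (dobj s @ s)" "pend (path_append y (prev y)) = fst a"
      using path_append_in_paths[OF y(1), of "prev y" s] prev_path[OF y(1)] y(2) by simp_all
    have "?Y (path_append (path_append y (prev y)) a, path_append (path_append b x) (prev x)) =
        Tns Q (Ide Q (dobj s)) f (path_append y (prev y), path_append b x) * Ide Q (dobj t) (a, prev x)"
      by (rule Tns_append_append[OF Y1 Ide_hom yy bx])
    also have "Tns Q (Ide Q (dobj s)) f (path_append y (prev y), path_append b x) =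
        Ide Q (dobj s) (y, b) * f (prev y, x)"
      using x(2) by (intro Tns_append_append[OF Ide_hom f y(1) _ b]) simp_all
    finally show ?thesis
      using y a by (simp add: loop_def path_append_assoc)
  qed
  have "dual' Q s t f (a, b) =
      (\<Sum>n\<in>paths (dobj s @ (t @ dobj t)).
        Tns Q (Ide Q (dobj s)) (coevs Q t) (b, n) *
        (\<Sum>m\<in>paths ((dobj s @ dobj (dobj s)) @ dobj t). ?X (a, m) * ?Y (m, n)))"
    unfolding dual'_def Cmp_coeff[OF Cmp_hom[OF X Y] Z] Cmp_coeff[OF X Y] Tns_Ide_evs
    by (simp add: mult.commute)
  also have "\<dots> = (\<Sum>x\<in>paths t. \<Sum>y\<in>paths (dobj s). if x = prev a \<and> y = b then ?c else 0)"
  proof -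
    have pointwise: "wgt x * (if fst y = fst a then wgt y * ?Y (path_append (loop y) a, path_append b (loop x)) else 0) =
        (if x = prev a \<and> y = b then ?c else 0)"
      if "x \<in> paths t" "y \<in> paths (dobj s)" "fst x = pend b" for x y
      using that Yval[of x y] prev_eq_iff[OF that(1) a]
      by (cases "y = b"; cases "x = prev a") (auto simp: eq_commute[of a])
    show ?thesis
      unfolding right_cup_sum[OF b] left_cup_sum[OF a]
    proof (intro sum.cong refl)
      fix x assume x: "x \<in> paths t"
      show "(if fst x = pend b then wgt x * (\<Sum>y\<in>paths (dobj s). if fst y = fst a then
            wgt y * ?Y (path_append (loop y) a, path_append b (loop x)) else 0) else 0) =
          (\<Sum>y\<in>paths (dobj s). if x = prev a \<and> y = b then ?c else 0)"
      proof (cases "fst x = pend b")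
        case True
        have "wgt x * (\<Sum>y\<in>paths (dobj s). if fst y = fst a then
            wgt y * ?Y (path_append (loop y) a, path_append b (loop x)) else 0) =
          (\<Sum>y\<in>paths (dobj s). if x = prev a \<and> y = b then ?c else 0)"
          unfolding sum_distrib_left by (intro sum.cong refl pointwise x True)
        with True show ?thesis by simp
      next
        case False
        then have "x = prev a \<Longrightarrow> ?c = 0" by auto
        with False show ?thesis by (auto intro!: sum.neutral)
      qed
    qed
  qed
  also have "\<dots> = ?c"
    using b prev_path[OF a] by (simp add: sum_delta2)
  also have "\<dots> = f (prev b, prev a)"
    using HomD(3,4)[OF f, of "prev b" "prev a"] wgt_prev_prev[OF b a] prev_path[OF a] prev_path[OF b]
    by (cases "f (prev b, prev a) = 0") auto
  finally show ?thesis .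
qed


lemma dual_homs:
  assumes f: "f \<in> Hom Q s t"
  shows "dual Q s t f \<in> Hom Q (dobj t) (dobj s)" "dual' Q s t f \<in> Hom Q (dobj t) (dobj s)"
proof -
  have "Tns Q (Ide Q (dobj t)) (coevs Q s) \<in> Hom Q (dobj t) (dobj t @ s @ dobj s)"
    using Tns_hom[OF Ide_hom coevs_hom, of "dobj t" s] by simp
  moreover have "Tns Q (Tns Q (Ide Q (dobj t)) f) (Ide Q (dobj s)) \<in>
      Hom Q (dobj t @ s @ dobj s) ((dobj t @ t) @ dobj s)"
    using Tns_hom[OF Tns_hom[OF Ide_hom f] Ide_hom, of "dobj t" "dobj s"] by simp
  moreover have "Tns Q (evs Q (dobj t)) (Ide Q (dobj s)) \<in> Hom Q ((dobj t @ t) @ dobj s) (dobj s)"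
    using Tns_hom[OF evs_hom Ide_hom, of "dobj t" "dobj s"] by simp
  ultimately show "dual Q s t f \<in> Hom Q (dobj t) (dobj s)"
    unfolding dual_def by (metis Cmp_hom)
  have "Tns Q (coevs Q (dobj s)) (Ide Q (dobj t)) \<in> Hom Q (dobj t) ((dobj s @ s) @ dobj t)"
    using Tns_hom[OF coevs_hom Ide_hom, of "dobj s" "dobj t"] by simp
  moreover have "Tns Q (Tns Q (Ide Q (dobj s)) f) (Ide Q (dobj t)) \<in>
      Hom Q ((dobj s @ s) @ dobj t) (dobj s @ (t @ dobj t))"
    using Tns_hom[OF Tns_hom[OF Ide_hom f] Ide_hom, of "dobj s" "dobj t"] by simp
  moreover have "Tns Q (Ide Q (dobj s)) (evs Q t) \<in> Hom Q (dobj s @ (t @ dobj t)) (dobj s)"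
    using Tns_hom[OF Ide_hom evs_hom, of "dobj s" t] by simp
  ultimately show "dual' Q s t f \<in> Hom Q (dobj t) (dobj s)"
    unfolding dual'_def by (metis Cmp_hom)
qed

lemma dual_eq_dual':
  assumes f: "f \<in> Hom Q s t"
  shows "dual Q s t f = dual' Q s t f"
proof (rule gpa_eqI)
  fix a b
  show "dual Q s t f (a, b) = dual' Q s t f (a, b)"
  proof (cases "a \<in> paths (dobj t) \<and> b \<in> paths (dobj s)")
    case True
    then show ?thesis by (simp add: dual_coeff[OF f] dual'_coeff[OF f])
  next
    case False
    then show ?thesis
      using HomD(1,2)[OF dual_homs(1)[OF f], of a b] HomD(1,2)[OF dual_homs(2)[OF f], of a b]
      by metis
  qed
qed

text \<open>Reversal is injective, so the rotated identity is the identity. For a single strand this is the zigzag equation.\<close>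

lemma dual_Ide: "dual Q s s (Ide Q s) = Ide Q (dobj s)" "dual' Q s s (Ide Q s) = Ide Q (dobj s)"
proof -
  show "dual Q s s (Ide Q s) = Ide Q (dobj s)"
  proof (rule gpa_eqI)
    fix a b
    show "dual Q s s (Ide Q s) (a, b) = Ide Q (dobj s) (a, b)"
    proof (cases "a \<in> paths (dobj s) \<and> b \<in> paths (dobj s)")
      case True
      moreover have "prev b = prev a \<longleftrightarrow> a = b"
        using True prev_prev by metis
      ultimately show ?thesis
        using prev_path[of b "dobj s"] by (simp add: dual_coeff[OF Ide_hom])
    next
      case False
      then show ?thesis
        using HomD(1,2)[OF dual_homs(1)[OF Ide_hom], of s a b] by (metis Ide_coeff)
    qed
  qed
  then show "dual' Q s s (Ide Q s) = Ide Q (dobj s)"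
    by (simp add: dual_eq_dual'[OF Ide_hom])
qed

lemma evs_single: "evs Q [a] = Ev Q a" and coevs_single: "coevs Q [a] = Coev Q a"
  using Cmp_Ide_right[OF Ev_hom[of a]] Cmp_Ide_left[OF Coev_hom[of a]]
  by (simp_all add: Tns_Ide)

lemma dobj_single: "dobj [a] = [opp a]"
  by simp

lemma zigzag_left:
  "Cmp Q (Tns Q (Ev Q a) (Ide Q [a])) (Tns Q (Ide Q [a]) (Coev Q (opp a))) = Ide Q [a]"
proof -
  have "Tns Q (Ide Q [a]) (Coev Q (opp a)) \<in> Hom Q [a] [a, opp a, a]"
    using Tns_hom[OF Ide_hom[of "[a]"] Coev_hom[of "opp a"]] by simp
  from Cmp_Ide_left[OF this] show ?thesis
    using dual_Ide(1)[of "[opp a]"]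
    by (simp add: dual_def dobj_single Tns_Ide evs_single coevs_single del: evs.simps coevs.simps dobj_simps)
qed

lemma zigzag_right:
  "Cmp Q (Tns Q (Ide Q [a]) (Ev Q (opp a))) (Tns Q (Coev Q a) (Ide Q [a])) = Ide Q [a]"
proof -
  have "Tns Q (Coev Q a) (Ide Q [a]) \<in> Hom Q [a] [a, opp a, a]"
    using Tns_hom[OF Coev_hom[of a] Ide_hom[of "[a]"]] by simp
  from Cmp_Ide_left[OF this] show ?thesis
    using dual_Ide(2)[of "[opp a]"]
    by (simp add: dual'_def dobj_single Tns_Ide evs_single coevs_single del: evs.simps coevs.simps dobj_simps)
qed

theorem planar_algebra_oGPA: "planar_algebra Q"
proof
  fix f g
  assume "planar_law Q f g"
  then show "f = g"
  proof cases
    case (cmp_add_left f s t g u g')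
    then show ?thesis
      by (intro gpa_eqI) (simp add: Cmp_coeff[of _ s t _ u] Add_hom sum.distrib ring_distribs)
  next
    case (cmp_add_right f s t f' g u)
    then show ?thesis
      by (intro gpa_eqI) (simp add: Cmp_coeff[of _ s t _ u] Add_hom sum.distrib ring_distribs)
  next
    case (cmp_scl_left f s t g u c)
    then show ?thesis
      by (intro gpa_eqI) (simp add: Cmp_coeff[of _ s t _ u] Scl_hom sum_distrib_left mult_ac)
  next
    case (cmp_scl_right f s t g u c)
    then show ?thesis
      by (intro gpa_eqI) (simp add: Cmp_coeff[of _ s t _ u] Scl_hom sum_distrib_left mult_ac)
  next
    case (tns_add_left f s t g h s' t')
    then show ?thesis
      by (intro gpa_eqI) (simp add: Tns_coeff[of _ s t _ s' t'] Add_hom ring_distribs)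
  next
    case (tns_add_right f s t g s' t' h)
    then show ?thesis
      by (intro gpa_eqI) (simp add: Tns_coeff[of _ s t _ s' t'] Add_hom ring_distribs)
  next
    case (tns_scl_left f s t g s' t' c)
    then show ?thesis
      by (intro gpa_eqI) (simp add: Tns_coeff[of _ s t _ s' t'] Scl_hom)
  next
    case (tns_scl_right f s t g s' t' c)
    then show ?thesis
      by (intro gpa_eqI) (simp add: Tns_coeff[of _ s t _ s' t'] Scl_hom)
  qed (auto intro: Cmp_assoc Cmp_Ide_left Cmp_Ide_right Tns_assoc Tns_unit_left Tns_unit_right
      Tns_Ide interchange_law zigzag_left zigzag_right dual_eq_dual',
      auto intro!: gpa_eqI simp: algebra_simps)
qed (fact homs)+

subsection \<open>Positivity\<close>

text \<open>A closed diagram in the region \<open>v\<close> is a sum over the paths starting there.\<close>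

lemma tr_coeff:
  assumes h: "h \<in> Hom Q s s" and v: "v \<in> verts G"
  shows "tr Q s h ((v, []), (v, [])) =
    (\<Sum>x\<in>paths s. if fst x = v then of_real (lam (pend x) / lam v) * h (x, x) else 0)"
proof -
  have Y: "Tns Q h (Ide Q (dobj s)) \<in> Hom Q (s @ dobj s) (s @ dobj s)"
    by (rule Tns_hom[OF h Ide_hom])
  have Yval: "Tns Q h (Ide Q (dobj s)) (loop x, loop y) = (if x = y then h (x, x) else 0)"
    if "x \<in> paths s" "y \<in> paths s" for x y
  proof -
    have "prev x = prev y \<longleftrightarrow> x = y"
      using prev_prev that by metis
    moreover have "Tns Q h (Ide Q (dobj s)) (loop x, loop y) = h (x, y) * Ide Q (dobj s) (prev x, prev y)"
      unfolding loop_def using that by (intro Tns_append_append[OF h Ide_hom]) auto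
    ultimately show ?thesis
      using prev_path[OF that(1)] by simp
  qed
  let ?p = "(v, [])"
  have coevs: "coevs Q s (?p, m) = (\<Sum>x\<in>paths s. if fst x = v \<and> m = loop x then wgt x else 0)" for m
    unfolding coevs_cup by (intro sum.cong refl) auto
  have "tr Q s h (?p, ?p) = (\<Sum>n\<in>paths (s @ dobj s). coevs Q s (?p, n) *
      (\<Sum>m\<in>paths (s @ dobj s). coevs Q s (?p, m) * Tns Q h (Ide Q (dobj s)) (m, n)))"
    unfolding tr_def Cmp_coeff[OF Cmp_hom[OF coevs_hom Y] evs_hom] Cmp_coeff[OF coevs_hom Y] evs_coevs
    by (simp add: mult.commute)
  also have "\<dots> = (\<Sum>y\<in>paths s. if fst y = v then wgt y *
      (\<Sum>x\<in>paths s. if fst x = v then wgt x * Tns Q h (Ide Q (dobj s)) (loop x, loop y) else 0) else 0)"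
    unfolding coevs using loop_path(1) by (subst (1 2) sum_loops) auto
  also have "\<dots> = (\<Sum>y\<in>paths s. if fst y = v then wgt y *
      (\<Sum>x\<in>paths s. if x = y then wgt y * h (y, y) else 0) else 0)"
  proof (intro sum.cong refl)
    fix y assume y: "y \<in> paths s"
    have "(\<Sum>x\<in>paths s. if fst x = v then wgt x * Tns Q h (Ide Q (dobj s)) (loop x, loop y) else 0) =
        (\<Sum>x\<in>paths s. if x = y then wgt y * h (y, y) else 0)" if "fst y = v"
      using that by (intro sum.cong refl) (simp add: Yval y)
    then show "(if fst y = v then wgt y * (\<Sum>x\<in>paths s. if fst x = v
        then wgt x * Tns Q h (Ide Q (dobj s)) (loop x, loop y) else 0) else 0) =
        (if fst y = v then wgt y * (\<Sum>x\<in>paths s. if x = y then wgt y * h (y, y) else 0) else 0)"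
      by simp
  qed
  also have "\<dots> = (\<Sum>x\<in>paths s. if fst x = v then of_real (lam (pend x) / lam v) * h (x, x) else 0)"
  proof (intro sum.cong refl)
    fix x assume x: "x \<in> paths s"
    have "0 < lam (pend x)" "0 < lam (fst x)"
      using lam_pos paths_verts[OF x] by simp_all
    then have "wgt x * wgt x = of_real (lam (pend x) / lam (fst x))"
      unfolding wgt_def by (simp add: of_real_mult[symmetric] del: of_real_mult of_real_divide)
    then show "(if fst x = v then wgt x * (\<Sum>z\<in>paths s. if z = x then wgt x * h (x, x) else 0) else 0) =
        (if fst x = v then of_real (lam (pend x) / lam v) * h (x, x) else 0)"
      using x by (auto simp: mult.assoc[symmetric])
  qed
  finally show ?thesis .
qed

text \<open>All terms of the trace of \<open>f\<^sup>\<dagger> f\<close> are nonnegative, so each of them vanishes.\<close>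

theorem trace_positive:
  assumes f: "f \<in> Hom Q s t" and tr: "tr Q s (Cmp Q (gpa_dag f) f) = Nul Q [] []"
  shows "f = Nul Q s t"
proof (rule gpa_eqI)
  fix p r
  have "f (p, r) = 0"
  proof (rule ccontr)
    assume nz: "f (p, r) \<noteq> 0"
    note pr = HomD[OF f nz]
    define v where "v = fst p"
    have v: "v \<in> verts G" using paths_verts[OF pr(1)] v_def by simp
    define w where "w x = lam (pend x) / lam v" for x
    have w: "w x > 0" if "x \<in> paths s" for x
      using lam_pos v paths_verts[OF that] by (simp add: w_def)
    have C: "Cmp Q (gpa_dag f) f (x, x) = of_real (\<Sum>q\<in>paths t. (cmod (f (x, q)))\<^sup>2)" for x
      by (simp add: Cmp_coeff[OF f gpa_dag_hom[OF f]] complex_norm_square[symmetric])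
    have "0 = tr Q s (Cmp Q (gpa_dag f) f) ((v, []), (v, []))"
      unfolding tr by simp
    also have "\<dots> = (\<Sum>x\<in>paths s. if fst x = v then of_real (w x) *
        of_real (\<Sum>q\<in>paths t. (cmod (f (x, q)))\<^sup>2) else 0 :: complex)"
      unfolding tr_coeff[OF Cmp_hom[OF f gpa_dag_hom[OF f]] v] C w_def ..
    also have "\<dots> = of_real (\<Sum>x\<in>paths s. if fst x = v then w x *
        (\<Sum>q\<in>paths t. (cmod (f (x, q)))\<^sup>2) else 0)"
      unfolding of_real_sum by (intro sum.cong refl) simp
    finally have "(\<Sum>x\<in>paths s. if fst x = v then w x *
        (\<Sum>q\<in>paths t. (cmod (f (x, q)))\<^sup>2) else 0) = 0"
      unfolding of_real_eq_0_iff[symmetric, where 'a = complex] by (rule sym)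
    then have "w p * (\<Sum>q\<in>paths t. (cmod (f (p, q)))\<^sup>2) = 0"
      by (subst (asm) sum_nonneg_eq_0_iff)
        (use pr(1) in \<open>auto simp: v_def intro!: mult_nonneg_nonneg sum_nonneg w[THEN less_imp_le]\<close>)
    then have "(\<Sum>q\<in>paths t. (cmod (f (p, q)))\<^sup>2) = 0"
      using w[OF pr(1)] by simp
    then show False
      using pr(2) nz by (subst (asm) sum_nonneg_eq_0_iff) auto
  qed
  then show "f (p, r) = Nul Q s t (p, r)" by simp
qed

end

section \<open>Kuperberg's relations as equations between cells\<close>

context gpa_graph begin

lemma gpa_ext:
  assumes "f \<in> Hom Q s t" "g \<in> Hom Q s t"
    and "\<And>p r. p \<in> paths s \<Longrightarrow> r \<in> paths t \<Longrightarrow> fst p = fst r \<Longrightarrow> pend p = pend r \<Longrightarrow> f (p, r) = g (p, r)"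
  shows "f = g"
proof (rule gpa_eqI)
  fix p r
  show "f (p, r) = g (p, r)"
  proof (cases "f (p, r) \<noteq> 0 \<or> g (p, r) \<noteq> 0")
    case True
    then show ?thesis
      using HomD[OF assms(1)] HomD[OF assms(2)] by (intro assms(3)) blast+
  qed simp
qed

definition edge_lists :: "nat \<Rightarrow> 'e list set" where
  "edge_lists n = {es. set es \<subseteq> arcs G \<and> length es = n}"

lemma finite_edge_lists [simp]: "finite (edge_lists n)"
  unfolding edge_lists_def by (rule finite_lists_length_eq) simp

lemma edge_lists_0: "edge_lists 0 = {[]}"
  by (auto simp: edge_lists_def)

lemma sum_edge_lists_Suc:
  "(\<Sum>es\<in>edge_lists (Suc n). F es) = (\<Sum>e\<in>arcs G. \<Sum>es\<in>edge_lists n. F (e # es) :: complex)"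
proof -
  have "(\<Sum>e\<in>arcs G. \<Sum>es\<in>edge_lists n. F (e # es)) =
      (\<Sum>(e, es)\<in>arcs G \<times> edge_lists n. F (e # es))"
    by (simp add: sum.cartesian_product)
  also have "\<dots> = (\<Sum>es\<in>edge_lists (Suc n). F es)"
    by (rule sum.reindex_bij_witness[where i = "\<lambda>es. (hd es, tl es)" and j = "\<lambda>(e, es). e # es"])
      (auto simp: edge_lists_def length_Suc_conv)
  finally show ?thesis ..
qed

text \<open>A summand that vanishes off the paths from \<open>v\<close> may be summed over all lists of edges, which turns sums over paths into iterated sums over edges.\<close>

lemma sum_paths:
  assumes h: "\<And>q. h q \<noteq> 0 \<Longrightarrow> q \<in> paths s \<and> fst q = v"
  shows "(\<Sum>q\<in>paths s. h q) = (\<Sum>es\<in>edge_lists (length s). h (v, zip s es) :: complex)"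
proof -
  have path: "q \<in> (\<lambda>es. (v, zip s es)) ` edge_lists (length s)"
    if "q \<in> paths s" "fst q = v" for q
  proof (rule image_eqI)
    have "is_path G (u, xs) \<Longrightarrow> snd ` set xs \<subseteq> arcs G" for u xs
      by (induction xs arbitrary: u) auto
    then show "map snd (snd q) \<in> edge_lists (length s)"
      using that by (cases q) (auto simp: edge_lists_def spaths_def)
    show "q = (v, zip s (map snd (snd q)))"
      using that by (cases q) (auto simp: spaths_def zip_map_fst_snd)
  qed
  have "inj_on (\<lambda>es. (v, zip s es)) (edge_lists (length s))"
    by (rule inj_on_inverseI[where g = "\<lambda>q. map snd (snd q)"]) (simp add: edge_lists_def)
  then have "(\<Sum>es\<in>edge_lists (length s). h (v, zip s es)) =
      (\<Sum>q\<in>(\<lambda>es. (v, zip s es)) ` edge_lists (length s). h q)"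
    by (simp add: sum.reindex)
  also have "\<dots> = (\<Sum>q\<in>paths s. h q)"
    using h path by (intro sum.mono_neutral_cong) auto
  finally show ?thesis ..
qed

lemmas edge_sum_simps = edge_lists_0 sum_edge_lists_Suc

lemma Cmp_edges:
  assumes f: "f \<in> Hom Q s t" and g: "g \<in> Hom Q t u"
  shows "Cmp Q g f (p, r) =
    (\<Sum>es\<in>edge_lists (length t). f (p, (fst p, zip t es)) * g ((fst p, zip t es), r))"
  unfolding Cmp_coeff[OF f g]
proof (rule sum_paths)
  fix q assume "f (p, q) * g (q, r) \<noteq> 0"
  then have "f (p, q) \<noteq> 0" by simp
  from HomD(2,3)[OF f this] show "q \<in> paths t \<and> fst q = fst p" by simp
qed

lemma gpa_dag_dual:
  assumes f: "f \<in> Hom Q s t"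
  shows "gpa_dag (dual Q s t f) = dual Q t s (gpa_dag f)"
  by (rule gpa_ext[of _ "dobj s" "dobj t"])
    (auto intro!: gpa_dag_hom dual_homs f simp: dual_coeff[OF f] dual_coeff[OF gpa_dag_hom[OF f]])

end

locale trivalent = gpa_graph G lam for G :: "('v, 'e) pre_digraph" (structure) and lam +
  fixes X :: "('v, 'e) gpa"
  assumes X: "X \<in> Hom (oGPA G lam) [Neg] [Pos, Pos]"
begin

text \<open>The coefficients in the sense of Ocneanu cells: one number for each triangle of edges.\<close>

definition cell :: "'e \<Rightarrow> 'e \<Rightarrow> 'e \<Rightarrow> complex" where
  "cell e1 e2 e3 = X ((tail G e1, [(Neg, e3)]), (tail G e1, [(Pos, e1), (Pos, e2)]))"

lemma cellD:
  assumes "cell e1 e2 e3 \<noteq> 0"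
  shows "e1 \<in> arcs G" "e2 \<in> arcs G" "e3 \<in> arcs G"
    "head G e1 = tail G e2" "head G e2 = tail G e3" "head G e3 = tail G e1"
  using HomD[OF X assms[unfolded cell_def]] by (auto simp: spaths_def)

lemma X_coeff:
  "X ((v, [(Neg, e3)]), (v', [(Pos, e1), (Pos, e2)])) =
    (if v = tail G e1 \<and> v' = tail G e1 then cell e1 e2 e3 else 0)"
  using HomD[OF X, of "(v, [(Neg, e3)])" "(v', [(Pos, e1), (Pos, e2)])"]
  by (cases "X ((v, [(Neg, e3)]), (v', [(Pos, e1), (Pos, e2)])) = 0")
    (auto simp: cell_def spaths_def)

abbreviation "Y \<equiv> gpa_dag X"

lemma Y: "Y \<in> Hom Q [Pos, Pos] [Neg]"
  by (rule gpa_dag_hom[OF X])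

abbreviation "Xd \<equiv> dual Q [Neg] [Pos, Pos] X"
abbreviation "Yd \<equiv> dual Q [Pos, Pos] [Neg] Y"

lemma Xd: "Xd \<in> Hom Q [Neg, Neg] [Pos]"
  using dual_homs(1)[OF X] by simp

lemma Yd: "Yd \<in> Hom Q [Pos] [Neg, Neg]"
  using dual_homs(1)[OF Y] by simp

lemma Xd_coeff:
  "Xd ((v, [(Neg, e2), (Neg, e1)]), (v', [(Pos, e3)])) =
    (if v = head G e2 \<and> v' = head G e2 then cell e1 e2 e3 else 0)"
proof -
  let ?a = "(v, [(Neg, e2), (Neg, e1)])" and ?b = "(v', [(Pos, e3)])"
  show ?thesis
  proof (cases "?a \<in> paths [Neg, Neg] \<and> ?b \<in> paths [Pos]")
    case True
    then have "Xd (?a, ?b) = X (prev ?b, prev ?a)"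
      by (intro dual_coeff[OF X]) auto
    also have "\<dots> = (if head G e3 = tail G e1 then cell e1 e2 e3 else 0)"
      using True by (auto simp: prev_def X_coeff spaths_def)
    finally show ?thesis
      using True cellD[of e1 e2 e3] by (cases "cell e1 e2 e3 = 0") (auto simp: spaths_def)
  next
    case False
    then have "Xd (?a, ?b) = 0"
      using HomD(1,2)[OF Xd] by blast
    moreover have "cell e1 e2 e3 = 0" if "v = head G e2" "v' = head G e2"
    proof (rule ccontr)
      assume "cell e1 e2 e3 \<noteq> 0"
      from cellD[OF this] False that show False by (auto simp: spaths_def)
    qed
    ultimately show ?thesis by auto
  qed
qed

lemma Yd_coeff:
  "Yd ((v', [(Pos, e3)]), (v, [(Neg, e2), (Neg, e1)])) =
    (if v = head G e2 \<and> v' = head G e2 then cnj (cell e1 e2 e3) else 0)"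
  unfolding gpa_dag_dual[OF X, symmetric] gpa_dag_coeff Xd_coeff by simp

subsection \<open>The bigon\<close>

lemma Y_coeff:
  "Y ((v', [(Pos, e1), (Pos, e2)]), (v, [(Neg, e3)])) =
    (if v = tail G e1 \<and> v' = tail G e1 then cnj (cell e1 e2 e3) else 0)"
  unfolding gpa_dag_coeff X_coeff by simp

lemma bigon_relation:
  assumes "\<And>e e'. e \<in> arcs G \<Longrightarrow> e' \<in> arcs G \<Longrightarrow> head G e = head G e' \<Longrightarrow> tail G e = tail G e' \<Longrightarrow>
    (\<Sum>e1\<in>arcs G. \<Sum>e2\<in>arcs G. cell e1 e2 e * cnj (cell e1 e2 e')) = (if e = e' then c else 0)"
  shows "Cmp Q Y X = Scl Q c (Ide Q [Neg])"
proof (rule gpa_ext[OF Cmp_hom[OF X Y] Scl_hom[OF Ide_hom]])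
  fix p r
  assume pr: "p \<in> paths [Neg]" "r \<in> paths [Neg]" "fst p = fst r" "pend p = pend r"
  then obtain e e' where e: "p = (head G e, [(Neg, e)])" "r = (head G e', [(Neg, e')])"
    "e \<in> arcs G" "e' \<in> arcs G" "head G e = head G e'" "tail G e = tail G e'"
    by (cases p; cases r) (auto simp: spaths_def Cons_eq_map_conv)
  have "Cmp Q Y X (p, r) = (\<Sum>e1\<in>arcs G. \<Sum>e2\<in>arcs G. cell e1 e2 e * cnj (cell e1 e2 e'))"
    unfolding Cmp_edges[OF X Y] e(1,2) using e(5)
    by (auto simp: edge_sum_simps X_coeff Y_coeff dest: cellD intro!: sum.cong)
  then show "Cmp Q Y X (p, r) = Scl Q c (Ide Q [Neg]) (p, r)"
    using assms[OF e(3-6)] pr e by auto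
qed

subsection \<open>The square\<close>

abbreviation "M \<equiv> Cmp Q (Tns Q (Ide Q [Neg]) Xd) (Tns Q Yd (Ide Q [Neg]))"

lemma D_hom: "Tns Q Yd (Ide Q [Neg]) \<in> Hom Q [Pos, Neg] [Neg, Neg, Neg]"
  using Tns_hom[OF Yd Ide_hom, of "[Neg]"] by simp

lemma C_hom: "Tns Q (Ide Q [Neg]) Xd \<in> Hom Q [Neg, Neg, Neg] [Neg, Pos]"
  using Tns_hom[OF Ide_hom Xd, of "[Neg]"] by simp

lemma M_hom: "M \<in> Hom Q [Pos, Neg] [Neg, Pos]"
  by (rule Cmp_hom[OF D_hom C_hom])

text \<open>The square is cut along its diagonal: its two halves are adjoint to each other, so only one of them has to be computed.\<close>

lemma square_eq: "Cmp Q (Cmp Q (Cmp Q (Tns Q Xd (Ide Q [Neg])) (Tns Q (Ide Q [Neg]) Yd))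
    (Tns Q (Ide Q [Neg]) Xd)) (Tns Q Yd (Ide Q [Neg])) = Cmp Q (gpa_dag M) M"
proof -
  have "gpa_dag Xd = Yd" by (rule gpa_dag_dual[OF X])
  moreover have "gpa_dag Yd = Xd"
    unfolding gpa_dag_dual[OF X, symmetric] by (rule gpa_eqI) simp
  ultimately have "gpa_dag M = Cmp Q (Tns Q Xd (Ide Q [Neg])) (Tns Q (Ide Q [Neg]) Yd)"
    by (simp add: gpa_dag_Cmp[OF D_hom C_hom] gpa_dag_Tns[OF Yd Ide_hom] gpa_dag_Tns[OF Ide_hom Xd]
        gpa_dag_Ide)
  then show ?thesis
    using Cmp_assoc[OF D_hom C_hom gpa_dag_hom[OF M_hom]] by simp
qed

text \<open>Here \<open>g\<close> is the internal edge between the two vertices of this half, while \<open>h\<close> and \<open>h'\<close> are cut.\<close>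

definition square_half :: "'e \<Rightarrow> 'e \<Rightarrow> 'e \<Rightarrow> 'e \<Rightarrow> complex" where
  "square_half e1 e2 h h' = (\<Sum>g\<in>arcs G. cnj (cell g h e1) * cell e2 g h')"

lemma ptake_simps [simp]: "ptake (Suc n) (v, x # xs) = (v, x # take n xs)" "ptake 0 p = (fst p, [])"
  by (simp_all add: ptake_def)

lemma pdrop_Suc [simp]: "pdrop (Suc n) (v, x # xs) = pdrop n (step_tgt G x, xs)"
  by (simp add: pdrop_def ptake_def)

lemma M_coeff:
  assumes e: "e1 \<in> arcs G" "e2 \<in> arcs G" "head G e1 = head G e2" "h \<in> arcs G" "h' \<in> arcs G"
  shows "M ((tail G e1, [(Pos, e1), (Neg, e2)]), (tail G e1, [(Neg, h), (Pos, h')])) =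
    square_half e1 e2 h h'"
proof -
  let ?v = "tail G e1"
  have D: "Tns Q Yd (Ide Q [Neg]) ((?v, [(Pos, e1), (Neg, e2)]), (?v, [(Neg, a), (Neg, g), (Neg, b)])) =
      (if b = e2 then cnj (cell g a e1) else 0)" if "b \<in> arcs G" for a g b
    using e that cellD[of g a e1]
    by (cases "cell g a e1 = 0") (auto simp: Tns_coeff[OF Yd Ide_hom] Yd_coeff spaths_def)
  have C: "Tns Q (Ide Q [Neg]) Xd ((?v, [(Neg, a), (Neg, g), (Neg, e2)]), (?v, [(Neg, h), (Pos, h')])) =
      (if a = h then cell e2 g h' else 0)" if "cell g a e1 \<noteq> 0" for a g
    using e that cellD[OF that] cellD[of e2 g h']
    by (cases "cell e2 g h' = 0") (auto simp: Tns_coeff[OF Ide_hom Xd] Xd_coeff spaths_def)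
  have "Tns Q Yd (Ide Q [Neg]) ((?v, [(Pos, e1), (Neg, e2)]), (?v, [(Neg, a), (Neg, g), (Neg, b)])) *
      Tns Q (Ide Q [Neg]) Xd ((?v, [(Neg, a), (Neg, g), (Neg, b)]), (?v, [(Neg, h), (Pos, h')])) =
      (if b = e2 then if a = h then cnj (cell g h e1) * cell e2 g h' else 0 else 0)"
    if "b \<in> arcs G" for a g b
    using D[OF that, of a g] C[of g a] by (cases "cell g a e1 = 0") auto
  then have "M ((?v, [(Pos, e1), (Neg, e2)]), (?v, [(Neg, h), (Pos, h')])) =
    (\<Sum>a\<in>arcs G. \<Sum>g\<in>arcs G. \<Sum>b\<in>arcs G. if b = e2 then if a = h then cnj (cell g h e1) * cell e2 g h' else 0 else 0)"
    unfolding Cmp_edges[OF D_hom C_hom]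
    by (simp add: edge_sum_simps)
  also have "\<dots> = (\<Sum>a\<in>arcs G. if a = h then square_half e1 e2 h h' else 0)"
    using e by (intro sum.cong[OF refl]) (simp add: square_half_def)
  finally show ?thesis
    using e by simp
qed

lemma square_relation:
  assumes sq: "\<And>e1 e2 f1 f2. {e1, e2, f1, f2} \<subseteq> arcs G \<Longrightarrow> head G e1 = head G e2 \<Longrightarrow> head G f1 = head G f2 \<Longrightarrow>
      tail G e1 = tail G f1 \<Longrightarrow> tail G e2 = tail G f2 \<Longrightarrow>
    (\<Sum>h\<in>arcs G. \<Sum>h'\<in>arcs G. square_half e1 e2 h h' * cnj (square_half f1 f2 h h')) =
    (if e1 = f1 \<and> e2 = f2 then 1 else 0) +
    (if e1 = e2 \<and> f1 = f2 then of_real (sqrt (lam (head G e1) / lam (tail G e1)) *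
      sqrt (lam (head G f1) / lam (tail G e1))) else 0)"
  shows "Cmp Q (Cmp Q (Cmp Q (Tns Q Xd (Ide Q [Neg])) (Tns Q (Ide Q [Neg]) Yd))
    (Tns Q (Ide Q [Neg]) Xd)) (Tns Q Yd (Ide Q [Neg])) =
    Add Q (Ide Q [Pos, Neg]) (Cmp Q (Coev Q Pos) (Ev Q Pos))"
  unfolding square_eq
proof (rule gpa_ext)
  have Ev: "Ev Q Pos \<in> Hom Q [Pos, Neg] []" and Coev: "Coev Q Pos \<in> Hom Q [] [Pos, Neg]"
    using Ev_hom[of Pos] Coev_hom[of Pos] by simp_all
  show "Cmp Q (gpa_dag M) M \<in> Hom Q [Pos, Neg] [Pos, Neg]"
    by (rule Cmp_hom[OF M_hom gpa_dag_hom[OF M_hom]])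
  show "Add Q (Ide Q [Pos, Neg]) (Cmp Q (Coev Q Pos) (Ev Q Pos)) \<in> Hom Q [Pos, Neg] [Pos, Neg]"
    by (intro Add_hom Ide_hom Cmp_hom[OF Ev Coev])
  fix p r
  assume pr: "p \<in> paths [Pos, Neg]" "r \<in> paths [Pos, Neg]" "fst p = fst r" "pend p = pend r"
  then obtain e1 e2 f1 f2 where e: "p = (tail G e1, [(Pos, e1), (Neg, e2)])"
    "r = (tail G f1, [(Pos, f1), (Neg, f2)])" "{e1, e2, f1, f2} \<subseteq> arcs G" "head G e1 = head G e2"
    "head G f1 = head G f2" "tail G e1 = tail G f1" "tail G e2 = tail G f2"
    by (cases p; cases r) (auto simp: spaths_def Cons_eq_map_conv)
  have half: "Cmp Q (gpa_dag M) M (p, r) =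
      (\<Sum>h\<in>arcs G. \<Sum>h'\<in>arcs G. square_half e1 e2 h h' * cnj (square_half f1 f2 h h'))"
    unfolding Cmp_edges[OF M_hom gpa_dag_hom[OF M_hom]]
    using e M_coeff[of e1 e2] M_coeff[of f1 f2] by (simp add: edge_sum_simps)
  have Coev_val: "Coev Q Pos ((v, []), (tail G a, [(Pos, a), (Neg, b)])) =
      (if a = b \<and> v = tail G a then of_real (sqrt (lam (head G a) / lam (tail G a))) else 0)"
    if "a \<in> arcs G" for v a b
  proof -
    have "Coev Q Pos ((v, []), (tail G a, [(Pos, a), (Neg, b)])) =
      (\<Sum>e\<in>arcs G. if e = a then if a = b \<and> v = tail G a
        then of_real (sqrt (lam (head G a) / lam (tail G a))) else 0 else 0)"
      unfolding Coev_coeff by (intro sum.cong[OF refl]) (auto simp: gpa_coev_coeff_def)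
    then show ?thesis using that by simp
  qed
  have p_val: "Coev Q Pos ((tail G e1, []), p) =
      (if e1 = e2 then of_real (sqrt (lam (head G e1) / lam (tail G e1))) else 0)"
    using Coev_val[of e1 "tail G e1" e2] e by simp
  have r_val: "Coev Q Pos ((tail G e1, []), r) =
      (if f1 = f2 then of_real (sqrt (lam (head G f1) / lam (tail G e1))) else 0)"
    using Coev_val[of f1 "tail G e1" f2] e by simp
  have "Cmp Q (Coev Q Pos) (Ev Q Pos) (p, r) =
      Coev Q Pos ((tail G e1, []), p) * Coev Q Pos ((tail G e1, []), r)"
    unfolding Cmp_edges[OF Ev Coev] Ev_coeff using e(1) by (simp add: edge_sum_simps edge_lists_0)
  moreover have "p = r \<longleftrightarrow> e1 = f1 \<and> e2 = f2"
    using e(1,2,6) by auto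
  ultimately show "Cmp Q (gpa_dag M) M (p, r) =
      Add Q (Ide Q [Pos, Neg]) (Cmp Q (Coev Q Pos) (Ev Q Pos)) (p, r)"
    unfolding half sq[OF e(3-7)] Add_coeff Ide_coeff p_val r_val using pr(1) by simp
qed

subsection \<open>Rotation and loops\<close>

abbreviation "V \<equiv> Cmp Q (Tns Q X (Ide Q [Pos])) (Coev Q Neg)"

lemma V_hom: "V \<in> Hom Q [] [Pos, Pos, Pos]"
  using Cmp_hom[OF Coev_hom, of "Tns Q X (Ide Q [Pos])" Neg] Tns_hom[OF X Ide_hom, of "[Pos]"] by simp

lemma sum_paths_single: "(\<Sum>x\<in>paths [a]. F x) = (\<Sum>e\<in>arcs G. F (step_src G (a, e), [(a, e)]) :: complex)"
proof -
  have "paths [a] = (\<lambda>e. (step_src G (a, e), [(a, e)])) ` arcs G"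
    using step_ends by (fastforce simp: spaths_def image_iff)
  moreover have "inj_on (\<lambda>e. (step_src G (a, e), [(a, e)])) (arcs G)"
    by (auto intro: inj_onI)
  ultimately show ?thesis by (simp add: sum.reindex)
qed

lemma V_coeff:
  assumes "e1 \<in> arcs G" "e2 \<in> arcs G" "e3 \<in> arcs G" "tail G e1 = head G e3"
  shows "V ((head G e3, []), (tail G e1, [(Pos, e1), (Pos, e2), (Pos, e3)])) =
    of_real (sqrt (lam (tail G e3) / lam (head G e3))) * cell e1 e2 e3"
proof -
  have XI: "Tns Q X (Ide Q [Pos]) \<in> Hom Q [Neg, Pos] [Pos, Pos, Pos]"
    using Tns_hom[OF X Ide_hom, of "[Pos]"] by simp
  have C: "Coev Q Neg \<in> Hom Q [] [Neg, Pos]"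
    using Coev_hom[of Neg] by simp
  have Coev_val: "Coev Q Neg ((head G e3, []), (head G e3, [(Neg, a), (Pos, b)])) =
      (if a = b \<and> head G a = head G e3 then of_real (sqrt (lam (tail G a) / lam (head G a))) else 0)"
    if "a \<in> arcs G" for a b
  proof -
    have "Coev Q Neg ((head G e3, []), (head G e3, [(Neg, a), (Pos, b)])) =
      (\<Sum>e\<in>arcs G. if e = a then if a = b \<and> head G a = head G e3
        then of_real (sqrt (lam (tail G a) / lam (head G a))) else 0 else 0)"
      unfolding Coev_coeff by (intro sum.cong[OF refl]) (auto simp: gpa_coev_coeff_def)
    then show ?thesis using that by simp
  qed
  have XI_val: "Tns Q X (Ide Q [Pos]) ((head G e3, [(Neg, a), (Pos, a)]),
      (tail G e1, [(Pos, e1), (Pos, e2), (Pos, e3)])) = (if a = e3 then cell e1 e2 e3 else 0)"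
    if "a \<in> arcs G" for a
    using assms that cellD[of e1 e2 a]
    by (cases "cell e1 e2 a = 0") (auto simp: Tns_coeff[OF X Ide_hom] X_coeff spaths_def)
  have "Coev Q Neg ((head G e3, []), (head G e3, [(Neg, a), (Pos, b)])) *
      Tns Q X (Ide Q [Pos]) ((head G e3, [(Neg, a), (Pos, b)]), (tail G e1, [(Pos, e1), (Pos, e2), (Pos, e3)])) =
      (if a = e3 \<and> b = e3 then of_real (sqrt (lam (tail G e3) / lam (head G e3))) * cell e1 e2 e3 else 0)"
    if "a \<in> arcs G" for a b
    using Coev_val[OF that, of b] XI_val[OF that] by (cases "a = b") auto
  then have "V ((head G e3, []), (tail G e1, [(Pos, e1), (Pos, e2), (Pos, e3)])) =
    (\<Sum>a\<in>arcs G. \<Sum>b\<in>arcs G. if a = e3 \<and> b = e3 then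
      of_real (sqrt (lam (tail G e3) / lam (head G e3))) * cell e1 e2 e3 else 0)"
    unfolding Cmp_edges[OF C XI]
    by (simp add: edge_sum_simps)
  then show ?thesis using assms by (simp add: sum_delta2)
qed


text \<open>Rotating by one click moves the last edge to the front; the weights of the additional cup and cap turn the rotational formula into an equality.\<close>

lemma rotation_relation:
  assumes rot: "\<And>e1 e2 e3. {e1, e2, e3} \<subseteq> arcs G \<Longrightarrow> head G e1 = tail G e2 \<Longrightarrow> head G e2 = tail G e3 \<Longrightarrow>
      head G e3 = tail G e1 \<Longrightarrow>
    cell e1 e2 e3 = of_real (sqrt (lam (tail G e2) / lam (tail G e1))) * cell e3 e1 e2"
  shows "Cmp Q (Cmp Q (Tns Q (Ev Q Neg) (Ide Q [Pos, Pos, Pos]))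
      (Tns Q (Tns Q (Ide Q [Neg]) V) (Ide Q [Pos]))) (Coev Q Neg) = V"
proof (rule gpa_ext[OF _ V_hom])
  let ?A = "Tns Q (evs Q [Neg]) (Ide Q [Pos, Pos, Pos])"
  let ?B = "Tns Q (Tns Q (Ide Q [Neg]) V) (Ide Q [Pos])"
  have A: "?A \<in> Hom Q [Neg, Pos, Pos, Pos, Pos] [Pos, Pos, Pos]"
    using Tns_hom[OF evs_hom Ide_hom, of "[Neg]" "[Pos, Pos, Pos]"] by simp
  have B1: "Tns Q (Ide Q [Neg]) V \<in> Hom Q [Neg] [Neg, Pos, Pos, Pos]"
    using Tns_hom[OF Ide_hom V_hom, of "[Neg]"] by simp
  have B: "?B \<in> Hom Q [Neg, Pos] [Neg, Pos, Pos, Pos, Pos]"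
    using Tns_hom[OF B1 Ide_hom, of "[Pos]"] by simp
  have C: "coevs Q [Neg] \<in> Hom Q [] [Neg, Pos]"
    using coevs_hom[of "[Neg]"] by simp
  let ?L = "Cmp Q (Cmp Q ?A ?B) (coevs Q [Neg])"
  have L: "Cmp Q (Cmp Q (Tns Q (Ev Q Neg) (Ide Q [Pos, Pos, Pos])) ?B) (Coev Q Neg) = ?L"
    by (simp only: evs_single coevs_single)
  show "Cmp Q (Cmp Q (Tns Q (Ev Q Neg) (Ide Q [Pos, Pos, Pos])) ?B) (Coev Q Neg) \<in>
      Hom Q [] [Pos, Pos, Pos]"
    unfolding L by (rule Cmp_hom[OF C Cmp_hom[OF B A]])
  fix p r
  assume pr: "p \<in> paths []" "r \<in> paths [Pos, Pos, Pos]" "fst p = fst r" "pend p = pend r"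
  then obtain e1 e2 e3 where r: "r = (tail G e1, [(Pos, e1), (Pos, e2), (Pos, e3)])"
    and p: "p = (head G e3, [])"
    and e: "e1 \<in> arcs G" "e2 \<in> arcs G" "e3 \<in> arcs G" "head G e1 = tail G e2" "head G e2 = tail G e3"
      "tail G e1 = head G e3"
    by (cases p; cases r) (auto simp: spaths_def Cons_eq_map_conv)
  define c where "c a b = complex_of_real (sqrt (lam a / lam b))" for a b
  have wgt: "wgt (head G x, [(Neg, x)]) = c (tail G x) (head G x)" for x
    by (simp add: wgt_def c_def)
  have B_val: "?B (loop (head G x, [(Neg, x)]), path_append (loop (head G y, [(Neg, y)])) r) =
      (if x = e3 \<and> y = e3 then c (tail G e2) (head G e2) * cell e3 e1 e2 else 0)"
    if "x \<in> arcs G" "y \<in> arcs G" for x y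
  proof -
    have loop: "loop (head G x, [(Neg, x)]) = (head G x, [(Neg, x), (Pos, x)])" for x
      by (simp add: loop_def prev_def path_append.simps)
    have "?B ((head G x, [(Neg, x), (Pos, x)]), (head G y, [(Neg, y), (Pos, y), (Pos, e1), (Pos, e2), (Pos, e3)])) =
      Ide Q [Neg] ((head G x, [(Neg, x)]), (head G y, [(Neg, y)])) *
      V ((tail G x, []), (tail G y, [(Pos, y), (Pos, e1), (Pos, e2)])) *
      Ide Q [Pos] ((tail G x, [(Pos, x)]), (pend (tail G y, [(Pos, y), (Pos, e1), (Pos, e2)]), [(Pos, e3)]))"
      by (simp add: Tns_coeff[OF B1 Ide_hom] Tns_coeff[OF Ide_hom V_hom] del: Ide_coeff)
    also have "\<dots> = (if x = e3 \<and> y = e3 then V ((head G e2, []), (tail G e3, [(Pos, e3), (Pos, e1), (Pos, e2)])) else 0)"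
      using that e by (auto simp: spaths_def)
    also have "\<dots> = (if x = e3 \<and> y = e3 then c (tail G e2) (head G e2) * cell e3 e1 e2 else 0)"
      using V_coeff[of e3 e1 e2] e by (simp add: c_def)
    finally show ?thesis by (simp add: loop r path_append.simps)
  qed
  have "?L (p, r) = (\<Sum>n\<in>paths [Neg, Pos, Pos, Pos, Pos]. Tns Q (coevs Q [Neg]) (Ide Q [Pos, Pos, Pos]) (r, n) *
      (\<Sum>m\<in>paths [Neg, Pos]. coevs Q [Neg] (p, m) * ?B (m, n)))"
    unfolding Cmp_coeff[OF Cmp_hom[OF C B] A] Cmp_coeff[OF C B] Tns_evs_Ide Cmp_assoc[OF C B A]
    by (simp add: mult.commute)
  also have "\<dots> = (\<Sum>y\<in>paths [Neg]. if fst y = fst r then wgt y *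
      (\<Sum>m\<in>paths [Neg, Pos]. coevs Q [Neg] (p, m) * ?B (m, path_append (loop y) r)) else 0)"
    using left_cup_sum[OF pr(2), of "[Neg]"] by (simp del: coevs.simps)
  also have "\<dots> = (\<Sum>y\<in>paths [Neg]. if fst y = fst r then wgt y *
      (\<Sum>x\<in>paths [Neg]. if p = (fst x, []) then wgt x * ?B (loop x, path_append (loop y) r) else 0) else 0)"
    unfolding coevs_cup using loop_path(1)[of _ "[Neg]"] by (subst sum_loops) auto
  also have "\<dots> = (\<Sum>y\<in>arcs G. \<Sum>x\<in>arcs G. if y = e3 \<and> x = e3 then
      c (tail G e3) (head G e3) * (c (tail G e3) (head G e3) * (c (tail G e2) (head G e2) * cell e3 e1 e2)) else 0)"
    unfolding sum_paths_single
  proof (rule sum.cong[OF refl])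
    fix y assume y: "y \<in> arcs G"
    let ?x = "\<lambda>x. (step_src G (Neg, x), [(Neg, x)])"
    let ?k = "c (tail G e3) (head G e3) * (c (tail G e2) (head G e2) * cell e3 e1 e2)"
    have "(\<Sum>x\<in>arcs G. if p = (fst (?x x), []) then wgt (?x x) * ?B (loop (?x x), path_append (loop (?x y)) r) else 0) =
        (\<Sum>x\<in>arcs G. if x = e3 then if y = e3 then ?k else 0 else 0)" (is "?l = _")
    proof (rule sum.cong[OF refl])
      fix x assume x: "x \<in> arcs G"
      show "(if p = (fst (?x x), []) then wgt (?x x) * ?B (loop (?x x), path_append (loop (?x y)) r) else 0) =
          (if x = e3 then if y = e3 then ?k else 0 else 0)"
        unfolding step_src.simps B_val[OF x y] wgt p
        by (cases "x = e3"; cases "y = e3") simp_all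
    qed
    then have "?l = (if y = e3 then ?k else 0)"
      using e(3) by simp
    then show "(if fst (?x y) = fst r then wgt (?x y) * ?l else 0) =
        (\<Sum>x\<in>arcs G. if y = e3 \<and> x = e3 then c (tail G e3) (head G e3) * ?k else 0)"
      using e by (cases "y = e3") (simp_all add: wgt r)
  qed
  also have "\<dots> = c (tail G e3) (head G e3) * (c (tail G e3) (head G e3) * (c (tail G e2) (head G e2) * cell e3 e1 e2))"
    using e(3) by (simp add: sum_delta2)
  also have "\<dots> = c (tail G e3) (head G e3) * cell e1 e2 e3"
  proof -
    have "lam (tail G e) > 0" if "e \<in> arcs G" for e
      using that lam_pos by simp
    then have "c (tail G e3) (head G e3) * c (tail G e2) (head G e2) = c (tail G e2) (tail G e1)"
      using e by (simp add: c_def of_real_mult[symmetric] real_sqrt_mult[symmetric] less_imp_neq[symmetric]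
          del: of_real_mult)
    then show ?thesis
      using rot[of e1 e2 e3] e unfolding c_def by (simp add: mult.assoc[symmetric])
  qed
  also have "\<dots> = V (p, r)"
    using V_coeff[of e1 e2 e3] e by (simp add: p r c_def)
  finally show "Cmp Q (Cmp Q (Tns Q (Ev Q Neg) (Ide Q [Pos, Pos, Pos])) ?B) (Coev Q Neg) (p, r) = V (p, r)"
    unfolding L .
qed

text \<open>The square of the weight of an edge is the quotient of the eigenvector at its ends, so the loop value is the Perron-Frobenius eigenvalue.\<close>

lemma loop_relation:
  assumes fp: "\<And>v. v \<in> verts G \<Longrightarrow> (\<Sum>e\<in>arcs G. if step_src G (a, e) = v then lam (step_tgt G (a, e)) else 0) = d * lam v"
  shows "Cmp Q (Ev Q a) (Coev Q a) = Scl Q (of_real d) (Ide Q [])"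
proof (rule gpa_ext[OF Cmp_hom[OF Coev_hom Ev_hom] Scl_hom[OF Ide_hom]])
  fix p r
  assume pr: "p \<in> paths []" "r \<in> paths []" "fst p = fst r"
  then obtain v where v: "p = (v, [])" "r = (v, [])" "v \<in> verts G"
    by (cases p; cases r) (auto simp: paths_Nil)
  have coevs: "coevs Q [a] (p, m) = (\<Sum>x\<in>paths [a]. if fst x = v \<and> m = loop x then wgt x else 0)" for m
    unfolding coevs_cup v by (intro sum.cong refl) auto
  have "Cmp Q (Ev Q a) (Coev Q a) (p, r) =
    (\<Sum>m\<in>paths ([a] @ dobj [a]). coevs Q [a] (p, m) * coevs Q [a] (r, m))"
    unfolding Cmp_coeff[OF Coev_hom Ev_hom] by (simp only: evs_single[symmetric] coevs_single[symmetric] evs_coevs) simp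
  also have "\<dots> = (\<Sum>x\<in>paths [a]. if fst x = v then wgt x * coevs Q [a] (r, loop x) else 0)"
    unfolding coevs using loop_path(1)[of _ "[a]"] by (subst sum_loops) auto
  also have "\<dots> = (\<Sum>x\<in>paths [a]. if fst x = v then wgt x * wgt x else 0)"
  proof (intro sum.cong refl)
    fix x assume x: "x \<in> paths [a]"
    have "coevs Q [a] (r, loop x) = (\<Sum>y\<in>paths [a]. if y = x then if fst x = v then wgt x else 0 else 0)"
      unfolding coevs_cup v
    proof (intro sum.cong refl)
      fix y assume y: "y \<in> paths [a]"
      have "loop x = loop y \<longleftrightarrow> x = y"
        unfolding loop_def using ptake_append[OF x] ptake_append[OF y] by metis
      then show "(if (v, []) = (fst y, []) \<and> loop x = loop y then wgt y else 0) =
          (if y = x then if fst x = v then wgt x else 0 else 0)" by auto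
    qed
    then show "(if fst x = v then wgt x * coevs Q [a] (r, loop x) else 0) =
        (if fst x = v then wgt x * wgt x else 0)"
      using x by simp
  qed
  also have "\<dots> = (\<Sum>e\<in>arcs G. of_real ((if step_src G (a, e) = v then lam (step_tgt G (a, e)) else 0) / lam v))"
    unfolding sum_paths_single
  proof (intro sum.cong refl)
    fix e assume "e \<in> arcs G"
    then have "0 < lam (step_src G (a, e))" "0 < lam (step_tgt G (a, e))"
      using step_ends[of "(a, e)"] lam_pos by auto
    then show "(if fst (step_src G (a, e), [(a, e)]) = v
        then wgt (step_src G (a, e), [(a, e)]) * wgt (step_src G (a, e), [(a, e)]) else 0) =
      of_real ((if step_src G (a, e) = v then lam (step_tgt G (a, e)) else 0) / lam v)"
      by (auto simp: wgt_def of_real_mult[symmetric] simp del: of_real_mult of_real_divide)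
  qed
  also have "\<dots> = of_real d"
    using fp[OF v(3)] lam_pos[OF v(3)]
    by (simp add: of_real_sum[symmetric] sum_divide_distrib[symmetric] del: of_real_divide)
  finally show "Cmp Q (Ev Q a) (Coev Q a) (p, r) = Scl Q (of_real d) (Ide Q []) (p, r)"
    using v by (simp add: paths_Nil)
qed

end

section \<open>Normalised cells and their equations\<close>

definition s2 :: real where "s2 = sqrt 2"
definition s3 :: real where "s3 = sqrt 3"
definition r4 :: real where "r4 = sqrt (sqrt 3)"
definition rf :: real where "rf = sqrt (2 + sqrt 2)"
definition b3 :: real where "b3 = sqrt (1 + sqrt 3)"
definition ra :: real where "ra = sqrt (1 + sqrt 3 + sqrt 2)"
definition rb :: real where "rb = sqrt (1 + sqrt 3 - sqrt 2)"

lemma radical_squares: "s2 * s2 = 2" "s3 * s3 = 3" "r4 * r4 = s3" "rf * rf = 2 + s2" "b3 * b3 = 1 + s3"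
  "ra * ra = 1 + s3 + s2" "rb * rb = 1 + s3 - s2"
proof -
  have "sqrt 2 \<le> sqrt 3" "sqrt 3 \<ge> 0" by simp_all
  then show "s2 * s2 = 2" "s3 * s3 = 3" "r4 * r4 = s3" "rf * rf = 2 + s2" "b3 * b3 = 1 + s3"
  "ra * ra = 1 + s3 + s2" "rb * rb = 1 + s3 - s2"
    by (simp_all add: s2_def s3_def r4_def rf_def b3_def ra_def rb_def del: real_sqrt_le_iff)
qed

lemma radical_squares': "s2 * (s2 * x) = 2 * x" "s3 * (s3 * x) = 3 * x" "r4 * (r4 * x) = s3 * x"
  "rf * (rf * x) = (2 + s2) * x" "b3 * (b3 * x) = (1 + s3) * x"
  "ra * (ra * x) = (1 + s3 + s2) * x" "rb * (rb * x) = (1 + s3 - s2) * x"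
  by (simp_all only: mult.assoc[symmetric] radical_squares)

lemmas radical_simps = radical_squares radical_squares'

text \<open>The cells after normalisation. With \<open>\<beta>\<close>-phases \<open>\<rho>\<^sub>3 = \<zeta>\<^sub>3\<close>, \<open>\<rho>\<^sub>4 = \<zeta>\<^sub>8\<^sup>5\<close>, the relations force \<open>sqrt (sqrt 3) * sqrt (1 + sqrt 3) * \<rho>\<^sub>2 = rf * (\<rho>\<^sub>3 - (s2 - 1) * \<rho>\<^sub>4)\<close>, where \<open>z = \<zeta>\<^sub>2\<^sub>4\<^sup>5 \<rho>\<^sub>2\<close>; the other explicit coordinates follow from this equation.\<close>

definition t_table :: "((edge \<times> edge) \<times> complex) list" where
  "t_table =
     [((Edge 1 6, Alpha), Complex (s2 * (1 + s3) / 2) 0),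
      ((Edge 1 6, Beta), 0),
      ((Edge 2 6, Alpha), Complex 1 0),
      ((Edge 2 6, Beta), Complex (r4 * rf * (s3 * (1 - s2) / 6)) (r4 * rf * (s3 * (2 + s3 - s2) / 6))),
      ((Edge 3 6, Alpha), Complex r4 0),
      ((Edge 3 6, Beta), Complex (- (rf * (s2 - 1) / 2)) (rf * (s2 - 1) * s3 / 2)),
      ((Edge 4 6, Alpha), Complex r4 0),
      ((Edge 4 6, Beta), Complex (- (rf * s2 / 2)) (- (rf * s2 / 2))),
      ((Edge 5 6, Alpha), Complex s2 0),
      ((Edge 5 6, Beta), Complex (s2 * r4 * rf * (- (s3 * (1 + s3 - s2 - 2 * s2 * s3) / 12))) (s2 * r4 * rf * (- (s3 * (s3 - 1 + 2 * s2 - s2 * s3) / 12)))),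
      ((Edge 3 6, Edge 6 7), Complex ra 0),
      ((Edge 3 10, Edge 10 7), Complex (rf * (s2 - 1)) 0),
      ((Edge 3 10, Edge 10 9), Complex ra 0),
      ((Edge 4 6, Edge 6 7), Complex (- (rb * s2 / 2)) (- (rb * s2 / 2))),
      ((Edge 4 10, Edge 10 7), Complex rf 0),
      ((Edge 4 10, Edge 10 9), Complex rb 0),
      ((Edge 5 6, Edge 6 7), Complex (s2 * r4 * b3 * rf * ((-3 + 3 * s2 + 1 * s3 - 2 * s2 * s3) / 12)) (s2 * r4 * b3 * rf * ((3 + 1 * s3 - 1 * s2 * s3) / 12))),
      ((Edge 5 8, Edge 8 7), Complex s2 0),
      ((Edge 5 10, Edge 10 7), Complex (b3 * (s3 - 1)) 0),
      ((Edge 5 10, Edge 10 9), Complex s2 0),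
      ((Edge 5 10, Edge 10 11), Complex s2 0)]"

definition t_start :: "edge \<Rightarrow> edge \<Rightarrow> complex" where
  "t_start a b = the (map_of t_table (a, b))"

lemma t_start_values:
  "t_start (Edge 1 6) Alpha = Complex (s2 * (1 + s3) / 2) 0"
  "t_start (Edge 1 6) Beta = 0"
  "t_start (Edge 2 6) Alpha = Complex 1 0"
  "t_start (Edge 2 6) Beta = Complex (r4 * rf * (s3 * (1 - s2) / 6)) (r4 * rf * (s3 * (2 + s3 - s2) / 6))"
  "t_start (Edge 3 6) Alpha = Complex r4 0"
  "t_start (Edge 3 6) Beta = Complex (- (rf * (s2 - 1) / 2)) (rf * (s2 - 1) * s3 / 2)"
  "t_start (Edge 4 6) Alpha = Complex r4 0"
  "t_start (Edge 4 6) Beta = Complex (- (rf * s2 / 2)) (- (rf * s2 / 2))"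
  "t_start (Edge 5 6) Alpha = Complex s2 0"
  "t_start (Edge 5 6) Beta = Complex (s2 * r4 * rf * (- (s3 * (1 + s3 - s2 - 2 * s2 * s3) / 12))) (s2 * r4 * rf * (- (s3 * (s3 - 1 + 2 * s2 - s2 * s3) / 12)))"
  "t_start (Edge 3 6) (Edge 6 7) = Complex ra 0"
  "t_start (Edge 3 10) (Edge 10 7) = Complex (rf * (s2 - 1)) 0"
  "t_start (Edge 3 10) (Edge 10 9) = Complex ra 0"
  "t_start (Edge 4 6) (Edge 6 7) = Complex (- (rb * s2 / 2)) (- (rb * s2 / 2))"
  "t_start (Edge 4 10) (Edge 10 7) = Complex rf 0"
  "t_start (Edge 4 10) (Edge 10 9) = Complex rb 0"
  "t_start (Edge 5 6) (Edge 6 7) = Complex (s2 * r4 * b3 * rf * ((-3 + 3 * s2 + 1 * s3 - 2 * s2 * s3) / 12)) (s2 * r4 * b3 * rf * ((3 + 1 * s3 - 1 * s2 * s3) / 12))"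
  "t_start (Edge 5 8) (Edge 8 7) = Complex s2 0"
  "t_start (Edge 5 10) (Edge 10 7) = Complex (b3 * (s3 - 1)) 0"
  "t_start (Edge 5 10) (Edge 10 9) = Complex s2 0"
  "t_start (Edge 5 10) (Edge 10 11) = Complex s2 0"
  by (simp_all add: t_start_def t_table_def)

text \<open>The graph is tripartite: edges lead from \<open>{1..5}\<close> to \<open>{6, 8, 10}\<close>, from there to \<open>{7, 9, 11}\<close>, and back. So each triangle has one corner in \<open>{1..5}\<close>, and the normalised cells do not depend on the starting corner.\<close>

definition tri3 :: "edge \<Rightarrow> edge \<Rightarrow> edge \<Rightarrow> complex" where
  "tri3 a b c = (if edge_tail a \<le> 5 then t_start a b else if edge_tail b \<le> 5 then t_start b c else t_start c a)"

text \<open>The eigenvector divided by \<open>(1 + sqrt 3) / 2\<close>, and below its inverse.\<close>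

definition mu :: "nat \<Rightarrow> real" where
  "mu v = [1, 1, s3, s3, 2, 1 + s3, 2, s3 - 1, 1 + s3, 2, s3 - 1] ! (v - 1)"

definition imu :: "nat \<Rightarrow> real" where
  "imu v = [1, 1, s3 / 3, s3 / 3, 1 / 2, (s3 - 1) / 2, 1 / 2, (s3 + 1) / 2, (s3 - 1) / 2, 1 / 2, (s3 + 1) / 2] ! (v - 1)"

definition edges :: "edge list" where
  "edges = [Edge 1 6, Edge 2 6, Edge 3 6, Edge 3 10, Edge 4 6, Edge 4 10,
       Edge 5 6, Edge 5 8, Edge 5 10, Edge 6 7, Edge 7 3, Edge 7 4, Edge 7 5,
       Edge 8 7, Edge 9 1, Edge 9 2, Edge 9 3, Edge 9 4, Edge 9 5,
       Edge 10 7, Edge 10 9, Edge 10 11, Edge 11 5, Alpha, Beta]"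

definition into :: "nat \<Rightarrow> edge list" where "into v = filter (\<lambda>e. edge_head e = v) edges"
definition outof :: "nat \<Rightarrow> edge list" where "outof v = filter (\<lambda>e. edge_tail e = v) edges"
definition parallel :: "nat \<Rightarrow> nat \<Rightarrow> edge list" where
  "parallel v w = filter (\<lambda>e. edge_tail e = v) (into w)"

lemma into_values:
  "into 1 = [Edge 9 1]"
  "into 2 = [Edge 9 2]"
  "into 3 = [Edge 7 3, Edge 9 3]"
  "into 4 = [Edge 7 4, Edge 9 4]"
  "into 5 = [Edge 7 5, Edge 9 5, Edge 11 5]"
  "into 6 = [Edge 1 6, Edge 2 6, Edge 3 6, Edge 4 6, Edge 5 6]"
  "into 7 = [Edge 6 7, Edge 8 7, Edge 10 7]"
  "into 8 = [Edge 5 8]"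
  "into 9 = [Edge 10 9, Alpha, Beta]"
  "into 10 = [Edge 3 10, Edge 4 10, Edge 5 10]"
  "into 11 = [Edge 10 11]"
  by (simp_all add: into_def edges_def)

lemma outof_values:
  "outof 1 = [Edge 1 6]"
  "outof 2 = [Edge 2 6]"
  "outof 3 = [Edge 3 6, Edge 3 10]"
  "outof 4 = [Edge 4 6, Edge 4 10]"
  "outof 5 = [Edge 5 6, Edge 5 8, Edge 5 10]"
  "outof 6 = [Edge 6 7, Alpha, Beta]"
  "outof 7 = [Edge 7 3, Edge 7 4, Edge 7 5]"
  "outof 8 = [Edge 8 7]"
  "outof 9 = [Edge 9 1, Edge 9 2, Edge 9 3, Edge 9 4, Edge 9 5]"
  "outof 10 = [Edge 10 7, Edge 10 9, Edge 10 11]"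
  "outof 11 = [Edge 11 5]"
  by (simp_all add: outof_def edges_def)

lemma mu_values:
  "mu 1 = 1"
  "mu 2 = 1"
  "mu 3 = s3"
  "mu 4 = s3"
  "mu 5 = 2"
  "mu 6 = 1 + s3"
  "mu 7 = 2"
  "mu 8 = s3 - 1"
  "mu 9 = 1 + s3"
  "mu 10 = 2"
  "mu 11 = s3 - 1"
  by (simp_all add: mu_def)

lemma imu_values:
  "imu 1 = 1"
  "imu 2 = 1"
  "imu 3 = s3 / 3"
  "imu 4 = s3 / 3"
  "imu 5 = 1 / 2"
  "imu 6 = (s3 - 1) / 2"
  "imu 7 = 1 / 2"
  "imu 8 = (s3 + 1) / 2"
  "imu 9 = (s3 - 1) / 2"
  "imu 10 = 1 / 2"
  "imu 11 = (s3 + 1) / 2"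
  by (simp_all add: imu_def)

definition half :: "edge \<Rightarrow> edge \<Rightarrow> edge \<Rightarrow> edge \<Rightarrow> complex" where
  "half a b h h' = (\<Sum>g\<leftarrow>parallel (edge_head a) (edge_tail h). cnj (tri3 g h a) * tri3 b g h')"

text \<open>The square equation with all normalising factors collected: the inner region contributes the inverse of \<open>mu\<close>.\<close>

definition square_lhs :: "edge \<Rightarrow> edge \<Rightarrow> edge \<Rightarrow> edge \<Rightarrow> complex" where
  "square_lhs a b c d = (\<Sum>h\<leftarrow>into (edge_tail a). scaleR (imu (edge_tail h))
     (\<Sum>h'\<leftarrow>parallel (edge_tail h) (edge_tail b). half a b h h' * cnj (half c d h h')))"

definition square_rhs :: "edge \<Rightarrow> edge \<Rightarrow> edge \<Rightarrow> edge \<Rightarrow> real" where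
  "square_rhs a b c d = (if a = c \<and> b = d then mu (edge_tail a) * mu (edge_tail b) * mu (edge_head a) / 2 else 0) +
     (if a = b \<and> c = d then mu (edge_tail a) * mu (edge_head a) * mu (edge_head c) / 2 else 0)"

definition square_ok :: "edge \<Rightarrow> edge \<Rightarrow> edge \<Rightarrow> edge \<Rightarrow> bool" where
  "square_ok a b c d \<longleftrightarrow> square_lhs a b c d = Complex (square_rhs a b c d) 0"


lemma square_okI: "Re (square_lhs a b c d) = square_rhs a b c d \<Longrightarrow> Im (square_lhs a b c d) = 0 \<Longrightarrow> square_ok a b c d"
  by (simp add: square_ok_def complex_eq_iff)

lemmas complex_simps = complex_mult complex_cnj complex_add complex_scaleR

lemmas value_simps = square_lhs_def square_rhs_def half_def into_values parallel_def tri3_def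
  t_start_values mu_values imu_values complex_simps algebra_simps radical_simps add_divide_distrib diff_divide_distrib

definition "layerI = [Edge 1 6, Edge 2 6, Edge 3 6, Edge 3 10, Edge 4 6, Edge 4 10,
       Edge 5 6, Edge 5 8, Edge 5 10]"
definition "layerJ = [Edge 6 7, Edge 8 7, Edge 10 7, Edge 10 9, Edge 10 11, Alpha, Beta]"
definition "layerK = [Edge 7 3, Edge 7 4, Edge 7 5, Edge 9 1, Edge 9 2, Edge 9 3, Edge 9 4, Edge 9 5, Edge 11 5]"

section \<open>Quantum integers and the root z\<close>

lemma radicals_pos [simp]: "s2 > 0" "s3 > 0" "r4 > 0" "rf > 0" "b3 > 0" "ra > 0" "rb > 0"
proof -
  have "sqrt 2 < sqrt 3" by simp
  then have "sqrt 2 < 1 + sqrt 3" by linarith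
  then show "s2 > 0" "s3 > 0" "r4 > 0" "rf > 0" "b3 > 0" "ra > 0" "rb > 0"
    by (simp_all add: s2_def s3_def r4_def rf_def b3_def ra_def rb_def add_pos_pos)
qed

lemma radicals_nonzero [simp]: "s2 \<noteq> 0" "s3 \<noteq> 0" "r4 \<noteq> 0" "rf \<noteq> 0" "b3 \<noteq> 0" "ra \<noteq> 0" "rb \<noteq> 0"
  by (rule less_imp_neq[symmetric], simp)+

lemma radicals_ge [simp]: "0 \<le> s2" "0 \<le> s3" "0 \<le> r4" "0 \<le> rf" "0 \<le> b3" "0 \<le> ra" "0 \<le> rb" "1 \<le> s2" "1 \<le> s3"
  by (rule less_imp_le, simp)+ (simp_all add: s2_def s3_def)

lemma radical_bounds: "(1414 / 1000) < s2" "s2 < (1415 / 1000)" "(1732 / 1000) < s3" "s3 < (17321 / 10000)"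
  "(2449 / 1000) < s2 * s3" "s2 * s3 < (24496 / 10000)"
proof -
  show "(1414 / 1000) < s2" "(1732 / 1000) < s3"
    unfolding s2_def s3_def by (rule real_less_rsqrt, simp add: power2_eq_square)+
  show "s2 < (1415 / 1000)" "s3 < (17321 / 10000)"
    unfolding s2_def s3_def by (rule real_less_lsqrt; simp add: power2_eq_square)+
  have "s2 * s3 = sqrt 6" by (simp add: s2_def s3_def real_sqrt_mult[symmetric])
  moreover have "(2449 / 1000) < sqrt 6"
    by (rule real_less_rsqrt, simp add: power2_eq_square)
  moreover have "sqrt 6 < (24496 / 10000)"
    by (rule real_less_lsqrt; simp add: power2_eq_square)
  ultimately show "(2449 / 1000) < s2 * s3" "s2 * s3 < (24496 / 10000)" by simp_all
qed

lemma sin_cos_pi12: "sin (pi / 12) = s2 * (s3 - 1) / 4" "cos (pi / 12) = s2 * (s3 + 1) / 4"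
proof -
  have *: "pi / 12 = pi / 3 - pi / 4" by simp
  show "sin (pi / 12) = s2 * (s3 - 1) / 4" "cos (pi / 12) = s2 * (s3 + 1) / 4"
    unfolding * sin_diff cos_diff by (simp_all add: sin_60 cos_60 sin_45 cos_45 s2_def s3_def field_simps)
qed

lemma qint_sin: "qint n = of_real (sin (real n * pi / 12) / sin (pi / 12))"
proof -
  have q: "q24 = cis (pi / 12)"
    by (simp add: q24_def cis_conv_exp mult_ac)
  have "cis x - cis (- x) = 2 * \<i> * of_real (sin x)" for x
    by (simp add: complex_eq_iff)
  then have "qint n = (2 * \<i> * of_real (sin (real n * (pi / 12)))) / (2 * \<i> * of_real (sin (pi / 12)))"
    by (simp add: qint_def q cis_inverse DeMoivre)
  then show ?thesis
    by simp
qed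

lemma qint_rqint: "qint n = of_real (rqint n)"
  by (simp add: rqint_def qint_sin)

lemma rqint_values: "rqint 2 = s2 * (1 + s3) / 2" "rqint 3 = 1 + s3" "rqint 4 = s2 * (3 + s3) / 2" "rqint 5 = 2 + s3"
proof -
  have nz: "s2 * (s3 - 1) / 4 \<noteq> 0"
    using radical_bounds(3) radicals_pos(1) by simp
  have rq: "rqint n = sin (real n * pi / 12) * (s2 * (s3 + 1))" for n
  proof -
    have "s2 * (s3 + 1) * (s2 * (s3 - 1) / 4) = 1"
      by (simp add: algebra_simps radical_simps)
    then have "sin (real n * pi / 12) / (s2 * (s3 - 1) / 4) = sin (real n * pi / 12) * (s2 * (s3 + 1))"
      using nz by (metis mult.assoc mult.right_neutral nonzero_eq_divide_eq)
    then show ?thesis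
      by (simp add: rqint_def qint_sin sin_cos_pi12)
  qed
  have "2 * pi / 12 = pi / 6" "3 * pi / 12 = pi / 4" "4 * pi / 12 = pi / 3" "5 * pi / 12 = pi / 2 - pi / 12"
    by simp_all
  then have sines: "sin (real 2 * pi / 12) = 1 / 2" "sin (real 3 * pi / 12) = s2 / 2"
    "sin (real 4 * pi / 12) = s3 / 2" "sin (real 5 * pi / 12) = s2 * (s3 + 1) / 4"
    by (simp_all only: of_nat_numeral sin_30 sin_45 sin_60 sin_diff sin_pi_half cos_pi_half sin_cos_pi12 s2_def s3_def)
  show "rqint 2 = s2 * (1 + s3) / 2" "rqint 3 = 1 + s3" "rqint 4 = s2 * (3 + s3) / 2" "rqint 5 = 2 + s3"
    unfolding rq sines by (simp_all add: algebra_simps radical_simps)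
qed

subsection \<open>The root z\<close>

text \<open>The explicit value of \<open>z\<close>. Already its square has coordinates in the field generated by \<open>sqrt 2\<close> and \<open>sqrt 3\<close>.\<close>

definition z0 :: complex where
  "z0 = Complex (r4 * rf * b3 * ((3 - 3 * s2 - s3) / 12)) (r4 * rf * b3 * ((3 - 3 * s3 + s2 * s3) / 12))"

lemma z0_power: "z0 ^ 2 = Complex ((2 * s3 + s2 * s3) / 6) ((s2 * s3 - 2 * s3) / 6)"
  "z0 ^ 4 = Complex (2 * s2 / 3) (- 1 / 3)" "z0 ^ 8 = Complex (7 / 9) (- 4 * s2 / 9)"
proof -
  show 2: "z0 ^ 2 = Complex ((2 * s3 + s2 * s3) / 6) ((s2 * s3 - 2 * s3) / 6)"
    by (simp add: power2_eq_square z0_def complex_mult algebra_simps radical_simps add_divide_distrib diff_divide_distrib)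
  have "z0 ^ 4 = z0 ^ 2 * z0 ^ 2" by (simp add: power_add[symmetric])
  then show 4: "z0 ^ 4 = Complex (2 * s2 / 3) (- 1 / 3)"
    unfolding 2 by (simp add: complex_mult algebra_simps radical_simps add_divide_distrib diff_divide_distrib)
  have "z0 ^ 8 = z0 ^ 4 * z0 ^ 4" by (simp add: power_add[symmetric])
  then show "z0 ^ 8 = Complex (7 / 9) (- 4 * s2 / 9)"
    unfolding 4 by (simp add: complex_mult algebra_simps radical_simps add_divide_distrib diff_divide_distrib)
qed

lemma z0_cnj: "z0 * cnj z0 = 1" "cnj z0 * z0 = 1"
proof -
  show "z0 * cnj z0 = 1"
    by (simp add: z0_def complex_mult complex_cnj complex_eq_iff)
      (simp add: algebra_simps radical_simps add_divide_distrib diff_divide_distrib)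
  then show "cnj z0 * z0 = 1" by (simp add: mult.commute)
qed

text \<open>The defining polynomial is quadratic in the eighth power, with the conjugate values \<open>z0 ^ 8\<close> and \<open>cnj z0 ^ 8\<close> as its roots.\<close>

lemma z_root_iff: "z_root y \<longleftrightarrow> y ^ 8 = z0 ^ 8 \<or> y ^ 8 = cnj z0 ^ 8"
proof -
  have "cnj z0 ^ 8 = cnj (z0 ^ 8)" by simp
  then have "(y ^ 8 - z0 ^ 8) * (y ^ 8 - cnj z0 ^ 8) = y ^ 8 * y ^ 8 - (14 / 9) * y ^ 8 + 1"
    unfolding z0_power complex_cnj
    by (simp add: Complex_eq algebra_simps)
      (simp add: complex_eq_iff algebra_simps radical_simps)
  also have "9 * \<dots> = 9 * y ^ 16 - 14 * y ^ 8 + 9"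
    by (simp add: algebra_simps power_add[symmetric])
  finally show ?thesis
    unfolding z_root_def by (metis mult_eq_0_iff right_minus_eq zero_neq_numeral)
qed

text \<open>An eighth root of unity in the open sector \<open>Re u > 1 / sqrt 2\<close> has a square with positive real part, hence is not a root of any other factor of \<open>u ^ 8 - 1\<close> than \<open>u - 1\<close>.\<close>

lemma eighth_root_of_unity:
  fixes u :: complex
  assumes "u ^ 8 = 1" "u \<noteq> 1"
  shows "Re u \<le> s2 / 2 \<and> \<bar>Im u\<bar> \<le> 1 \<and> (Re u)\<^sup>2 + (Im u)\<^sup>2 = 1"
proof -
  have norm: "cmod u = 1"
    using assms(1) by (metis norm_one norm_power power_eq_1_iff norm_ge_zero zero_neq_numeral)
  then have n2: "(Re u)\<^sup>2 + (Im u)\<^sup>2 = 1"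
    by (metis cmod_power2 one_power2)
  have fac: "(u - 1) * ((u + 1) * ((u\<^sup>2 + 1) * (u ^ 4 + 1))) = u ^ 8 - 1"
    by (simp add: algebra_simps power_add[symmetric] power2_eq_square eval_nat_numeral)
  have "Re u \<le> s2 / 2"
  proof (rule ccontr)
    assume "\<not> Re u \<le> s2 / 2"
    then have "(Re u)\<^sup>2 > (s2 / 2)\<^sup>2"
      using less_imp_le[OF radicals_pos(1)] by (intro power_strict_mono) auto
    then have re: "(Re u)\<^sup>2 > 1 / 2" "Re u > 0"
      using radical_squares(1) by (simp add: power2_eq_square)
        (use \<open>\<not> Re u \<le> s2 / 2\<close> radicals_pos(1) in linarith)
    have "u + 1 \<noteq> 0" using re(2) by (auto simp: complex_eq_iff)
    moreover have "Re (u\<^sup>2) > 0" using re n2 by (simp add: power2_eq_square)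
    then have "u\<^sup>2 + 1 \<noteq> 0" by (auto simp: complex_eq_iff)
    ultimately have u4: "u ^ 4 = - 1" using fac assms by (auto simp: eq_neg_iff_add_eq_0)
    define v where "v = u\<^sup>2"
    have "v * v = - 1"
      using u4 by (simp add: v_def power_add[symmetric])
    from arg_cong[OF this, of Re] arg_cong[OF this, of Im]
    have "Re v * Re v = Im v * Im v - 1" "Re v * Im v = 0"
      by auto
    moreover have "Re v > 0" using \<open>Re (u\<^sup>2) > 0\<close> by (simp add: v_def)
    ultimately have "Re v * Re v = - 1" by auto
    then show False using zero_le_square[of "Re v"] by linarith
  qed
  moreover have "\<bar>Im u\<bar> \<le> 1" using norm abs_Im_le_cmod[of u] by simp
  ultimately show ?thesis using n2 by simp
qed

lemma z0_bounds: "- 1 \<le> Re z0" "Re z0 \<le> - (98 / 100)" "(8 / 100) \<le> Im z0" "Im z0 \<le> (9 / 100)"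
  "Re (z0 ^ 2) < (9864 / 10000)" "- (18 / 100) < Im (z0 ^ 2)" "Im (z0 ^ 2) < 0"
proof -
  note b = radical_bounds
  show re: "Re (z0 ^ 2) < (9864 / 10000)" and im: "- (18 / 100) < Im (z0 ^ 2)" "Im (z0 ^ 2) < 0"
    unfolding z0_power using b by simp_all
  have re': "(985 / 1000) < Re (z0 ^ 2)" and im': "Im (z0 ^ 2) < - (168 / 1000)"
    unfolding z0_power using b by simp_all
  have n: "(Re z0)\<^sup>2 + (Im z0)\<^sup>2 = 1"
    using z0_cnj(1) by (simp add: complex_eq_iff power2_eq_square)
  have sq: "Re (z0 ^ 2) = 2 * (Re z0)\<^sup>2 - 1" "Im (z0 ^ 2) = 2 * Re z0 * Im z0"
    using n by (simp add: power2_eq_square, simp add: power2_eq_square)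
  have neg: "Re z0 < 0"
    using b by (auto simp: z0_def mult_pos_neg)
  define x where "x = - Re z0"
  have x: "x > 0" "x\<^sup>2 > (9925 / 10000)" "x\<^sup>2 \<le> 1"
  proof -
    have "(Re z0)\<^sup>2 \<le> 1" using n zero_le_power2[of "Im z0"] by linarith
    then show "x > 0" "x\<^sup>2 > (9925 / 10000)" "x\<^sup>2 \<le> 1"
      using neg re' sq(1) by (simp_all add: x_def)
  qed
  have x1: "x \<le> 1" using x by (metis abs_le_square_iff abs_of_pos abs_one one_power2)
  have x2: "x \<ge> (99 / 100)"
  proof (rule ccontr)
    assume "\<not> x \<ge> (99 / 100)"
    then have "x\<^sup>2 \<le> (99 / 100)\<^sup>2" using x by (intro power_mono) auto
    then show False using x by (simp add: power2_eq_square)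
  qed
  show "- 1 \<le> Re z0" "Re z0 \<le> - (98 / 100)" using x1 x2 by (simp_all add: x_def)
  have "Im (z0 ^ 2) = - (2 * (x * Im z0))"
    using sq(2) by (simp add: x_def)
  moreover have "- (17 / 100) < Im (z0 ^ 2)"
    unfolding z0_power using b by simp
  ultimately have y: "2 * (x * Im z0) > (168 / 1000)" "2 * (x * Im z0) < (17 / 100)"
    using im' by linarith+
  then have "0 < x * Im z0" by linarith
  then have pos: "Im z0 > 0" using x(1) by (simp add: zero_less_mult_iff)
  then have "x * Im z0 \<le> 1 * Im z0" "(99 / 100) * Im z0 \<le> x * Im z0"
    using x1 x2 by (intro mult_right_mono; simp)+
  then show "(8 / 100) \<le> Im z0" "Im z0 \<le> (9 / 100)" using y by linarith+
qed

text \<open>Every other root is \<open>z0\<close> or its conjugate times an eighth root of unity; the conjugate itself is the nearest one.\<close>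

lemma z_root_separated:
  assumes "z_root y" "y \<noteq> z0"
  shows "dist y z0 \<ge> (16 / 100)"
proof -
  have key: "Re (y * cnj z0) \<le> (9864 / 10000)" if "cmod y = 1"
  proof -
    from assms(1) consider "y ^ 8 = z0 ^ 8" | "y ^ 8 = cnj z0 ^ 8"
      by (auto simp: z_root_iff)
    then show ?thesis
    proof cases
      case 1
      have "(y * cnj z0) ^ 8 = (z0 * cnj z0) ^ 8"
        using 1 by (simp add: power_mult_distrib)
      then have u: "(y * cnj z0) ^ 8 = 1" by (simp add: z0_cnj)
      moreover have "y * cnj z0 \<noteq> 1"
        using assms(2) z0_cnj(2) by (metis mult.assoc mult.commute mult_1)
      ultimately show ?thesis
        using eighth_root_of_unity[of "y * cnj z0"] radical_bounds(2) by simp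
    next
      case 2
      define u where "u = y * z0"
      have "u ^ 8 = (cnj z0 * z0) ^ 8"
        unfolding u_def power_mult_distrib 2 ..
      then have u: "u ^ 8 = 1" by (simp add: z0_cnj)
      have y: "y * cnj z0 = u * cnj (z0 ^ 2)"
        using z0_cnj(1) by (simp add: u_def power2_eq_square)
      show ?thesis
      proof (cases "u = 1")
        case True
        show ?thesis
          using z0_bounds(5) unfolding y True mult_1 cnj.simps by (rule less_imp_le)
      next
        case False
        note r = eighth_root_of_unity[OF u False]
        define p q where "p = Re (z0 ^ 2)" and "q = - Im (z0 ^ 2)"
        have pq: "0 < p" "p < (9864 / 10000)" "0 < q" "q < (18 / 100)"
          using z0_bounds(5-7) radical_bounds unfolding p_def q_def z0_power
          by (simp_all add: diff_divide_distrib)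
        have "Re (y * cnj z0) = Re u * p - Im u * q"
          unfolding y by (simp add: p_def q_def del: complex_cnj_power)
        also have "\<dots> \<le> (71 / 100) * p + 1 * q"
        proof -
          have "Re u * p \<le> (71 / 100) * p"
            using r radical_bounds(2) pq by (intro mult_right_mono) auto
          moreover have "- Im u * q \<le> 1 * q"
            using r pq by (intro mult_right_mono) auto
          ultimately show ?thesis by simp
        qed
        finally show ?thesis using pq by linarith
      qed
    qed
  qed
  have z1: "cmod z0 = 1"
    using z0_cnj(1) by (metis complex_mod_sqrt_Re_mult_cnj one_complex.simps(1) real_sqrt_one)
  have y8: "cmod y ^ 8 = 1"
    using assms(1) z1 by (auto simp: z_root_iff norm_power[symmetric] simp del: norm_power) (simp_all add: norm_power)
  then have y1: "cmod y = 1"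
    using power_eq_1_iff[OF y8] by simp
  have "(dist y z0)\<^sup>2 = (cmod y)\<^sup>2 + (cmod z0)\<^sup>2 - 2 * Re (y * cnj z0)"
    by (simp add: dist_norm cmod_power2) (simp add: power2_eq_square algebra_simps)
  also have "\<dots> \<ge> (16 / 100)\<^sup>2"
    using key[OF y1] y1 z1 by (simp add: power2_eq_square)
  finally show ?thesis
    by (rule power2_le_imp_le) simp
qed

lemma zW_eq: "zW = z0"
proof -
  define c where "c = Complex (- 0.996393) 0.0848571"
  have near: "dist z0 c \<le> (3 / 100)"
  proof -
    have "dist z0 c \<le> \<bar>Re (z0 - c)\<bar> + \<bar>Im (z0 - c)\<bar>"
      unfolding dist_norm by (rule cmod_le)
    also have "\<dots> \<le> (3 / 100)"
      using z0_bounds(1-4) by (simp add: c_def abs_if)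
    finally show ?thesis .
  qed
  have far: "dist z0 c < dist y c" if "z_root y" "y \<noteq> z0" for y
    using z_root_separated[OF that] near dist_triangle2[of y z0 c] by linarith
  have "z_root z0" by (simp add: z_root_iff)
  show ?thesis
    unfolding zW_def Let_def c_def[symmetric]
  proof (rule the_equality)
    show "z_root z0 \<and> (\<forall>y. z_root y \<and> y \<noteq> z0 \<longrightarrow> dist z0 c < dist y c)"
      using \<open>z_root z0\<close> far by blast
    show "x = z0" if "z_root x \<and> (\<forall>y. z_root y \<and> y \<noteq> x \<longrightarrow> dist x c < dist y c)" for x
      using that far[of x] \<open>z_root z0\<close> by (metis less_asym)
  qed
qed

section \<open>The table of W in normalised form\<close>

text \<open>A unitary rescaling of the edges that removes \<open>z\<close> from all cells except those of the triangle 5, 6, 7. The relations are invariant under such rescalings.\<close>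

definition gauge :: "edge \<Rightarrow> complex" where
  "gauge e = (if e = Edge 2 6 then cnj z0 else if e = Edge 5 6 then \<i> * cnj z0
     else if e \<in> {Edge 3 6, Edge 3 10, Edge 4 10, Edge 5 8, Edge 5 10} then z0 else 1)"

lemma gauge_cnj: "gauge e * cnj (gauge e) = 1"
proof -
  have "\<i> * cnj z0 * (- \<i> * z0) = - (\<i> * \<i>) * (cnj z0 * z0)"
    by (simp only: mult_ac mult_minus_left mult_minus_right)
  then show ?thesis
    by (auto simp: gauge_def z0_cnj)
qed

lemma cos_sin_pi8: "cos (pi / 8) = rf / 2" "sin (pi / 8) = rf * (s2 - 1) / 2"
proof -
  have pos: "cos (pi / 8) > 0" "sin (pi / 8) > 0"
    by (auto intro: cos_gt_zero_pi sin_gt_zero)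
  have double: "cos (2 * (pi / 8)) = s2 / 2"
    by (simp add: cos_45 s2_def)
  have "(cos (pi / 8))\<^sup>2 = (rf / 2)\<^sup>2"
    using double unfolding cos_double_cos by (simp add: power2_eq_square radical_simps)
  then show "cos (pi / 8) = rf / 2"
    using pos by (simp add: power2_eq_iff_nonneg less_imp_le)
  have "s2 - 1 > 0" using radical_bounds(1) by simp
  have "(sin (pi / 8))\<^sup>2 = (rf * (s2 - 1) / 2)\<^sup>2"
    using double unfolding cos_double_sin by (simp add: power2_eq_square algebra_simps radical_simps)
  then show "sin (pi / 8) = rf * (s2 - 1) / 2"
    using pos \<open>s2 - 1 > 0\<close> by (simp add: power2_eq_iff_nonneg less_imp_le)
qed

lemma zeta_cis: "zeta l ^ n = cis (2 * pi * real n / real l)"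
proof -
  have "zeta l = cis (2 * pi / real l)"
    by (simp add: zeta_def cis_conv_exp mult_ac)
  then show ?thesis by (simp add: DeMoivre mult_ac)
qed

lemma cis_values: "cis (pi / 3) = Complex (1 / 2) (s3 / 2)" "cis (pi / 4) = Complex (s2 / 2) (s2 / 2)"
  "cis (pi / 8) = Complex (rf / 2) (rf * (s2 - 1) / 2)" "cis (pi / 2) = Complex 0 1" "cis pi = Complex (- 1) 0"
  by (simp_all add: complex_eq_iff cos_60 sin_60 cos_45 sin_45 cos_sin_pi8 s2_def s3_def)

lemma zeta_values:
  "zeta 3 = Complex (- 1 / 2) (s3 / 2)"
  "zeta 8 = Complex (s2 / 2) (s2 / 2)"
  "zeta 8 ^ 5 = Complex (- s2 / 2) (- s2 / 2)"
  "zeta 24 ^ 19 = Complex (s2 * (s3 - 1) / 4) (- s2 * (1 + s3) / 4)"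
  "zeta 48 ^ 11 = Complex (1 / 2) (s3 / 2) * Complex (rf / 2) (rf * (s2 - 1) / 2)"
proof -
  have a: "2 * pi * real 1 / real 3 = pi / 3 + pi / 3" "2 * pi * real 1 / real 8 = pi / 4"
    "2 * pi * real 5 / real 8 = pi + pi / 4" "2 * pi * real 19 / real 24 = pi + (pi / 3 + pi / 4)"
    "2 * pi * real 11 / real 48 = pi / 3 + pi / 8"
    by simp_all
  show "zeta 3 = Complex (- 1 / 2) (s3 / 2)" "zeta 8 = Complex (s2 / 2) (s2 / 2)"
  proof -
    have "zeta 3 = cis (pi / 3 + pi / 3)" "zeta 8 = cis (pi / 4)"
      using zeta_cis[of 3 1] zeta_cis[of 8 1] by simp_all
    then show "zeta 3 = Complex (- 1 / 2) (s3 / 2)" "zeta 8 = Complex (s2 / 2) (s2 / 2)"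
      by (simp_all only: cis_mult[symmetric] cis_values complex_mult) (simp_all add: radical_simps)
  qed
  show "zeta 8 ^ 5 = Complex (- s2 / 2) (- s2 / 2)"
    "zeta 24 ^ 19 = Complex (s2 * (s3 - 1) / 4) (- s2 * (1 + s3) / 4)"
    "zeta 48 ^ 11 = Complex (1 / 2) (s3 / 2) * Complex (rf / 2) (rf * (s2 - 1) / 2)"
    unfolding zeta_cis a
    by (simp_all only: cis_mult[symmetric] cis_values complex_mult)
      (simp_all add: algebra_simps add_divide_distrib diff_divide_distrib)
qed

lemma inverse_zW: "inverse zW = cnj z0"
  unfolding zW_eq using z0_cnj(1) by (rule inverse_unique)

lemma mu_pos: "v \<in> {1..11} \<Longrightarrow> mu v > 0"
proof -
  have "s3 - 1 > 0" using radical_bounds(3) by simp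
  moreover assume "v \<in> {1..11}"
  then have "v \<in> {1, 2, 3, 4, 5, 6, 7, 8, 9, 10, 11}" by (simp, presburger)
  ultimately show ?thesis by (auto simp: mu_values add_pos_pos simp del: One_nat_def)
qed

lemma mu_imu: "v \<in> {1..11} \<Longrightarrow> mu v * imu v = 1"
proof -
  assume "v \<in> {1..11}"
  then have "v \<in> {1, 2, 3, 4, 5, 6, 7, 8, 9, 10, 11}" by (simp, presburger)
  then show ?thesis
    by (auto simp: mu_values imu_values algebra_simps radical_simps simp del: One_nat_def)
qed

lemma lam_mu: "v \<in> {1..11} \<Longrightarrow> lam v = (1 + s3) / 2 * mu v"
proof -
  assume "v \<in> {1..11}"
  then have v: "v \<in> {1, 2, 3, 4, 5, 6, 7, 8, 9, 10, 11}" by (simp, presburger)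
  have pos: "1 + s3 > 0" by (simp add: add_pos_pos)
  have div: "x / (1 + s3) = x * (s3 - 1) / 2" for x
    using pos by (simp add: divide_eq_eq) (simp add: algebra_simps radical_simps)
  show ?thesis
    using v by (auto simp: lam_def mu_values rqint_values div simp del: One_nat_def)
      (simp_all add: algebra_simps radical_simps add_divide_distrib diff_divide_distrib)
qed

text \<open>The square roots of the table.\<close>

text \<open>Compares an entry of the table with the normalised absolute value \<open>y\<close> by squaring.\<close>

lemma rsqrt_eq:
  assumes "num = s2 * (y * y) * (imu v * imu w) * den" "den > 0" "y \<ge> 0" "v \<in> {1..11}" "w \<in> {1..11}"
  shows "rsqrt (num / den) = of_real (sqrt s2 * y / (sqrt (mu v) * sqrt (mu w)))"
proof -
  have "imu v = 1 / mu v" "imu w = 1 / mu w"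
    using mu_imu[OF assms(4)] mu_imu[OF assms(5)] mu_pos[OF assms(4)] mu_pos[OF assms(5)]
    by (simp_all add: field_simps)
  then have "num / den = s2 * (y * y) / (mu v * mu w)"
    using assms(1,2) by simp
  then show ?thesis
    using assms(3) by (simp add: rsqrt_def real_sqrt_mult real_sqrt_divide)
qed

definition normalised :: "edge \<Rightarrow> edge \<Rightarrow> complex" where
  "normalised a b = of_real (sqrt s2 / (sqrt (mu (edge_tail a)) * sqrt (mu (edge_head b)))) * gauge a * t_start a b"

lemma normalisedI:
  assumes "w = ph * of_real (sqrt s2 * y / (sqrt (mu (edge_tail a)) * sqrt (mu (edge_head b))))"
    and "ph * of_real y = gauge a * t_start a b"
  shows "w = normalised a b"
proof -
  have "w = of_real (sqrt s2 / (sqrt (mu (edge_tail a)) * sqrt (mu (edge_head b)))) * (ph * of_real y)"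
    unfolding assms(1) by (simp add: mult_ac)
  then show ?thesis unfolding assms(2) normalised_def by (simp add: mult.assoc)
qed

lemmas table_simps = rqint_values imu_values algebra_simps radical_simps add_pos_pos power2_eq_square
  add_divide_distrib diff_divide_distrib

lemma z0_phase: "z0 * (cnj z0 * x) = x" "cnj z0 * (z0 * x) = x"
  by (simp_all add: mult.assoc[symmetric] z0_cnj)

text \<open>The entries at 2, \<open>\<beta>\<close>, at 5, \<open>\<beta>\<close> and at 5, 6, 7 depend on the value of \<open>z\<close>; all others only need its modulus.\<close>

lemma W_start_values:
  "W_start (Edge 1 6) Beta = normalised (Edge 1 6) Beta"
  "W_start (Edge 1 6) Alpha = normalised (Edge 1 6) Alpha"
  "W_start (Edge 2 6) Alpha = normalised (Edge 2 6) Alpha"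
  "W_start (Edge 2 6) Beta = normalised (Edge 2 6) Beta"
  "W_start (Edge 3 6) Alpha = normalised (Edge 3 6) Alpha"
  "W_start (Edge 3 6) Beta = normalised (Edge 3 6) Beta"
  "W_start (Edge 4 6) Alpha = normalised (Edge 4 6) Alpha"
  "W_start (Edge 4 6) Beta = normalised (Edge 4 6) Beta"
  "W_start (Edge 5 6) Alpha = normalised (Edge 5 6) Alpha"
  "W_start (Edge 5 6) Beta = normalised (Edge 5 6) Beta"
  "W_start (Edge 3 6) (Edge 6 7) = normalised (Edge 3 6) (Edge 6 7)"
  "W_start (Edge 3 10) (Edge 10 7) = normalised (Edge 3 10) (Edge 10 7)"
  "W_start (Edge 3 10) (Edge 10 9) = normalised (Edge 3 10) (Edge 10 9)"
  "W_start (Edge 4 6) (Edge 6 7) = normalised (Edge 4 6) (Edge 6 7)"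
  "W_start (Edge 4 10) (Edge 10 7) = normalised (Edge 4 10) (Edge 10 7)"
  "W_start (Edge 4 10) (Edge 10 9) = normalised (Edge 4 10) (Edge 10 9)"
  "W_start (Edge 5 6) (Edge 6 7) = normalised (Edge 5 6) (Edge 6 7)"
  "W_start (Edge 5 8) (Edge 8 7) = normalised (Edge 5 8) (Edge 8 7)"
  "W_start (Edge 5 10) (Edge 10 7) = normalised (Edge 5 10) (Edge 10 7)"
  "W_start (Edge 5 10) (Edge 10 9) = normalised (Edge 5 10) (Edge 10 9)"
  "W_start (Edge 5 10) (Edge 10 11) = normalised (Edge 5 10) (Edge 10 11)"
proof -
  have W: "W_start (Edge 1 6) Beta = 0" "t_start (Edge 1 6) Beta = 0"
    by (simp_all add: W_start_def W_table_def Let_def t_start_values del: One_nat_def)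
  show "W_start (Edge 1 6) Beta = normalised (Edge 1 6) Beta"
    by (simp add: W normalised_def del: One_nat_def)
  show "W_start (Edge 1 6) Alpha = normalised (Edge 1 6) Alpha"
  proof (rule normalisedI[where ph = "1" and y = "s2 * (1 + s3) / 2"])
    have "rsqrt (rqint 2 / 1) = of_real (sqrt s2 * (s2 * (1 + s3) / 2) / (sqrt (mu 1) * sqrt (mu 9)))"
    proof (rule rsqrt_eq)
      show "rqint 2 = s2 * ((s2 * (1 + s3) / 2) * (s2 * (1 + s3) / 2)) * (imu 1 * imu 9) * (1)"
        by (simp add: table_simps del: One_nat_def)
      show "(0 :: real) < 1" by (simp add: rqint_values add_pos_pos)
      show "(0 :: real) \<le> s2 * (1 + s3) / 2" by simp
    qed simp_all
    then show "W_start (Edge 1 6) Alpha = 1 * of_real (sqrt s2 * (s2 * (1 + s3) / 2) / (sqrt (mu (edge_tail (Edge 1 6))) * sqrt (mu (edge_head Alpha))))"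
      by (simp add: W_start_def W_table_def Let_def zW_eq inverse_zW[unfolded zW_eq] mult.assoc del: One_nat_def)
    show "1 * of_real (s2 * (1 + s3) / 2) = gauge (Edge 1 6) * t_start (Edge 1 6) Alpha"
      by (simp add: gauge_def t_start_values zeta_values(1,3,4,5) complex_of_real_def complex_mult complex_cnj z0_phase algebra_simps del: One_nat_def)
  qed
  show "W_start (Edge 2 6) Alpha = normalised (Edge 2 6) Alpha"
  proof (rule normalisedI[where ph = "cnj z0" and y = "1"])
    have "rsqrt (1 / rqint 2) = of_real (sqrt s2 * (1) / (sqrt (mu 2) * sqrt (mu 9)))"
    proof (rule rsqrt_eq)
      show "1 = s2 * ((1) * (1)) * (imu 2 * imu 9) * (rqint 2)"
        by (simp add: table_simps del: One_nat_def)
      show "(0 :: real) < rqint 2" by (simp add: rqint_values add_pos_pos)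
      show "(0 :: real) \<le> 1" by simp
    qed simp_all
    then show "W_start (Edge 2 6) Alpha = cnj z0 * of_real (sqrt s2 * (1) / (sqrt (mu (edge_tail (Edge 2 6))) * sqrt (mu (edge_head Alpha))))"
      by (simp add: W_start_def W_table_def Let_def zW_eq inverse_zW[unfolded zW_eq] mult.assoc del: One_nat_def)
    show "cnj z0 * of_real (1) = gauge (Edge 2 6) * t_start (Edge 2 6) Alpha"
      by (simp add: gauge_def t_start_values zeta_values(1,3,4,5) complex_of_real_def complex_mult complex_cnj z0_phase algebra_simps del: One_nat_def)
  qed
  show "W_start (Edge 2 6) Beta = normalised (Edge 2 6) Beta"
  proof (rule normalisedI[where ph = "zeta 24 ^ 19" and y = "b3"])
    have "rsqrt (rqint 3 / rqint 2) = of_real (sqrt s2 * (b3) / (sqrt (mu 2) * sqrt (mu 9)))"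
    proof (rule rsqrt_eq)
      show "rqint 3 = s2 * ((b3) * (b3)) * (imu 2 * imu 9) * (rqint 2)"
        by (simp add: table_simps del: One_nat_def)
      show "(0 :: real) < rqint 2" by (simp add: rqint_values add_pos_pos)
      show "(0 :: real) \<le> b3" by simp
    qed simp_all
    then show "W_start (Edge 2 6) Beta = zeta 24 ^ 19 * of_real (sqrt s2 * (b3) / (sqrt (mu (edge_tail (Edge 2 6))) * sqrt (mu (edge_head Beta))))"
      by (simp add: W_start_def W_table_def Let_def zW_eq inverse_zW[unfolded zW_eq] mult.assoc del: One_nat_def)
    show "zeta 24 ^ 19 * of_real (b3) = gauge (Edge 2 6) * t_start (Edge 2 6) Beta"
      by (simp add: gauge_def t_start_values zeta_values(4,5) z0_def complex_eq_iff, simp add: algebra_simps radical_simps add_divide_distrib diff_divide_distrib)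
  qed
  show "W_start (Edge 3 6) Alpha = normalised (Edge 3 6) Alpha"
  proof (rule normalisedI[where ph = "z0" and y = "r4"])
    have "rsqrt (1 / rqint 2) = of_real (sqrt s2 * (r4) / (sqrt (mu 3) * sqrt (mu 9)))"
    proof (rule rsqrt_eq)
      show "1 = s2 * ((r4) * (r4)) * (imu 3 * imu 9) * (rqint 2)"
        by (simp add: table_simps del: One_nat_def)
      show "(0 :: real) < rqint 2" by (simp add: rqint_values add_pos_pos)
      show "(0 :: real) \<le> r4" by simp
    qed simp_all
    then show "W_start (Edge 3 6) Alpha = z0 * of_real (sqrt s2 * (r4) / (sqrt (mu (edge_tail (Edge 3 6))) * sqrt (mu (edge_head Alpha))))"
      by (simp add: W_start_def W_table_def Let_def zW_eq inverse_zW[unfolded zW_eq] mult.assoc del: One_nat_def)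
    show "z0 * of_real (r4) = gauge (Edge 3 6) * t_start (Edge 3 6) Alpha"
      by (simp add: gauge_def t_start_values zeta_values(1,3,4,5) complex_of_real_def complex_mult complex_cnj z0_phase algebra_simps del: One_nat_def)
  qed
  show "W_start (Edge 3 6) Beta = normalised (Edge 3 6) Beta"
  proof (rule normalisedI[where ph = "zeta 3 * z0" and y = "rf * (s2 - 1)"])
    have "rsqrt (rqint 3 / (rqint 4 * (rqint 2 + rqint 3))) = of_real (sqrt s2 * (rf * (s2 - 1)) / (sqrt (mu 3) * sqrt (mu 9)))"
    proof (rule rsqrt_eq)
      show "rqint 3 = s2 * ((rf * (s2 - 1)) * (rf * (s2 - 1))) * (imu 3 * imu 9) * ((rqint 4 * (rqint 2 + rqint 3)))"
        by (simp add: table_simps del: One_nat_def)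
      show "(0 :: real) < (rqint 4 * (rqint 2 + rqint 3))" by (simp add: rqint_values add_pos_pos)
      show "(0 :: real) \<le> rf * (s2 - 1)" by simp
    qed simp_all
    then show "W_start (Edge 3 6) Beta = zeta 3 * z0 * of_real (sqrt s2 * (rf * (s2 - 1)) / (sqrt (mu (edge_tail (Edge 3 6))) * sqrt (mu (edge_head Beta))))"
      by (simp add: W_start_def W_table_def Let_def zW_eq inverse_zW[unfolded zW_eq] mult.assoc del: One_nat_def)
    show "zeta 3 * z0 * of_real (rf * (s2 - 1)) = gauge (Edge 3 6) * t_start (Edge 3 6) Beta"
      by (simp add: gauge_def t_start_values zeta_values(1,3,4,5) complex_of_real_def complex_mult complex_cnj z0_phase algebra_simps del: One_nat_def)
  qed
  show "W_start (Edge 4 6) Alpha = normalised (Edge 4 6) Alpha"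
  proof (rule normalisedI[where ph = "1" and y = "r4"])
    have "rsqrt (1 / rqint 2) = of_real (sqrt s2 * (r4) / (sqrt (mu 4) * sqrt (mu 9)))"
    proof (rule rsqrt_eq)
      show "1 = s2 * ((r4) * (r4)) * (imu 4 * imu 9) * (rqint 2)"
        by (simp add: table_simps del: One_nat_def)
      show "(0 :: real) < rqint 2" by (simp add: rqint_values add_pos_pos)
      show "(0 :: real) \<le> r4" by simp
    qed simp_all
    then show "W_start (Edge 4 6) Alpha = 1 * of_real (sqrt s2 * (r4) / (sqrt (mu (edge_tail (Edge 4 6))) * sqrt (mu (edge_head Alpha))))"
      by (simp add: W_start_def W_table_def Let_def zW_eq inverse_zW[unfolded zW_eq] mult.assoc del: One_nat_def)
    show "1 * of_real (r4) = gauge (Edge 4 6) * t_start (Edge 4 6) Alpha"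
      by (simp add: gauge_def t_start_values zeta_values(1,3,4,5) complex_of_real_def complex_mult complex_cnj z0_phase algebra_simps del: One_nat_def)
  qed
  show "W_start (Edge 4 6) Beta = normalised (Edge 4 6) Beta"
  proof (rule normalisedI[where ph = "zeta 8 ^ 5" and y = "rf"])
    have "rsqrt (rqint 3 * (rqint 2 + rqint 3) / (rqint 4 * rqint 5)) = of_real (sqrt s2 * (rf) / (sqrt (mu 4) * sqrt (mu 9)))"
    proof (rule rsqrt_eq)
      show "rqint 3 * (rqint 2 + rqint 3) = s2 * ((rf) * (rf)) * (imu 4 * imu 9) * ((rqint 4 * rqint 5))"
        by (simp add: table_simps del: One_nat_def)
      show "(0 :: real) < (rqint 4 * rqint 5)" by (simp add: rqint_values add_pos_pos)
      show "(0 :: real) \<le> rf" by simp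
    qed simp_all
    then show "W_start (Edge 4 6) Beta = zeta 8 ^ 5 * of_real (sqrt s2 * (rf) / (sqrt (mu (edge_tail (Edge 4 6))) * sqrt (mu (edge_head Beta))))"
      by (simp add: W_start_def W_table_def Let_def zW_eq inverse_zW[unfolded zW_eq] mult.assoc del: One_nat_def)
    show "zeta 8 ^ 5 * of_real (rf) = gauge (Edge 4 6) * t_start (Edge 4 6) Beta"
      by (simp add: gauge_def t_start_values zeta_values(1,3,4,5) complex_of_real_def complex_mult complex_cnj z0_phase algebra_simps del: One_nat_def)
  qed
  show "W_start (Edge 5 6) Alpha = normalised (Edge 5 6) Alpha"
  proof (rule normalisedI[where ph = "\<i> * cnj z0" and y = "s2"])
    have "rsqrt (1 / rqint 2) = of_real (sqrt s2 * (s2) / (sqrt (mu 5) * sqrt (mu 9)))"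
    proof (rule rsqrt_eq)
      show "1 = s2 * ((s2) * (s2)) * (imu 5 * imu 9) * (rqint 2)"
        by (simp add: table_simps del: One_nat_def)
      show "(0 :: real) < rqint 2" by (simp add: rqint_values add_pos_pos)
      show "(0 :: real) \<le> s2" by simp
    qed simp_all
    then show "W_start (Edge 5 6) Alpha = \<i> * cnj z0 * of_real (sqrt s2 * (s2) / (sqrt (mu (edge_tail (Edge 5 6))) * sqrt (mu (edge_head Alpha))))"
      by (simp add: W_start_def W_table_def Let_def zW_eq inverse_zW[unfolded zW_eq] mult.assoc del: One_nat_def)
    show "\<i> * cnj z0 * of_real (s2) = gauge (Edge 5 6) * t_start (Edge 5 6) Alpha"
      by (simp add: gauge_def t_start_values zeta_values(1,3,4,5) complex_of_real_def complex_mult complex_cnj z0_phase algebra_simps del: One_nat_def)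
  qed
  show "W_start (Edge 5 6) Beta = normalised (Edge 5 6) Beta"
  proof (rule normalisedI[where ph = "zeta 48 ^ 11 * z0" and y = "s2 * r4"])
    have "rsqrt (rqint 4 / rqint 5) = of_real (sqrt s2 * (s2 * r4) / (sqrt (mu 5) * sqrt (mu 9)))"
    proof (rule rsqrt_eq)
      show "rqint 4 = s2 * ((s2 * r4) * (s2 * r4)) * (imu 5 * imu 9) * (rqint 5)"
        by (simp add: table_simps del: One_nat_def)
      show "(0 :: real) < rqint 5" by (simp add: rqint_values add_pos_pos)
      show "(0 :: real) \<le> s2 * r4" by simp
    qed simp_all
    then show "W_start (Edge 5 6) Beta = zeta 48 ^ 11 * z0 * of_real (sqrt s2 * (s2 * r4) / (sqrt (mu (edge_tail (Edge 5 6))) * sqrt (mu (edge_head Beta))))"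
      by (simp add: W_start_def W_table_def Let_def zW_eq inverse_zW[unfolded zW_eq] mult.assoc del: One_nat_def)
    show "zeta 48 ^ 11 * z0 * of_real (s2 * r4) = gauge (Edge 5 6) * t_start (Edge 5 6) Beta"
      by (simp add: gauge_def t_start_values zeta_values(4,5) z0_def complex_eq_iff, simp add: algebra_simps radical_simps add_divide_distrib diff_divide_distrib)
  qed
  show "W_start (Edge 3 6) (Edge 6 7) = normalised (Edge 3 6) (Edge 6 7)"
  proof (rule normalisedI[where ph = "z0" and y = "ra"])
    have "rsqrt (rqint 2 * (1 + rqint 2) / rqint 4) = of_real (sqrt s2 * (ra) / (sqrt (mu 3) * sqrt (mu 7)))"
    proof (rule rsqrt_eq)
      show "rqint 2 * (1 + rqint 2) = s2 * ((ra) * (ra)) * (imu 3 * imu 7) * (rqint 4)"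
        by (simp add: table_simps del: One_nat_def)
      show "(0 :: real) < rqint 4" by (simp add: rqint_values add_pos_pos)
      show "(0 :: real) \<le> ra" by simp
    qed simp_all
    then show "W_start (Edge 3 6) (Edge 6 7) = z0 * of_real (sqrt s2 * (ra) / (sqrt (mu (edge_tail (Edge 3 6))) * sqrt (mu (edge_head (Edge 6 7)))))"
      by (simp add: W_start_def W_table_def Let_def zW_eq inverse_zW[unfolded zW_eq] mult.assoc del: One_nat_def)
    show "z0 * of_real (ra) = gauge (Edge 3 6) * t_start (Edge 3 6) (Edge 6 7)"
      by (simp add: gauge_def t_start_values zeta_values(1,3,4,5) complex_of_real_def complex_mult complex_cnj z0_phase algebra_simps del: One_nat_def)
  qed
  show "W_start (Edge 3 10) (Edge 10 7) = normalised (Edge 3 10) (Edge 10 7)"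
  proof (rule normalisedI[where ph = "z0" and y = "rf * (s2 - 1)"])
    have "rsqrt ((rqint 2)\<^sup>2 / (rqint 4 * (rqint 2 + rqint 3))) = of_real (sqrt s2 * (rf * (s2 - 1)) / (sqrt (mu 3) * sqrt (mu 7)))"
    proof (rule rsqrt_eq)
      show "(rqint 2)\<^sup>2 = s2 * ((rf * (s2 - 1)) * (rf * (s2 - 1))) * (imu 3 * imu 7) * ((rqint 4 * (rqint 2 + rqint 3)))"
        by (simp add: table_simps del: One_nat_def)
      show "(0 :: real) < (rqint 4 * (rqint 2 + rqint 3))" by (simp add: rqint_values add_pos_pos)
      show "(0 :: real) \<le> rf * (s2 - 1)" by simp
    qed simp_all
    then show "W_start (Edge 3 10) (Edge 10 7) = z0 * of_real (sqrt s2 * (rf * (s2 - 1)) / (sqrt (mu (edge_tail (Edge 3 10))) * sqrt (mu (edge_head (Edge 10 7)))))"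
      by (simp add: W_start_def W_table_def Let_def zW_eq inverse_zW[unfolded zW_eq] mult.assoc del: One_nat_def)
    show "z0 * of_real (rf * (s2 - 1)) = gauge (Edge 3 10) * t_start (Edge 3 10) (Edge 10 7)"
      by (simp add: gauge_def t_start_values zeta_values(1,3,4,5) complex_of_real_def complex_mult complex_cnj z0_phase algebra_simps del: One_nat_def)
  qed
  show "W_start (Edge 3 10) (Edge 10 9) = normalised (Edge 3 10) (Edge 10 9)"
  proof (rule normalisedI[where ph = "z0" and y = "ra"])
    have "rsqrt (rqint 3 * (1 + rqint 2) / (rqint 2 * rqint 4)) = of_real (sqrt s2 * (ra) / (sqrt (mu 3) * sqrt (mu 9)))"
    proof (rule rsqrt_eq)
      show "rqint 3 * (1 + rqint 2) = s2 * ((ra) * (ra)) * (imu 3 * imu 9) * ((rqint 2 * rqint 4))"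
        by (simp add: table_simps del: One_nat_def)
      show "(0 :: real) < (rqint 2 * rqint 4)" by (simp add: rqint_values add_pos_pos)
      show "(0 :: real) \<le> ra" by simp
    qed simp_all
    then show "W_start (Edge 3 10) (Edge 10 9) = z0 * of_real (sqrt s2 * (ra) / (sqrt (mu (edge_tail (Edge 3 10))) * sqrt (mu (edge_head (Edge 10 9)))))"
      by (simp add: W_start_def W_table_def Let_def zW_eq inverse_zW[unfolded zW_eq] mult.assoc del: One_nat_def)
    show "z0 * of_real (ra) = gauge (Edge 3 10) * t_start (Edge 3 10) (Edge 10 9)"
      by (simp add: gauge_def t_start_values zeta_values(1,3,4,5) complex_of_real_def complex_mult complex_cnj z0_phase algebra_simps del: One_nat_def)
  qed
  show "W_start (Edge 4 6) (Edge 6 7) = normalised (Edge 4 6) (Edge 6 7)"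
  proof (rule normalisedI[where ph = "zeta 8 ^ 5" and y = "rb"])
    have "rsqrt (rqint 2 * rqint 3 / (rqint 4 * (1 + rqint 2))) = of_real (sqrt s2 * (rb) / (sqrt (mu 4) * sqrt (mu 7)))"
    proof (rule rsqrt_eq)
      show "rqint 2 * rqint 3 = s2 * ((rb) * (rb)) * (imu 4 * imu 7) * ((rqint 4 * (1 + rqint 2)))"
        by (simp add: table_simps del: One_nat_def)
      show "(0 :: real) < (rqint 4 * (1 + rqint 2))" by (simp add: rqint_values add_pos_pos)
      show "(0 :: real) \<le> rb" by simp
    qed simp_all
    then show "W_start (Edge 4 6) (Edge 6 7) = zeta 8 ^ 5 * of_real (sqrt s2 * (rb) / (sqrt (mu (edge_tail (Edge 4 6))) * sqrt (mu (edge_head (Edge 6 7)))))"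
      by (simp add: W_start_def W_table_def Let_def zW_eq inverse_zW[unfolded zW_eq] mult.assoc del: One_nat_def)
    show "zeta 8 ^ 5 * of_real (rb) = gauge (Edge 4 6) * t_start (Edge 4 6) (Edge 6 7)"
      by (simp add: gauge_def t_start_values zeta_values(1,3,4,5) complex_of_real_def complex_mult complex_cnj z0_phase algebra_simps del: One_nat_def)
  qed
  show "W_start (Edge 4 10) (Edge 10 7) = normalised (Edge 4 10) (Edge 10 7)"
  proof (rule normalisedI[where ph = "z0" and y = "rf"])
    have "rsqrt ((rqint 2 + rqint 3) / rqint 4) = of_real (sqrt s2 * (rf) / (sqrt (mu 4) * sqrt (mu 7)))"
    proof (rule rsqrt_eq)
      show "(rqint 2 + rqint 3) = s2 * ((rf) * (rf)) * (imu 4 * imu 7) * (rqint 4)"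
        by (simp add: table_simps del: One_nat_def)
      show "(0 :: real) < rqint 4" by (simp add: rqint_values add_pos_pos)
      show "(0 :: real) \<le> rf" by simp
    qed simp_all
    then show "W_start (Edge 4 10) (Edge 10 7) = z0 * of_real (sqrt s2 * (rf) / (sqrt (mu (edge_tail (Edge 4 10))) * sqrt (mu (edge_head (Edge 10 7)))))"
      by (simp add: W_start_def W_table_def Let_def zW_eq inverse_zW[unfolded zW_eq] mult.assoc del: One_nat_def)
    show "z0 * of_real (rf) = gauge (Edge 4 10) * t_start (Edge 4 10) (Edge 10 7)"
      by (simp add: gauge_def t_start_values zeta_values(1,3,4,5) complex_of_real_def complex_mult complex_cnj z0_phase algebra_simps del: One_nat_def)
  qed
  show "W_start (Edge 4 10) (Edge 10 9) = normalised (Edge 4 10) (Edge 10 9)"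
  proof (rule normalisedI[where ph = "z0" and y = "rb"])
    have "rsqrt ((rqint 3)\<^sup>2 / (rqint 2 * rqint 4 * (1 + rqint 2))) = of_real (sqrt s2 * (rb) / (sqrt (mu 4) * sqrt (mu 9)))"
    proof (rule rsqrt_eq)
      show "(rqint 3)\<^sup>2 = s2 * ((rb) * (rb)) * (imu 4 * imu 9) * ((rqint 2 * rqint 4 * (1 + rqint 2)))"
        by (simp add: table_simps del: One_nat_def)
      show "(0 :: real) < (rqint 2 * rqint 4 * (1 + rqint 2))" by (simp add: rqint_values add_pos_pos)
      show "(0 :: real) \<le> rb" by simp
    qed simp_all
    then show "W_start (Edge 4 10) (Edge 10 9) = z0 * of_real (sqrt s2 * (rb) / (sqrt (mu (edge_tail (Edge 4 10))) * sqrt (mu (edge_head (Edge 10 9)))))"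
      by (simp add: W_start_def W_table_def Let_def zW_eq inverse_zW[unfolded zW_eq] mult.assoc del: One_nat_def)
    show "z0 * of_real (rb) = gauge (Edge 4 10) * t_start (Edge 4 10) (Edge 10 9)"
      by (simp add: gauge_def t_start_values zeta_values(1,3,4,5) complex_of_real_def complex_mult complex_cnj z0_phase algebra_simps del: One_nat_def)
  qed
  show "W_start (Edge 5 6) (Edge 6 7) = normalised (Edge 5 6) (Edge 6 7)"
  proof (rule normalisedI[where ph = "zeta 8" and y = "s2"])
    have "rsqrt (rqint 2 / rqint 3) = of_real (sqrt s2 * (s2) / (sqrt (mu 5) * sqrt (mu 7)))"
    proof (rule rsqrt_eq)
      show "rqint 2 = s2 * ((s2) * (s2)) * (imu 5 * imu 7) * (rqint 3)"
        by (simp add: table_simps del: One_nat_def)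
      show "(0 :: real) < rqint 3" by (simp add: rqint_values add_pos_pos)
      show "(0 :: real) \<le> s2" by simp
    qed simp_all
    then show "W_start (Edge 5 6) (Edge 6 7) = zeta 8 * of_real (sqrt s2 * (s2) / (sqrt (mu (edge_tail (Edge 5 6))) * sqrt (mu (edge_head (Edge 6 7)))))"
      by (simp add: W_start_def W_table_def Let_def zW_eq inverse_zW[unfolded zW_eq] mult.assoc del: One_nat_def)
    show "zeta 8 * of_real (s2) = gauge (Edge 5 6) * t_start (Edge 5 6) (Edge 6 7)"
      by (simp add: gauge_def t_start_values zeta_values(2) z0_def complex_eq_iff, simp add: algebra_simps radical_simps add_divide_distrib diff_divide_distrib)
  qed
  show "W_start (Edge 5 8) (Edge 8 7) = normalised (Edge 5 8) (Edge 8 7)"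
  proof (rule normalisedI[where ph = "z0" and y = "s2"])
    have "rsqrt (rqint 2 / rqint 3) = of_real (sqrt s2 * (s2) / (sqrt (mu 5) * sqrt (mu 7)))"
    proof (rule rsqrt_eq)
      show "rqint 2 = s2 * ((s2) * (s2)) * (imu 5 * imu 7) * (rqint 3)"
        by (simp add: table_simps del: One_nat_def)
      show "(0 :: real) < rqint 3" by (simp add: rqint_values add_pos_pos)
      show "(0 :: real) \<le> s2" by simp
    qed simp_all
    then show "W_start (Edge 5 8) (Edge 8 7) = z0 * of_real (sqrt s2 * (s2) / (sqrt (mu (edge_tail (Edge 5 8))) * sqrt (mu (edge_head (Edge 8 7)))))"
      by (simp add: W_start_def W_table_def Let_def zW_eq inverse_zW[unfolded zW_eq] mult.assoc del: One_nat_def)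
    show "z0 * of_real (s2) = gauge (Edge 5 8) * t_start (Edge 5 8) (Edge 8 7)"
      by (simp add: gauge_def t_start_values zeta_values(1,3,4,5) complex_of_real_def complex_mult complex_cnj z0_phase algebra_simps del: One_nat_def)
  qed
  show "W_start (Edge 5 10) (Edge 10 7) = normalised (Edge 5 10) (Edge 10 7)"
  proof (rule normalisedI[where ph = "z0" and y = "b3 * (s3 - 1)"])
    have "rsqrt (1 / rqint 2) = of_real (sqrt s2 * (b3 * (s3 - 1)) / (sqrt (mu 5) * sqrt (mu 7)))"
    proof (rule rsqrt_eq)
      show "1 = s2 * ((b3 * (s3 - 1)) * (b3 * (s3 - 1))) * (imu 5 * imu 7) * (rqint 2)"
        by (simp add: table_simps del: One_nat_def)
      show "(0 :: real) < rqint 2" by (simp add: rqint_values add_pos_pos)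
      show "(0 :: real) \<le> b3 * (s3 - 1)" by simp
    qed simp_all
    then show "W_start (Edge 5 10) (Edge 10 7) = z0 * of_real (sqrt s2 * (b3 * (s3 - 1)) / (sqrt (mu (edge_tail (Edge 5 10))) * sqrt (mu (edge_head (Edge 10 7)))))"
      by (simp add: W_start_def W_table_def Let_def zW_eq inverse_zW[unfolded zW_eq] mult.assoc del: One_nat_def)
    show "z0 * of_real (b3 * (s3 - 1)) = gauge (Edge 5 10) * t_start (Edge 5 10) (Edge 10 7)"
      by (simp add: gauge_def t_start_values zeta_values(1,3,4,5) complex_of_real_def complex_mult complex_cnj z0_phase algebra_simps del: One_nat_def)
  qed
  show "W_start (Edge 5 10) (Edge 10 9) = normalised (Edge 5 10) (Edge 10 9)"
  proof (rule normalisedI[where ph = "z0" and y = "s2"])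
    have "rsqrt (1 / rqint 2) = of_real (sqrt s2 * (s2) / (sqrt (mu 5) * sqrt (mu 9)))"
    proof (rule rsqrt_eq)
      show "1 = s2 * ((s2) * (s2)) * (imu 5 * imu 9) * (rqint 2)"
        by (simp add: table_simps del: One_nat_def)
      show "(0 :: real) < rqint 2" by (simp add: rqint_values add_pos_pos)
      show "(0 :: real) \<le> s2" by simp
    qed simp_all
    then show "W_start (Edge 5 10) (Edge 10 9) = z0 * of_real (sqrt s2 * (s2) / (sqrt (mu (edge_tail (Edge 5 10))) * sqrt (mu (edge_head (Edge 10 9)))))"
      by (simp add: W_start_def W_table_def Let_def zW_eq inverse_zW[unfolded zW_eq] mult.assoc del: One_nat_def)
    show "z0 * of_real (s2) = gauge (Edge 5 10) * t_start (Edge 5 10) (Edge 10 9)"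
      by (simp add: gauge_def t_start_values zeta_values(1,3,4,5) complex_of_real_def complex_mult complex_cnj z0_phase algebra_simps del: One_nat_def)
  qed
  show "W_start (Edge 5 10) (Edge 10 11) = normalised (Edge 5 10) (Edge 10 11)"
  proof (rule normalisedI[where ph = "z0" and y = "s2"])
    have "rsqrt (rqint 2 / 1) = of_real (sqrt s2 * (s2) / (sqrt (mu 5) * sqrt (mu 11)))"
    proof (rule rsqrt_eq)
      show "rqint 2 = s2 * ((s2) * (s2)) * (imu 5 * imu 11) * (1)"
        by (simp add: table_simps del: One_nat_def)
      show "(0 :: real) < 1" by (simp add: rqint_values add_pos_pos)
      show "(0 :: real) \<le> s2" by simp
    qed simp_all
    then show "W_start (Edge 5 10) (Edge 10 11) = z0 * of_real (sqrt s2 * (s2) / (sqrt (mu (edge_tail (Edge 5 10))) * sqrt (mu (edge_head (Edge 10 11)))))"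
      by (simp add: W_start_def W_table_def Let_def zW_eq inverse_zW[unfolded zW_eq] mult.assoc del: One_nat_def)
    show "z0 * of_real (s2) = gauge (Edge 5 10) * t_start (Edge 5 10) (Edge 10 11)"
      by (simp add: gauge_def t_start_values zeta_values(1,3,4,5) complex_of_real_def complex_mult complex_cnj z0_phase algebra_simps del: One_nat_def)
  qed
qed

section \<open>Verification of the bigon and square equations\<close>

text \<open>The boundary of a square consists of four edges of one of the three kinds. In each case the two sides are expanded into polynomials in the square roots, which agree after reduction.\<close>

lemma square_layerI: "list_all (\<lambda>a. list_all (\<lambda>b. list_all (\<lambda>c. list_all (\<lambda>d. square_ok a b c d)
   (parallel (edge_tail b) (edge_head c))) (outof (edge_tail a))) (into (edge_head a))) layerI"
  apply (simp add: layerI_def into_values outof_values parallel_def del: One_nat_def)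
  apply (intro conjI)
  apply (rule square_okI; simp add: value_simps del: One_nat_def; linarith?)+
  done

lemma square_layerJ: "list_all (\<lambda>a. list_all (\<lambda>b. list_all (\<lambda>c. list_all (\<lambda>d. square_ok a b c d)
   (parallel (edge_tail b) (edge_head c))) (outof (edge_tail a))) (into (edge_head a))) layerJ"
  apply (simp add: layerJ_def into_values outof_values parallel_def del: One_nat_def)
  apply (intro conjI)
  apply (rule square_okI; simp add: value_simps del: One_nat_def; linarith?)+
  done

lemma square_layerK: "list_all (\<lambda>a. list_all (\<lambda>b. list_all (\<lambda>c. list_all (\<lambda>d. square_ok a b c d)
   (parallel (edge_tail b) (edge_head c))) (outof (edge_tail a))) (into (edge_head a))) layerK"
  apply (simp add: layerK_def into_values outof_values parallel_def del: One_nat_def)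
  apply (intro conjI)
  apply (rule square_okI; simp add: value_simps del: One_nat_def; linarith?)+
  done

definition bigon_ok :: "edge \<Rightarrow> edge \<Rightarrow> bool" where
  "bigon_ok e e' \<longleftrightarrow> (\<Sum>a\<leftarrow>outof (edge_head e). \<Sum>b\<leftarrow>parallel (edge_head a) (edge_tail e). tri3 a b e * cnj (tri3 a b e')) =
    Complex (if e = e' then mu (edge_tail e) * mu (edge_head e) * (1 + s3) / 2 else 0) 0"

lemma bigon_all: "list_all (\<lambda>e. list_all (bigon_ok e) (parallel (edge_tail e) (edge_head e))) edges"
  apply (simp add: edges_def into_values parallel_def del: One_nat_def)
  apply (intro conjI)
  apply ((unfold bigon_ok_def complex_eq_iff)[1], intro conjI; simp add: value_simps outof_values del: One_nat_def; linarith?)+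
  done

section \<open>The relations for W\<close>

lemma E412_simps [simp]: "verts E412 = {1..11}" "arcs E412 = set edges"
  "tail E412 = edge_tail" "head E412 = edge_head"
  by (auto simp: E412_def edges_def)

lemma edge_ends: "e \<in> set edges \<Longrightarrow> edge_tail e \<in> {1..11} \<and> edge_head e \<in> {1..11}"
  by (auto simp: edges_def)

lemma triangles_iff: "(e1, e2, e3) \<in> triangles \<longleftrightarrow> {e1, e2, e3} \<subseteq> set edges \<and>
    edge_head e1 = edge_tail e2 \<and> edge_head e2 = edge_tail e3 \<and> edge_head e3 = edge_tail e1"
  by (auto simp: triangles_def)

lemma finite_triangles [simp]: "finite triangles"
  by (rule finite_subset[of _ "set edges \<times> set edges \<times> set edges"]) (auto simp: triangles_iff)

lemma W_hom: "W \<in> Hom (oGPA E412 lam) [Neg] [Pos, Pos]"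
proof -
  have "x \<in> gpa_basis E412 [Neg] [Pos, Pos]" if nz: "W x \<noteq> 0" for x
  proof -
    obtain e1 e2 e3 where t: "(e1, e2, e3) \<in> triangles"
      and x: "((edge_tail e1, [(Neg, e3)]), (edge_tail e1, [(Pos, e1), (Pos, e2)])) = x"
    proof -
      obtain i where "i \<in> triangles" and i: "(if (case i of (e1, e2, e3) \<Rightarrow> ((edge_tail e1, [(Neg, e3)]),
          (edge_tail e1, [(Pos, e1), (Pos, e2)]))) = x then case i of (e1, e2, e3) \<Rightarrow> W_coeff e1 e2 e3 else 0) \<noteq> 0"
        using nz unfolding W_def lincomb_def by (rule sum.not_neutral_contains_not_neutral)
      then show ?thesis using that by (cases i) (auto split: if_splits)
    qed
    show ?thesis
      using t edge_ends by (auto simp: x[symmetric] gpa_basis_def spaths_def triangles_iff)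
  qed
  then show ?thesis by (simp add: oGPA_def)
qed

interpretation E412: trivalent E412 lam W
proof
  show "finite (verts E412)" "finite (arcs E412)" by simp_all
  show "tail E412 e \<in> verts E412" "head E412 e \<in> verts E412" if "e \<in> arcs E412" for e
    using that edge_ends by simp_all
  show "lam v > 0" if "v \<in> verts E412" for v
  proof -
    from that have v: "v \<in> {1..11}" by simp
    have "(1 + s3) / 2 > 0" by (simp add: add_pos_pos)
    then show ?thesis
      unfolding lam_mu[OF v] using mu_pos[OF v] by (rule mult_pos_pos)
  qed
  show "W \<in> Hom (oGPA E412 lam) [Neg] [Pos, Pos]" by (rule W_hom)
qed

lemma cell_W: "E412.cell e1 e2 e3 = (if (e1, e2, e3) \<in> triangles then W_coeff e1 e2 e3 else 0)"
proof -
  have "W ((edge_tail e1, [(Neg, e3)]), (edge_tail e1, [(Pos, e1), (Pos, e2)])) =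
      (\<Sum>i\<in>triangles. if i = (e1, e2, e3) then W_coeff e1 e2 e3 else 0)"
    unfolding W_def lincomb_def by (rule sum.cong) auto
  then show ?thesis by (simp add: E412.cell_def)
qed

lemma triangle_cases: "list_all (\<lambda>e1. list_all (\<lambda>e2. list_all (\<lambda>e3.
    (if edge_tail e1 \<le> 5 then W_start e1 e2 = normalised e1 e2 \<and> \<not> edge_tail e2 \<le> 5 \<and> \<not> edge_tail e3 \<le> 5
     else gauge e1 = 1 \<and> (edge_tail e2 \<le> 5) \<noteq> (edge_tail e3 \<le> 5)))
   (parallel (edge_head e2) (edge_tail e1))) (outof (edge_head e1))) edges"
  by (simp add: edges_def outof_values into_values parallel_def W_start_values gauge_def del: One_nat_def)

lemma set_parallel: "set (parallel v w) = {e \<in> set edges. edge_tail e = v \<and> edge_head e = w}"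
  by (auto simp: parallel_def into_def)

lemma triangle_start:
  assumes "(e1, e2, e3) \<in> triangles"
  shows "edge_tail e1 \<le> 5 \<Longrightarrow> W_start e1 e2 = normalised e1 e2"
    and "edge_tail e1 \<le> 5 \<Longrightarrow> \<not> edge_tail e2 \<le> 5 \<and> \<not> edge_tail e3 \<le> 5"
    and "\<not> edge_tail e1 \<le> 5 \<Longrightarrow> gauge e1 = 1"
    and "\<not> edge_tail e1 \<le> 5 \<Longrightarrow> (edge_tail e2 \<le> 5) \<noteq> (edge_tail e3 \<le> 5)"
proof -
  have "e1 \<in> set edges" "e2 \<in> set (outof (edge_head e1))" "e3 \<in> set (parallel (edge_head e2) (edge_tail e1))"
    using assms by (simp_all add: triangles_iff set_parallel outof_def)
  from triangle_cases[unfolded list_all_iff, rule_format, OF this]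
  show "edge_tail e1 \<le> 5 \<Longrightarrow> W_start e1 e2 = normalised e1 e2"
    and "edge_tail e1 \<le> 5 \<Longrightarrow> \<not> edge_tail e2 \<le> 5 \<and> \<not> edge_tail e3 \<le> 5"
    and "\<not> edge_tail e1 \<le> 5 \<Longrightarrow> gauge e1 = 1"
    and "\<not> edge_tail e1 \<le> 5 \<Longrightarrow> (edge_tail e2 \<le> 5) \<noteq> (edge_tail e3 \<le> 5)"
    by presburger+
qed

lemma triangle_rotate: "(e1, e2, e3) \<in> triangles \<Longrightarrow> (e2, e3, e1) \<in> triangles"
  by (auto simp: triangles_iff)

lemma tri3_rotate:
  assumes t: "(e1, e2, e3) \<in> triangles"
  shows "tri3 e2 e3 e1 = tri3 e1 e2 e3"
proof (cases "edge_tail e1 \<le> 5")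
  case True
  with triangle_start(2)[OF t True] show ?thesis by (simp add: tri3_def)
next
  case False
  with triangle_start(4)[OF t False] show ?thesis
    by (cases "edge_tail e2 \<le> 5") (simp_all add: tri3_def)
qed

definition edge_scale :: "nat \<Rightarrow> nat \<Rightarrow> complex" where
  "edge_scale v w = of_real (sqrt s2 / (sqrt (mu v) * sqrt (mu w)))"

lemma rsqrt_lam:
  assumes "v \<in> {1..11}" "w \<in> {1..11}"
  shows "rsqrt (lam v / lam w) = of_real (sqrt (mu v) / sqrt (mu w))"
proof -
  have "1 + s3 > 0" by (simp add: add_pos_pos)
  then have "lam v / lam w = mu v / mu w"
    using assms by (simp add: lam_mu)
  then show ?thesis by (simp add: rsqrt_def real_sqrt_divide)
qed

lemma edge_scale_rotate:
  assumes "a \<in> {1..11}" "b \<in> {1..11}" "c \<in> {1..11}"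
  shows "rsqrt (lam b / lam c) * edge_scale b a = edge_scale a c"
proof -
  have "sqrt (mu a) > 0" "sqrt (mu b) > 0" "sqrt (mu c) > 0"
    using mu_pos assms by (simp_all del: atLeastAtMost_iff)
  then have "sqrt (mu b) / sqrt (mu c) * (sqrt s2 / (sqrt (mu b) * sqrt (mu a))) =
      sqrt s2 / (sqrt (mu a) * sqrt (mu c))"
    by (simp add: field_simps)
  then show ?thesis
    unfolding rsqrt_lam[OF assms(2,3)] edge_scale_def of_real_mult[symmetric] by (rule arg_cong)
qed

text \<open>The rotational formula exactly transports the normalising factors, so the formula for triangles starting in \<open>{1..5}\<close> extends to all of them.\<close>

lemma W_coeff_value:
  assumes t: "(e1, e2, e3) \<in> triangles"
  shows "W_coeff e1 e2 e3 =
    edge_scale (edge_tail e1) (edge_tail e3) * (gauge e1 * gauge e2 * gauge e3) * tri3 e1 e2 e3"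
proof -
  note t2 = triangle_rotate[OF t] and t3 = triangle_rotate[OF triangle_rotate[OF t]]
  have verts: "edge_tail e1 \<in> {1..11}" "edge_tail e2 \<in> {1..11}" "edge_tail e3 \<in> {1..11}"
    using t edge_ends by (auto simp: triangles_iff)
  have heads: "edge_head e1 = edge_tail e2" "edge_head e2 = edge_tail e3" "edge_head e3 = edge_tail e1"
    using t by (auto simp: triangles_iff)
  have norm: "normalised a b = edge_scale (edge_tail a) (edge_head b) * gauge a * t_start a b" for a b
    by (simp add: normalised_def edge_scale_def)
  consider (1) "edge_tail e1 \<le> 5" "\<not> edge_tail e2 \<le> 5" "\<not> edge_tail e3 \<le> 5"
    | (2) "\<not> edge_tail e1 \<le> 5" "edge_tail e2 \<le> 5" "\<not> edge_tail e3 \<le> 5"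
    | (3) "\<not> edge_tail e1 \<le> 5" "\<not> edge_tail e2 \<le> 5" "edge_tail e3 \<le> 5"
    using triangle_start(2,4)[OF t] by blast
  then show ?thesis
  proof cases
    case 1
    then have "gauge e2 = 1" "gauge e3 = 1" "W_start e1 e2 = normalised e1 e2"
      using triangle_start(3)[OF t2] triangle_start(3)[OF t3] triangle_start(1)[OF t] by blast+
    then show ?thesis
      using 1 by (simp add: W_coeff_def tri3_def norm heads)
  next
    case 2
    then have g: "gauge e1 = 1" "gauge e3 = 1" "W_start e2 e3 = normalised e2 e3"
      using triangle_start(3)[OF t] triangle_start(3)[OF t3] triangle_start(1)[OF t2] by blast+
    have "W_coeff e1 e2 e3 = rsqrt (lam (edge_tail e2) / lam (edge_tail e3)) *
        edge_scale (edge_tail e2) (edge_tail e1) * (gauge e2 * t_start e2 e3)"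
      using 2 g by (simp add: W_coeff_def Let_def norm heads mult.assoc)
    then show ?thesis
      unfolding edge_scale_rotate[OF verts] using 2 g by (simp add: tri3_def mult.assoc)
  next
    case 3
    then have g: "gauge e1 = 1" "gauge e2 = 1" "W_start e3 e1 = normalised e3 e1"
      using triangle_start(3)[OF t] triangle_start(3)[OF t2] triangle_start(1)[OF t3] by blast+
    have "W_coeff e1 e2 e3 = rsqrt (lam (edge_tail e2) / lam (edge_tail e3)) *
        (rsqrt (lam (edge_tail e3) / lam (edge_tail e1)) * edge_scale (edge_tail e3) (edge_tail e2)) *
        (gauge e3 * t_start e3 e1)"
      using 3 g by (simp add: W_coeff_def Let_def norm heads mult.assoc)
    also have "\<dots> = edge_scale (edge_tail e1) (edge_tail e3) * (gauge e3 * t_start e3 e1)"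
      unfolding edge_scale_rotate[OF verts(2,3,1)]
      using edge_scale_rotate[OF verts] by (simp add: edge_scale_def mult.commute)
    finally show ?thesis
      using 3 g by (simp add: tri3_def mult.assoc)
  qed
qed

lemma cell_value:
  assumes "(e1, e2, e3) \<in> triangles"
  shows "E412.cell e1 e2 e3 =
    edge_scale (edge_tail e1) (edge_tail e3) * (gauge e1 * gauge e2 * gauge e3) * tri3 e1 e2 e3"
  using assms by (simp add: cell_W W_coeff_value)

lemma sum_edges:
  assumes "\<And>e. e \<in> set edges \<Longrightarrow> \<not> P e \<Longrightarrow> F e = (0 :: complex)"
  shows "(\<Sum>e\<in>set edges. F e) = (\<Sum>e\<leftarrow>filter P edges. F e)"
proof -
  have "distinct edges" by (simp add: edges_def)
  then have "(\<Sum>e\<leftarrow>filter P edges. F e) = (\<Sum>e\<in>set (filter P edges). F e)"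
    by (simp add: sum_list_distinct_conv_sum_set)
  also have "\<dots> = (\<Sum>e\<in>set edges. F e)"
    using assms by (intro sum.mono_neutral_left) auto
  finally show ?thesis ..
qed

lemma parallel_filter: "parallel v w = filter (\<lambda>e. edge_tail e = v \<and> edge_head e = w) edges"
  by (simp add: parallel_def into_def conj_commute)

lemma sum_list_cong: "(\<And>x. x \<in> set xs \<Longrightarrow> f x = g x) \<Longrightarrow> (\<Sum>x\<leftarrow>xs. f x) = (\<Sum>x\<leftarrow>xs. g x :: complex)"
  by (induction xs) auto

lemma sum_edges2:
  assumes "\<And>a b. a \<in> set edges \<Longrightarrow> b \<in> set edges \<Longrightarrow> \<not> (P a \<and> P' a b) \<Longrightarrow> F a b = (0 :: complex)"
  shows "(\<Sum>a\<in>set edges. \<Sum>b\<in>set edges. F a b) = (\<Sum>a\<leftarrow>filter P edges. \<Sum>b\<leftarrow>filter (P' a) edges. F a b)"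
proof -
  have "(\<Sum>a\<in>set edges. \<Sum>b\<in>set edges. F a b) = (\<Sum>a\<leftarrow>filter P edges. \<Sum>b\<in>set edges. F a b)"
    by (rule sum_edges) (rule sum.neutral, use assms in blast)
  also have "\<dots> = (\<Sum>a\<leftarrow>filter P edges. \<Sum>b\<leftarrow>filter (P' a) edges. F a b)"
  proof (rule sum_list_cong)
    fix a assume "a \<in> set (filter P edges)"
    then show "(\<Sum>b\<in>set edges. F a b) = (\<Sum>b\<leftarrow>filter (P' a) edges. F a b)"
      using assms by (intro sum_edges) auto
  qed
  finally show ?thesis .
qed

lemma edge_scale_square:
  assumes "v \<in> {1..11}" "w \<in> {1..11}"
  shows "edge_scale v w * edge_scale v w = of_real (s2 * (imu v * imu w))"
proof -
  have i: "imu v = 1 / mu v" "imu w = 1 / mu w"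
    using mu_imu[OF assms(1)] mu_imu[OF assms(2)] mu_pos[OF assms(1)] mu_pos[OF assms(2)]
    by (simp_all add: field_simps)
  have "sqrt s2 / (sqrt (mu v) * sqrt (mu w)) * (sqrt s2 / (sqrt (mu v) * sqrt (mu w))) =
      (sqrt s2 * sqrt s2) / ((sqrt (mu v) * sqrt (mu v)) * (sqrt (mu w) * sqrt (mu w)))"
    by (simp only: times_divide_times_eq mult_ac)
  also have "\<dots> = s2 * (imu v * imu w)"
    using mu_pos[OF assms(1)] mu_pos[OF assms(2)] by (simp only: real_sqrt_mult_self i) simp
  finally show ?thesis
    unfolding edge_scale_def of_real_mult[symmetric] by simp
qed

lemma cnj_edge_scale [simp]: "cnj (edge_scale v w) = edge_scale v w"
  by (simp add: edge_scale_def)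

lemma bigon_W: "Cmp (oGPA E412 lam) (gpa_dag W) W = Scl (oGPA E412 lam) (qint 2) (Ide (oGPA E412 lam) [Neg])"
proof (rule E412.bigon_relation)
  fix e e' assume e: "e \<in> arcs E412" "e' \<in> arcs E412" "head E412 e = head E412 e'" "tail E412 e = tail E412 e'"
  have v: "edge_tail e \<in> {1..11}" "edge_head e \<in> {1..11}"
    using edge_ends e by auto
  let ?c = "of_real (s2 * (imu (edge_head e) * imu (edge_tail e))) * (gauge e * cnj (gauge e'))"
  have "(\<Sum>e1\<in>arcs E412. \<Sum>e2\<in>arcs E412. E412.cell e1 e2 e * cnj (E412.cell e1 e2 e')) =
    (\<Sum>a\<leftarrow>outof (edge_head e). \<Sum>b\<leftarrow>parallel (edge_head a) (edge_tail e). E412.cell a b e * cnj (E412.cell a b e'))"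
    unfolding outof_def parallel_filter E412_simps
    by (rule sum_edges2) (auto simp: cell_W triangles_iff)
  also have "\<dots> = (\<Sum>a\<leftarrow>outof (edge_head e). \<Sum>b\<leftarrow>parallel (edge_head a) (edge_tail e). ?c * (tri3 a b e * cnj (tri3 a b e')))"
  proof (intro sum_list_cong)
    fix a b assume "a \<in> set (outof (edge_head e))" "b \<in> set (parallel (edge_head a) (edge_tail e))"
    then have t: "(a, b, e) \<in> triangles" "(a, b, e') \<in> triangles" "edge_tail a = edge_head e"
      using e by (auto simp: triangles_iff outof_def set_parallel)
    show "E412.cell a b e * cnj (E412.cell a b e') = ?c * (tri3 a b e * cnj (tri3 a b e'))"
    proof -
      have "E412.cell a b e * cnj (E412.cell a b e') =
        (gauge a * cnj (gauge a)) * (gauge b * cnj (gauge b)) * (?c * (tri3 a b e * cnj (tri3 a b e')))"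
        unfolding cell_value[OF t(1)] cell_value[OF t(2)] t(3) e(4)[unfolded E412_simps, symmetric]
          edge_scale_square[OF v(2,1), symmetric]
        by (simp only: complex_cnj_mult cnj_edge_scale mult_ac)
      then show ?thesis by (simp only: gauge_cnj mult_1_left)
    qed
  qed
  also have "\<dots> = ?c * (\<Sum>a\<leftarrow>outof (edge_head e). \<Sum>b\<leftarrow>parallel (edge_head a) (edge_tail e). tri3 a b e * cnj (tri3 a b e'))"
    by (simp add: sum_list_const_mult)
  also have "\<dots> = ?c * Complex (if e = e' then mu (edge_tail e) * mu (edge_head e) * (1 + s3) / 2 else 0) 0"
    using bigon_all[unfolded list_all_iff, rule_format, of e e'] e
    by (simp add: set_parallel bigon_ok_def)
  also have "\<dots> = (if e = e' then qint 2 else 0)"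
  proof (cases "e = e'")
    case True
    have "s2 * (imu (edge_head e) * imu (edge_tail e)) * (mu (edge_tail e) * mu (edge_head e) * (1 + s3) / 2) =
        s2 * (1 + s3) / 2 * ((mu (edge_tail e) * imu (edge_tail e)) * (mu (edge_head e) * imu (edge_head e)))"
      by simp
    also have "\<dots> = rqint 2"
      using mu_imu v by (simp add: rqint_values)
    finally show ?thesis
      using True by (simp add: gauge_cnj qint_rqint complex_of_real_def[symmetric] of_real_mult[symmetric]
          del: of_real_mult of_real_divide)
  next
    case False
    then show ?thesis by (simp add: Complex_eq)
  qed
  finally show "(\<Sum>e1\<in>arcs E412. \<Sum>e2\<in>arcs E412. E412.cell e1 e2 e * cnj (E412.cell e1 e2 e')) =
    (if e = e' then qint 2 else 0)" .
qed

text \<open>The gauge of the internal edge cancels; that of the cut edges will cancel against the other half.\<close>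

lemma square_half_value:
  assumes e: "e1 \<in> set edges" "e2 \<in> set edges" "h \<in> set edges" "h' \<in> set edges"
    "edge_head e1 = edge_head e2" "edge_head h = edge_tail e1" "edge_head h' = edge_tail e2" "edge_tail h = edge_tail h'"
  shows "E412.square_half e1 e2 h h' =
    edge_scale (edge_head e1) (edge_tail e1) * edge_scale (edge_tail e2) (edge_tail h) *
    (cnj (gauge e1) * gauge e2 * cnj (gauge h) * gauge h') * half e1 e2 h h'"
    (is "_ = ?c * _")
proof -
  have "E412.square_half e1 e2 h h' =
    (\<Sum>g\<leftarrow>parallel (edge_head e1) (edge_tail h). cnj (E412.cell g h e1) * E412.cell e2 g h')"
    unfolding E412.square_half_def parallel_filter E412_simps
    by (rule sum_edges) (auto simp: cell_W triangles_iff)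
  also have "\<dots> = (\<Sum>g\<leftarrow>parallel (edge_head e1) (edge_tail h). ?c * (cnj (tri3 g h e1) * tri3 e2 g h'))"
  proof (rule sum_list_cong)
    fix g assume "g \<in> set (parallel (edge_head e1) (edge_tail h))"
    then have t: "(g, h, e1) \<in> triangles" "(e2, g, h') \<in> triangles" "edge_tail g = edge_head e1"
      using e by (auto simp: triangles_iff set_parallel)
    show "cnj (E412.cell g h e1) * E412.cell e2 g h' = ?c * (cnj (tri3 g h e1) * tri3 e2 g h')"
    proof -
      have "cnj (E412.cell g h e1) * E412.cell e2 g h' =
        (gauge g * cnj (gauge g)) * (?c * (cnj (tri3 g h e1) * tri3 e2 g h'))"
        unfolding cell_value[OF t(1)] cell_value[OF t(2)] t(3) e(8)
        by (simp only: complex_cnj_mult cnj_edge_scale mult_ac)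
      then show ?thesis by (simp only: gauge_cnj mult_1_left)
    qed
  qed
  also have "\<dots> = ?c * half e1 e2 h h'"
    by (simp add: half_def sum_list_const_mult)
  finally show ?thesis .
qed

lemma square_half_zero:
  assumes "\<not> (edge_head h = edge_tail e1 \<and> edge_head h' = edge_tail e2 \<and> edge_tail h = edge_tail h')"
  shows "E412.square_half e1 e2 h h' = 0"
  unfolding E412.square_half_def by (rule sum.neutral) (use assms in \<open>auto simp: cell_W triangles_iff\<close>)

lemma set_layers: "set edges = set layerI \<union> set layerJ \<union> set layerK"
  by (auto simp: edges_def layerI_def layerJ_def layerK_def)

lemma square_ok_all:
  assumes "{e1, e2, f1, f2} \<subseteq> set edges" "edge_head e1 = edge_head e2" "edge_head f1 = edge_head f2"
    "edge_tail e1 = edge_tail f1" "edge_tail e2 = edge_tail f2"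
  shows "square_ok e1 e2 f1 f2"
proof -
  have e: "e2 \<in> set (into (edge_head e1))" "f1 \<in> set (outof (edge_tail e1))"
    "f2 \<in> set (parallel (edge_tail e2) (edge_head f1))"
    using assms by (simp_all add: into_def outof_def set_parallel)
  have "e1 \<in> set layerI \<or> e1 \<in> set layerJ \<or> e1 \<in> set layerK"
    using assms(1) unfolding set_layers by blast
  then show ?thesis
    using square_layerI[unfolded list_all_iff, rule_format, OF _ e]
      square_layerJ[unfolded list_all_iff, rule_format, OF _ e]
      square_layerK[unfolded list_all_iff, rule_format, OF _ e] by blast
qed

text \<open>What remains of the gauge is a phase of the boundary, which is 1 whenever the right-hand side is not zero.\<close>

lemma square_W:
  assumes e: "{e1, e2, f1, f2} \<subseteq> arcs E412" "head E412 e1 = head E412 e2" "head E412 f1 = head E412 f2"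
    "tail E412 e1 = tail E412 f1" "tail E412 e2 = tail E412 f2"
  shows "(\<Sum>h\<in>arcs E412. \<Sum>h'\<in>arcs E412. E412.square_half e1 e2 h h' * cnj (E412.square_half f1 f2 h h')) =
    (if e1 = f1 \<and> e2 = f2 then 1 else 0) +
    (if e1 = e2 \<and> f1 = f2 then of_real (sqrt (lam (head E412 e1) / lam (tail E412 e1)) *
      sqrt (lam (head E412 f1) / lam (tail E412 e1))) else 0)"
proof -
  define v w m n where "v = edge_tail e1" and "w = edge_tail e2" and "m = edge_head e1" and "n = edge_head f1"
  note vwmn = v_def w_def m_def n_def
  have ends: "edge_tail f1 = v" "edge_tail f2 = w" "edge_head e2 = m" "edge_head f2 = n"
    "edge_tail e1 = v" "edge_tail e2 = w" "edge_head e1 = m" "edge_head f1 = n"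
    and es: "e1 \<in> set edges" "e2 \<in> set edges" "f1 \<in> set edges" "f2 \<in> set edges"
    using e by (auto simp: vwmn)
  have verts: "v \<in> {1..11}" "w \<in> {1..11}" "m \<in> {1..11}" "n \<in> {1..11}"
    using es edge_ends unfolding vwmn by blast+
  define ph where "ph = cnj (gauge e1) * gauge e2 * (gauge f1 * cnj (gauge f2))"
  define k where "k = sqrt s2 / (sqrt (mu m) * sqrt (mu v)) * (sqrt s2 / (sqrt (mu n) * sqrt (mu v)))"
  let ?c = "of_real (k * (s2 * imu w)) * ph"
  have "(\<Sum>h\<in>arcs E412. \<Sum>h'\<in>arcs E412. E412.square_half e1 e2 h h' * cnj (E412.square_half f1 f2 h h')) =
    (\<Sum>h\<leftarrow>into v. \<Sum>h'\<leftarrow>parallel (edge_tail h) w. E412.square_half e1 e2 h h' * cnj (E412.square_half f1 f2 h h'))"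
    unfolding into_def parallel_filter E412_simps
  proof (rule sum_edges2)
    fix h h' assume "\<not> (edge_head h = v \<and> edge_tail h' = edge_tail h \<and> edge_head h' = w)"
    then have "E412.square_half e1 e2 h h' = 0"
      using ends by (intro square_half_zero) auto
    then show "E412.square_half e1 e2 h h' * cnj (E412.square_half f1 f2 h h') = 0" by simp
  qed
  also have "\<dots> = (\<Sum>h\<leftarrow>into v. \<Sum>h'\<leftarrow>parallel (edge_tail h) w.
      ?c * (of_real (imu (edge_tail h)) * (half e1 e2 h h' * cnj (half f1 f2 h h'))))"
  proof (intro sum_list_cong)
    fix h h' assume "h \<in> set (into v)" "h' \<in> set (parallel (edge_tail h) w)"
    then have h: "h \<in> set edges" "h' \<in> set edges" "edge_head h = v" "edge_head h' = w" "edge_tail h = edge_tail h'"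
      by (auto simp: into_def set_parallel)
    define x where "x = edge_tail h"
    have x: "x \<in> {1..11}" using h edge_ends unfolding x_def by blast
    have 1: "E412.square_half e1 e2 h h' = edge_scale m v * edge_scale w x *
        (cnj (gauge e1) * gauge e2 * cnj (gauge h) * gauge h') * half e1 e2 h h'"
      using square_half_value[of e1 e2 h h'] es h ends x_def by simp
    have 2: "E412.square_half f1 f2 h h' = edge_scale n v * edge_scale w x *
        (cnj (gauge f1) * gauge f2 * cnj (gauge h) * gauge h') * half f1 f2 h h'"
      using square_half_value[of f1 f2 h h'] es h ends x_def by simp
    have 3: "edge_scale m v * edge_scale n v = of_real k"
      by (simp only: edge_scale_def k_def of_real_mult)
    have "E412.square_half e1 e2 h h' * cnj (E412.square_half f1 f2 h h') =
      (edge_scale m v * edge_scale n v) * (edge_scale w x * edge_scale w x) * ph * (half e1 e2 h h' * cnj (half f1 f2 h h'))"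
    proof -
      have "E412.square_half e1 e2 h h' * cnj (E412.square_half f1 f2 h h') =
        (gauge h * cnj (gauge h)) * (gauge h' * cnj (gauge h')) *
        ((edge_scale m v * edge_scale n v) * (edge_scale w x * edge_scale w x) * ph * (half e1 e2 h h' * cnj (half f1 f2 h h')))"
        unfolding 1 2 ph_def by (simp only: complex_cnj_mult complex_cnj_cnj cnj_edge_scale mult_ac)
      then show ?thesis by (simp only: gauge_cnj mult_1_left)
    qed
    then show "E412.square_half e1 e2 h h' * cnj (E412.square_half f1 f2 h h') =
        ?c * (of_real (imu (edge_tail h)) * (half e1 e2 h h' * cnj (half f1 f2 h h')))"
      unfolding 3 edge_scale_square[OF verts(2) x] x_def[symmetric] of_real_mult by (simp only: mult_ac)
  qed
  also have "\<dots> = ?c * square_lhs e1 e2 f1 f2"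
    unfolding square_lhs_def ends
    by (simp add: sum_list_const_mult scaleR_conv_of_real del: of_real_mult)
  also have "square_lhs e1 e2 f1 f2 = of_real (square_rhs e1 e2 f1 f2)"
    using square_ok_all[of e1 e2 f1 f2] es ends by (simp add: square_ok_def complex_of_real_def)
  also have "?c * of_real (square_rhs e1 e2 f1 f2) = (if e1 = f1 \<and> e2 = f2 then 1 else 0) +
    (if e1 = e2 \<and> f1 = f2 then of_real (sqrt (mu m) * sqrt (mu n) / mu v) else 0)"
  proof -
    have pos: "mu v > 0" "mu w > 0" "mu m > 0" "mu n > 0"
      using verts mu_pos by blast+
    have imu: "imu w = 1 / mu w"
      using mu_imu[OF verts(2)] pos by (simp add: field_simps)
    have k: "k * (s2 * imu w) = 2 / (sqrt (mu m) * sqrt (mu n) * (mu v * mu w))"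
    proof -
      have "k = (sqrt s2 * sqrt s2) / (sqrt (mu m) * sqrt (mu n) * (sqrt (mu v) * sqrt (mu v)))"
        by (simp only: k_def times_divide_times_eq mult_ac)
      also have "\<dots> = s2 / (sqrt (mu m) * sqrt (mu n) * mu v)"
        using pos by (simp only: real_sqrt_mult_self abs_of_pos radicals_pos)
      finally show ?thesis using radical_squares(1) by (simp add: imu)
    qed
    have first: "k * (s2 * imu w) * (mu v * mu w * mu m / 2) = 1" if "e1 = f1"
    proof -
      have "m = n" using that by (simp add: vwmn)
      then show ?thesis unfolding k using pos by simp
    qed
    have second: "k * (s2 * imu w) * (mu v * mu m * mu n / 2) = sqrt (mu m) * sqrt (mu n) / mu v" if "e1 = e2"
    proof -
      have vw: "w = v" using that by (simp add: vwmn)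
      define q where "q = sqrt (mu m) * sqrt (mu n)"
      have "q > 0" using pos by (simp add: q_def)
      have "q * q = (sqrt (mu m) * sqrt (mu m)) * (sqrt (mu n) * sqrt (mu n))"
        unfolding q_def by (simp only: mult_ac)
      then have mn: "mu v * mu m * mu n = mu v * (q * q)"
        using pos by simp
      have "2 / (q * (x * x)) * (x * (q * q) / 2) = q / x" if "x > 0" for x
        using that \<open>q > 0\<close> by simp
      from this[OF pos(1)] show ?thesis
        unfolding k unfolding mn q_def[symmetric] vw .
    qed
    have ph: "ph = 1" if "e1 = f1 \<and> e2 = f2 \<or> e1 = e2 \<and> f1 = f2"
      using that
    proof
      assume "e1 = f1 \<and> e2 = f2"
      then have "ph = (gauge e1 * cnj (gauge e1)) * (gauge e2 * cnj (gauge e2))"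
        unfolding ph_def by (simp only: mult_ac)
      then show ?thesis by (simp only: gauge_cnj mult_1_left)
    next
      assume "e1 = e2 \<and> f1 = f2"
      then have "ph = (gauge e1 * cnj (gauge e1)) * (gauge f1 * cnj (gauge f1))"
        unfolding ph_def by (simp only: mult_ac)
      then show ?thesis by (simp only: gauge_cnj mult_1_left)
    qed
    have split: "k * (s2 * imu w) * square_rhs e1 e2 f1 f2 = (if e1 = f1 \<and> e2 = f2 then 1 else 0) +
        (if e1 = e2 \<and> f1 = f2 then sqrt (mu m) * sqrt (mu n) / mu v else 0)"
      unfolding square_rhs_def ends distrib_left using first second by auto
    show ?thesis
    proof (cases "e1 = f1 \<and> e2 = f2 \<or> e1 = e2 \<and> f1 = f2")
      case True
      have "?c * of_real (square_rhs e1 e2 f1 f2) = of_real (k * (s2 * imu w) * square_rhs e1 e2 f1 f2)"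
        using ph[OF True] by simp
      then show ?thesis unfolding split by auto
    next
      case False
      then show ?thesis by (auto simp: square_rhs_def)
    qed
  qed
  also have "sqrt (mu m) * sqrt (mu n) / mu v = sqrt (lam m / lam v) * sqrt (lam n / lam v)"
  proof -
    have "1 + s3 > 0" by (simp add: add_pos_pos)
    then have "lam m / lam v = mu m / mu v" "lam n / lam v = mu n / mu v"
      using verts by (simp_all add: lam_mu)
    then show ?thesis
      using mu_pos[OF verts(1)] by (simp add: real_sqrt_divide)
  qed
  finally show ?thesis unfolding E412_simps ends .
qed

lemma rotation_W:
  assumes "{e1, e2, e3} \<subseteq> arcs E412" "head E412 e1 = tail E412 e2" "head E412 e2 = tail E412 e3"
    "head E412 e3 = tail E412 e1"
  shows "E412.cell e1 e2 e3 = of_real (sqrt (lam (tail E412 e2) / lam (tail E412 e1))) * E412.cell e3 e1 e2"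
proof -
  have t: "(e1, e2, e3) \<in> triangles" "(e3, e1, e2) \<in> triangles"
    using assms by (auto simp: triangles_iff)
  have v: "edge_tail e1 \<in> {1..11}" "edge_tail e2 \<in> {1..11}" "edge_tail e3 \<in> {1..11}"
    using assms edge_ends by auto
  have scale: "of_real (sqrt (lam (edge_tail e2) / lam (edge_tail e1))) * edge_scale (edge_tail e3) (edge_tail e2) =
      edge_scale (edge_tail e1) (edge_tail e3)"
    using edge_scale_rotate[OF v(3,2,1)] by (simp add: rsqrt_def edge_scale_def mult.commute)
  show ?thesis
    unfolding cell_value[OF t(1)] cell_value[OF t(2)] E412_simps tri3_rotate[OF t(2)] scale[symmetric]
    by (simp add: mult_ac)
qed

lemma perron_frobenius_mu:
  "list_all (\<lambda>v. (\<Sum>e\<leftarrow>outof v. mu (edge_head e)) = (1 + s3) * mu v \<and>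
     (\<Sum>e\<leftarrow>into v. mu (edge_tail e)) = (1 + s3) * mu v) [1, 2, 3, 4, 5, 6, 7, 8, 9, 10, 11]"
  by (simp add: outof_values into_values mu_values algebra_simps radical_simps del: One_nat_def)

lemma perron_frobenius:
  assumes v: "v \<in> verts E412"
  shows "(\<Sum>e\<in>arcs E412. if step_src E412 (a, e) = v then lam (step_tgt E412 (a, e)) else 0) = rqint 3 * lam v"
proof -
  have v': "v \<in> {1..11}" using v by simp
  then have "v \<in> set [1, 2, 3, 4, 5, 6, 7, 8, 9, 10, 11]" by (simp, presburger)
  then have fp: "(\<Sum>e\<leftarrow>outof v. mu (edge_head e)) = (1 + s3) * mu v" "(\<Sum>e\<leftarrow>into v. mu (edge_tail e)) = (1 + s3) * mu v"
    using perron_frobenius_mu unfolding list_all_iff by blast+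
  have "distinct edges" by (simp add: edges_def)
  then have sums: "(\<Sum>e\<in>set edges. if P e then F e else 0) = (\<Sum>e\<leftarrow>filter P edges. F e)" for P and F :: "edge \<Rightarrow> real"
    by (simp add: sum_list_distinct_conv_sum_set sum.inter_filter[symmetric])
  have lam: "(\<Sum>e\<leftarrow>filter P edges. lam (F e)) = (1 + s3) / 2 * (\<Sum>e\<leftarrow>filter P edges. mu (F e))"
    if "\<And>e. e \<in> set edges \<Longrightarrow> F e \<in> {1..11}" for P F
  proof -
    have "map (\<lambda>e. lam (F e)) (filter P edges) = map (\<lambda>e. (1 + s3) / 2 * mu (F e)) (filter P edges)"
      by (rule map_cong[OF refl], rule lam_mu[OF that], simp)
    then show ?thesis by (simp only: sum_list_const_mult)
  qed
  show ?thesis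
  proof (cases a)
    case Pos
    then have "(\<Sum>e\<in>arcs E412. if step_src E412 (a, e) = v then lam (step_tgt E412 (a, e)) else 0) =
        (1 + s3) / 2 * (\<Sum>e\<leftarrow>outof v. mu (edge_head e))"
      using edge_ends lam[of edge_head "\<lambda>e. edge_tail e = v"] by (simp add: sums outof_def)
    then show ?thesis unfolding fp lam_mu[OF v'] rqint_values by simp
  next
    case Neg
    then have "(\<Sum>e\<in>arcs E412. if step_src E412 (a, e) = v then lam (step_tgt E412 (a, e)) else 0) =
        (1 + s3) / 2 * (\<Sum>e\<leftarrow>into v. mu (edge_tail e))"
      using edge_ends lam[of edge_tail "\<lambda>e. edge_head e = v"] by (simp add: sums into_def)
    then show ?thesis unfolding fp lam_mu[OF v'] rqint_values by simp
  qed
qed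

section \<open>The functor\<close>

lemma tdag_type [simp]: "src (tdag f) = tgt f" "tgt (tdag f) = src f"
  by (induction f) auto

lemma wt_tdag [simp]: "wt (tdag f) \<longleftrightarrow> wt f"
  by (induction f) auto

lemma coherent_kuperberg: "coherent kuperberg_rel"
proof -
  have "wt f \<and> wt g \<and> src f = src g \<and> tgt f = tgt g" if "kuperberg_rel f g" for f g
    using that
  proof (induction rule: kuperberg_rel.induct)
    case square
    show ?case
      using dual_Terms_type(1-3)[of TTri] dual_Terms_type(1-3)[of TTriDag] by simp
  qed (auto simp: Tvertex_def)
  then show ?thesis by (simp add: coherent_def)
qed

lemma coherent_semisimple: "coherent semisimple_rel"
  using coherent_kuperberg unfolding coherent_def
  by (auto elim!: semisimple_rel.cases simp: has_type_iff)

interpretation kuperberg: presentation kuperberg_rel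
  by unfold_locales (rule coherent_kuperberg)

interpretation semisimple: presentation semisimple_rel
  by unfold_locales (rule coherent_semisimple)

abbreviation "Target \<equiv> oGPA E412 lam"
abbreviation "value_of \<equiv> interp Target W (gpa_dag W)"

interpretation E412: vertex_pair Target W "gpa_dag W"
  by (intro vertex_pair.intro E412.planar_algebra_oGPA vertex_pair_axioms.intro W_hom E412.Y)

lemma value_of_tdag: "wt f \<Longrightarrow> value_of (tdag f) = gpa_dag (value_of f)"
proof (induction f)
  case (TTns f g)
  then show ?case using E412.gpa_dag_Tns[OF E412.interp_hom E412.interp_hom] by simp
next
  case (TCmp g f)
  then show ?case
    using E412.gpa_dag_Cmp[of "value_of f" "src f" "tgt f" "value_of g" "tgt g"]
      E412.interp_hom[of f] E412.interp_hom[of g] by simp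
qed (auto simp: E412.gpa_dag_Ide E412.gpa_dag_Ev E412.gpa_dag_Coev intro!: E412.gpa_eqI)

lemma kuperberg_sound: "kuperberg_rel f g \<Longrightarrow> value_of f = value_of g"
proof (induction rule: kuperberg_rel.induct)
  case (loop a)
  show ?case
    using E412.loop_relation[of a "rqint 3"] perron_frobenius by (simp add: qint_rqint)
next
  case rotation
  show ?case
    using E412.rotation_relation[OF rotation_W] by (simp add: Tvertex_def)
next
  case bigon
  show ?case using bigon_W by simp
next
  case square
  show ?case
    using E412.square_relation[OF square_W] by simp
next
  case (adjoint f g)
  then have "wt f" "wt g" using coherent_kuperberg by (auto simp: coherent_def)
  then show ?case using adjoint.IH by (simp add: value_of_tdag)
qed

text \<open>A negligible \<open>f\<close> is tested against its own adjoint.\<close>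

lemma semisimple_sound: "semisimple_rel f g \<Longrightarrow> value_of f = value_of g"
proof (induction rule: semisimple_rel.induct)
  case (kuperberg f g)
  then show ?case by (rule kuperberg_sound)
next
  case (kill f s t)
  then have f: "wt f" "src f = s" "tgt f = t" by (auto simp: has_type_iff)
  have "cls kuperberg_rel (tdag f) \<in> Hom P_sl3 t s"
    using f by (auto simp: P_sl3_def)
  then have "tr P_sl3 s (Cmp P_sl3 (cls kuperberg_rel (tdag f)) (cls kuperberg_rel f)) = Nul P_sl3 [] []"
    using kill(2) by (auto simp: negligible_def)
  then have "cls kuperberg_rel (tr Terms s (tdag f \<odot> f)) = cls kuperberg_rel (TNul [] [])"
    using f kuperberg.tr_cls[of "tdag f \<odot> f"] by (simp add: P_sl3_def)
  then have "planar_cong kuperberg_rel (TNul [] []) (tr Terms s (tdag f \<odot> f))"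
    using kuperberg.cls_eq_iff[of "TNul [] []" "tr Terms s (tdag f \<odot> f)"] by simp
  from E412.interp_cong[OF kuperberg_sound this]
  have "tr Target s (Cmp Target (gpa_dag (value_of f)) (value_of f)) = Nul Target [] []"
    using f by (simp add: value_of_tdag)
  then show ?case
    using E412.trace_positive[of "value_of f" s t] E412.interp_hom[of f] f by simp
qed

theorem theorem1p2:
  "\<exists>F. (tensor_functor P_sl3_ss (oGPA E412 lam) F \<and>
        F [Neg] [Pos, Pos] tri = W \<and> F [Pos, Pos] [Neg] tri_dag = gpa_dag W) \<and>
       (\<forall>F'. tensor_functor P_sl3_ss (oGPA E412 lam) F' \<and>
             F' [Neg] [Pos, Pos] tri = W \<and> F' [Pos, Pos] [Neg] tri_dag = gpa_dag W \<longrightarrow>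
             (\<forall>s t. \<forall>f\<in>Hom P_sl3_ss s t. F' s t f = F s t f))"
proof -
  define F where "F = (\<lambda>(s :: obj) (t :: obj) X. value_of (SOME f. f \<in> X))"
  note vp = E412.vertex_pair_axioms
  have F: "tensor_functor P_sl3_ss (oGPA E412 lam) F"
    unfolding P_sl3_ss_def F_def
    by (rule semisimple.tensor_functor_presented(1)[OF vp semisimple_sound])
  have F_cls: "F s t (cls semisimple_rel f) = value_of f" if "wt f" for s t f
    unfolding F_def by (rule semisimple.tensor_functor_presented(2)[OF vp semisimple_sound that])
  have uniq: "F' s t f = F s t f"
    if F': "tensor_functor P_sl3_ss (oGPA E412 lam) F'"
      and gens: "F' [Neg] [Pos, Pos] tri = W" "F' [Pos, Pos] [Neg] tri_dag = gpa_dag W"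
      and f: "f \<in> Hom P_sl3_ss s t" for F' s t f
  proof -
    obtain g where g: "f = cls semisimple_rel g" "wt g" "src g = s" "tgt g = t"
      using f by (auto simp: P_sl3_ss_def)
    then have "F' s t f = value_of g"
      using semisimple.tensor_functor_eq_interp[OF F'[unfolded P_sl3_ss_def] g(2)] gens
      by (simp add: tri_def tri_dag_def)
    then show ?thesis using F_cls g by simp
  qed
  have gen: "F [Neg] [Pos, Pos] tri = W" "F [Pos, Pos] [Neg] tri_dag = gpa_dag W"
    unfolding tri_def tri_dag_def by (simp_all only: F_cls wt.simps interp.simps)
  show ?thesis
  proof (intro exI[of _ F] conjI allI impI ballI)
    show "tensor_functor P_sl3_ss (oGPA E412 lam) F" by (rule F)
    show "F [Neg] [Pos, Pos] tri = W" "F [Pos, Pos] [Neg] tri_dag = gpa_dag W" by (rule gen)+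
    fix F' s t f
    assume "tensor_functor P_sl3_ss (oGPA E412 lam) F' \<and>
        F' [Neg] [Pos, Pos] tri = W \<and> F' [Pos, Pos] [Neg] tri_dag = gpa_dag W"
      and f: "f \<in> Hom P_sl3_ss s t"
    then show "F' s t f = F s t f" by (elim conjE) (rule uniq)
  qed
qed

end
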